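(* Let $1\le p\le q$, $n=p+q$, $\mathfrak g_0=\mathfrak{su}(p,q)$. Let $w\in W^1$ and let $\mu$ be a $\mathfrak g$-dominant integral weight. The parameter $w(\rho+\mu)$ is unitary if and only if the following two conditions are satisfied: (1) $w\rho$ is a unitary point in the Hasse diagram of $\rho$, i.e., either $w\rho=\tilde\rho$, or $w\rho$ is an edge point; (2) if $w\rho$ is the $i$-th point on the $j$-th edge of the Hasse diagram, then $$(w\mu)_1=\dots=(w\mu)_j=(w\mu)_{n-i+1}=\dots=(w\mu)_n,$$ with dots standing for consecutive coordinates. In other words, if $w\rho$ is the $i$-th point on the $j$-th edge of the Hasse diagram of $\rho$, then the regular integral modules with parameters in the Weyl chamber of $w\rho$ are unitary exactly in the reduced translation cone of dimension $p+q-i-j$ described by condition (2). In the chamber of $\tilde\rho$, the full translation cone consists of unitary modules.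
   Context: Setting: $\mathfrak g_0=\mathfrak{su}(p,q)$ with $1\le p\le q$, $n=p+q$, complexification $\mathfrak g=\mathfrak{sl}(n,\mathbb C)$, $\mathfrak k=\mathfrak s(\mathfrak{gl}(p,\mathbb C)\oplus\mathfrak{gl}(q,\mathbb C))$. Weights of the diagonal Cartan subalgebra are written as $n$-tuples (modulo adding a common constant), with a bar separating the first $p$ from the last $q$ coordinates. Positive roots are $\varepsilon_i-\varepsilon_j$, $i<j$; those with both indices $\le p$ or both $>p$ are compact, the others noncompact. $\rho=(\frac{n-1}2,\frac{n-3}2,\ldots,-\frac{n-1}2)$. For $\lambda$ $\mathfrak k$-dominant integral, $L(\lambda)$ is the irreducible highest weight $(\mathfrak g,K)$-module with highest weight $\lambda$; its parameter is $\Lambda=\lambda+\rho$, which satisfies $\Lambda_1>\dots>\Lambda_p$ and $\Lambda_{p+1}>\dots>\Lambda_n$. $L(\lambda)$, and equivalently $\Lambda$, is called unitary if $L(\lambda)$ admits a positive definite Hermitian form for which $\mathfrak g_0$ acts by skew-Hermitian operators. The Weyl group $W_{\mathfrak g}=S_n$ acts by permuting coordinates, and $W^1=\{w\in W_{\mathfrak g}: w\rho \text{ is } \mathfrak k\text{-dominant}\}$. A $\mathfrak g$-dominant integral weight is $\mu$ with $\mu_i-\mu_{i+1}\in\mathbb Z_{\ge0}$. The regular integral parameters are exactly $w(\rho+\mu)$ with $w\in W^1$ and $\mu$ such a weight; those with $w$ fixed are the parameters in the chamber of $w\rho$, and the corresponding set of all $\mu$ is the full translation cone (of dimension $n-1$).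 The Hasse diagram of $\rho$ is the set $\{w\rho: w\in W^1\}$ with the Bruhat order. Put $$\tilde\rho=\left(\tfrac{n-1}2-q,\tfrac{n-1}2-q-1,\ldots,-\tfrac{n-1}2\,\middle|\,\tfrac{n-1}2,\tfrac{n-1}2-1,\ldots,\tfrac{n-1}2-q+1\right).$$ To $w\in W^1$ attach the Young diagram $\mathrm{YD}_w$ with at most $p$ rows, whose $k$-th row ($1\le k\le p$) has $(w\rho)_k-\tilde\rho_k$ boxes. For $1\le i\le q$, $1\le j\le p$, $w\rho$ is called the $i$-th point on the $j$-th edge of the Hasse diagram if $\mathrm{YD}_w$ has exactly $j$ nonzero rows, each with $i$ boxes; such points are the edge points. For a parameter $\Lambda$, let $p'\in[1,p]$ be maximal such that $\Lambda_1,\ldots,\Lambda_{p'}$ decrease by exactly one at each step, and $q'\in[1,q]$ maximal such that $\Lambda_{n-q'+1},\ldots,\Lambda_n$ decrease by exactly one at each step. The known description of unitarity used by the paper: an integral parameter $\Lambda$ (all $\Lambda_i-\Lambda_j\in\mathbb Z$) is unitary if and only if $\Lambda_1-\Lambda_n\le p'+q'-1$, equivalently $\Lambda_{p'}-\Lambda_{n-q'+1}\le1$. *)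

theory Defs
  imports
    "HOL-Library.Function_Algebras"
    "HOL-Combinatorics.Permutations"
    "Jordan_Normal_Form.Schur_Decomposition"
begin

section \<open>Lie algebras\<close>

text \<open>Matrices are indexed from 0, following the library; weights are indexed from 1, following
  the mathematics. The two meet only in \<open>highest_weight_vector\<close> below.\<close>

definition sl :: "nat \<Rightarrow> complex mat set" where
  "sl n = {X \<in> carrier_mat n n. (\<Sum>i<n. X $$ (i, i)) = 0}"

definition sig_mat :: "nat \<Rightarrow> nat \<Rightarrow> complex mat" where
  "sig_mat p q = mat_diag (p + q) (\<lambda>i. if i < p then 1 else - 1)"

definition su :: "nat \<Rightarrow> nat \<Rightarrow> complex mat set" where
  "su p q = {X \<in> sl (p + q). mat_adjoint X * sig_mat p q = - (sig_mat p q * X)}"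

definition k_alg :: "nat \<Rightarrow> nat \<Rightarrow> complex mat set" where
  "k_alg p q = {X \<in> sl (p + q).
     \<forall>i<p + q. \<forall>j<p + q. (i < p) \<noteq> (j < p) \<longrightarrow> X $$ (i, j) = 0}"

definition cartan :: "nat \<Rightarrow> complex mat set" where
  "cartan n = {H \<in> sl n. diagonal_mat H}"

text \<open>Sum of the root spaces for the positive roots \<open>\<epsilon>\<^sub>i - \<epsilon>\<^sub>j\<close>, \<open>i < j\<close>.\<close>
definition n_plus :: "nat \<Rightarrow> complex mat set" where
  "n_plus n = {X \<in> carrier_mat n n. \<forall>i<n. \<forall>j<n. j \<le> i \<longrightarrow> X $$ (i, j) = 0}"

section \<open>Modules\<close>

text \<open>A module over \<open>sl (p + q)\<close>, carried by a subspace \<open>V\<close> of an ambient complex vector space.\<close>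
locale sl_module = vector_space scale
  for scale :: "complex \<Rightarrow> 'v::ab_group_add \<Rightarrow> 'v" +
  fixes p q :: nat and V :: "'v set" and act :: "complex mat \<Rightarrow> 'v \<Rightarrow> 'v"
  assumes subspace_V: "subspace V"
    and act_closed: "X \<in> sl (p + q) \<Longrightarrow> v \<in> V \<Longrightarrow> act X v \<in> V"
    and act_add_vec: "X \<in> sl (p + q) \<Longrightarrow> u \<in> V \<Longrightarrow> v \<in> V \<Longrightarrow> act X (u + v) = act X u + act X v"
    and act_scale_vec: "X \<in> sl (p + q) \<Longrightarrow> v \<in> V \<Longrightarrow> act X (scale c v) = scale c (act X v)"
    and act_add_mat: "X \<in> sl (p + q) \<Longrightarrow> Y \<in> sl (p + q) \<Longrightarrow> v \<in> V \<Longrightarrow>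
      act (X + Y) v = act X v + act Y v"
    and act_smult_mat: "X \<in> sl (p + q) \<Longrightarrow> v \<in> V \<Longrightarrow> act (c \<cdot>\<^sub>m X) v = scale c (act X v)"
    and act_bracket: "X \<in> sl (p + q) \<Longrightarrow> Y \<in> sl (p + q) \<Longrightarrow> v \<in> V \<Longrightarrow>
      act (X * Y - Y * X) v = act X (act Y v) - act Y (act X v)"
begin

definition stable :: "complex mat set \<Rightarrow> 'v set \<Rightarrow> bool" where
  "stable A W \<longleftrightarrow> subspace W \<and> W \<subseteq> V \<and> (\<forall>X\<in>A. \<forall>v\<in>W. act X v \<in> W)"

definition irreducible_module :: bool where
  "irreducible_module \<longleftrightarrow>
     V \<noteq> {0} \<and> (\<forall>W. stable (sl (p + q)) W \<longrightarrow> W = {0} \<or> W = V)"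

text \<open>As \<open>K = S(U(p) \<times> U(q))\<close> is connected, the \<open>K\<close>-action of a \<open>(\<gg>,K)\<close>-module is determined by
  the action of \<open>\<kk>\<close>, and the condition on the module is that this action is locally finite (and
  integrates to the group, which for a highest weight module only concerns the integrality of the
  highest weight).\<close>
definition locally_k_finite :: bool where
  "locally_k_finite \<longleftrightarrow>
     (\<forall>v\<in>V. \<exists>W B. stable (k_alg p q) W \<and> v \<in> W \<and> finite B \<and> W \<subseteq> span B)"

definition highest_weight_vector :: "(nat \<Rightarrow> real) \<Rightarrow> 'v \<Rightarrow> bool" where
  "highest_weight_vector lam v \<longleftrightarrow> v \<in> V \<and> v \<noteq> 0 \<and>
     (\<forall>X\<in>n_plus (p + q). act X v = 0) \<and>
     (\<forall>H\<in>cartan (p + q).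
        act H v = scale (\<Sum>i=1..p + q. complex_of_real (lam i) * H $$ (i - 1, i - 1)) v)"

text \<open>\<open>V\<close> is a realization of \<open>L(lam)\<close>. By irreducibility \<open>V\<close> is generated by any nonzero vector, in
  particular by the highest weight vector.\<close>
definition realizes_L :: "(nat \<Rightarrow> real) \<Rightarrow> bool" where
  "realizes_L lam \<longleftrightarrow>
     irreducible_module \<and> locally_k_finite \<and> (\<exists>v. highest_weight_vector lam v)"

definition positive_definite_hermitian :: "('v \<Rightarrow> 'v \<Rightarrow> complex) \<Rightarrow> bool" where
  "positive_definite_hermitian B \<longleftrightarrow>
     (\<forall>u\<in>V. \<forall>v\<in>V. \<forall>x\<in>V. B (u + v) x = B u x + B v x) \<and>
     (\<forall>c. \<forall>u\<in>V. \<forall>x\<in>V. B (scale c u) x = c * B u x) \<and>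
     (\<forall>u\<in>V. \<forall>x\<in>V. B x u = cnj (B u x)) \<and>
     (\<forall>u\<in>V. u \<noteq> 0 \<longrightarrow> Re (B u u) > 0)"

definition unitarizable :: bool where
  "unitarizable \<longleftrightarrow> (\<exists>B. positive_definite_hermitian B \<and>
     (\<forall>X\<in>su p q. \<forall>u\<in>V. \<forall>v\<in>V. B (act X u) v = - B u (act X v)))"

end

section \<open>Weights and parameters\<close>

text \<open>An \<open>n\<close>-tuple is a function on \<open>nat\<close> of which only the values on \<open>{1..n}\<close> matter.\<close>

definition rho :: "nat \<Rightarrow> nat \<Rightarrow> real" where
  "rho n i = (real n - 1) / 2 - (real i - 1)"

definition fun_scale :: "'a::field \<Rightarrow> (nat \<Rightarrow> 'a) \<Rightarrow> nat \<Rightarrow> 'a" where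
  "fun_scale c f = (\<lambda>k. c * f k)"

lemma vector_space_fun_scale: "vector_space fun_scale"
  by unfold_locales (simp_all add: fun_scale_def fun_eq_iff algebra_simps)

text \<open>The parameter \<open>\<Lambda> = \<lambda> + \<rho>\<close> is unitary if \<open>L(\<lambda>)\<close> is. The module \<open>L(\<lambda>)\<close> is unique up to
  isomorphism, and as it has countable dimension it can be realized on a subspace of the space of
  all complex sequences.\<close>
definition unitary_parameter :: "nat \<Rightarrow> nat \<Rightarrow> (nat \<Rightarrow> real) \<Rightarrow> bool" where
  "unitary_parameter p q \<Lambda> \<longleftrightarrow>
     (\<exists>(V :: (nat \<Rightarrow> complex) set) act.
        sl_module fun_scale p q V act \<and>
        sl_module.realizes_L fun_scale p q V act (\<lambda>i. \<Lambda> i - rho (p + q) i) \<and>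
        sl_module.unitarizable fun_scale p q V act)"

definition weyl_act :: "(nat \<Rightarrow> nat) \<Rightarrow> (nat \<Rightarrow> real) \<Rightarrow> nat \<Rightarrow> real" where
  "weyl_act w x i = x (inv_into UNIV w i)"

definition compact_positive_root :: "nat \<Rightarrow> nat \<Rightarrow> nat \<Rightarrow> nat \<Rightarrow> bool" where
  "compact_positive_root p n i j \<longleftrightarrow> 1 \<le> i \<and> i < j \<and> j \<le> n \<and> (j \<le> p \<or> p < i)"

definition k_dominant :: "nat \<Rightarrow> nat \<Rightarrow> (nat \<Rightarrow> real) \<Rightarrow> bool" where
  "k_dominant p n x \<longleftrightarrow> (\<forall>i j. compact_positive_root p n i j \<longrightarrow> x i - x j \<ge> 0)"

definition W1 :: "nat \<Rightarrow> nat \<Rightarrow> (nat \<Rightarrow> nat) set" where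
  "W1 p n = {w. w permutes {1..n} \<and> k_dominant p n (weyl_act w (rho n))}"

definition g_dominant_integral :: "nat \<Rightarrow> (nat \<Rightarrow> real) \<Rightarrow> bool" where
  "g_dominant_integral n \<mu> \<longleftrightarrow> (\<forall>i. 1 \<le> i \<and> i < n \<longrightarrow> \<mu> i - \<mu> (i + 1) \<in> \<nat>)"

text \<open>Each class of \<open>n\<close>-tuples modulo constants has exactly one representative with coordinate sum 0
  (and extended by 0 outside \<open>{1..n}\<close>); sets of weights whose dimension is taken consist of these.\<close>
definition translation_cone :: "nat \<Rightarrow> (nat \<Rightarrow> real) set" where
  "translation_cone n =
     {\<mu>. g_dominant_integral n \<mu> \<and> (\<Sum>i=1..n. \<mu> i) = 0 \<and> (\<forall>i. i \<notin> {1..n} \<longrightarrow> \<mu> i = 0)}"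

text \<open>The dimension of the real linear span.\<close>
definition cone_dim :: "(nat \<Rightarrow> real) set \<Rightarrow> nat" where
  "cone_dim = vector_space.dim fun_scale"

section \<open>The Hasse diagram of \<open>\<rho>\<close>\<close>

definition rho_tilde :: "nat \<Rightarrow> nat \<Rightarrow> nat \<Rightarrow> real" where
  "rho_tilde p q k =
     (if k \<le> p then (real (p + q) - 1) / 2 - real q - (real k - 1)
      else (real (p + q) - 1) / 2 - (real k - real p - 1))"

text \<open>Number of boxes in the \<open>k\<close>-th row of the Young diagram attached to \<open>w\<close>.\<close>
definition YD_row :: "nat \<Rightarrow> nat \<Rightarrow> (nat \<Rightarrow> nat) \<Rightarrow> nat \<Rightarrow> real" where
  "YD_row p q w k = weyl_act w (rho (p + q)) k - rho_tilde p q k"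

text \<open>\<open>w\<rho>\<close> is the \<open>i\<close>-th point on the \<open>j\<close>-th edge.\<close>
definition edge_point :: "nat \<Rightarrow> nat \<Rightarrow> (nat \<Rightarrow> nat) \<Rightarrow> nat \<Rightarrow> nat \<Rightarrow> bool" where
  "edge_point p q w i j \<longleftrightarrow> 1 \<le> i \<and> i \<le> q \<and> 1 \<le> j \<and> j \<le> p \<and>
     card {k \<in> {1..p}. YD_row p q w k \<noteq> 0} = j \<and>
     (\<forall>k\<in>{1..p}. YD_row p q w k \<noteq> 0 \<longrightarrow> YD_row p q w k = real i)"

definition is_rho_tilde :: "nat \<Rightarrow> nat \<Rightarrow> (nat \<Rightarrow> nat) \<Rightarrow> bool" where
  "is_rho_tilde p q w \<longleftrightarrow>
     (\<forall>k\<in>{1..p + q}. weyl_act w (rho (p + q)) k = rho_tilde p q k)"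

text \<open>\<open>(w\<mu>)\<^sub>1 = \<dots> = (w\<mu>)\<^sub>j = (w\<mu>)\<^sub>n\<^sub>-\<^sub>i\<^sub>+\<^sub>1 = \<dots> = (w\<mu>)\<^sub>n\<close>\<close>
definition reduced_cond :: "nat \<Rightarrow> (nat \<Rightarrow> nat) \<Rightarrow> nat \<Rightarrow> nat \<Rightarrow> (nat \<Rightarrow> real) \<Rightarrow> bool" where
  "reduced_cond n w i j \<mu> \<longleftrightarrow>
     (\<forall>a \<in> {1..j} \<union> {n - i + 1..n}. \<forall>b \<in> {1..j} \<union> {n - i + 1..n}.
        weyl_act w \<mu> a = weyl_act w \<mu> b)"

end

theory Submission
  imports Defs "HOL-Library.Poly_Mapping" "HOL-Library.Multiset" "HOL-Library.Countable_Set"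
begin

text \<open>Necessity. Let \<open>r \<le> p\<close> end the run of consecutive coordinates on the left and let \<open>m > p\<close> start
  the one on the right. In a unitary module the image of the \<open>\<kk>\<close>-highest weight vector of weight
  \<open>\<lambda> - (\<epsilon>\<^sub>r - \<epsilon>\<^sub>m)\<close> of \<open>\<pp>\<^sup>- \<otimes> F\<^sub>\<lambda>\<close> has a square norm that is a positive multiple of
  \<open>1 - (\<Lambda>\<^sub>r - \<Lambda>\<^sub>m)\<close>, so \<open>\<Lambda>\<^sub>r - \<Lambda>\<^sub>m \<le> 1\<close>. As \<open>\<Lambda>\<close> is regular and integral, either all of the first
  \<open>p\<close> coordinates are smaller than all of the last \<open>q\<close>, or the two runs together form one run of
  consecutive numbers; the latter is the edge case.

  Sufficiency. The remaining \<open>L(\<lambda>)\<close> occur in the Fock space of the dual pair \<open>(U(p,q), U(K))\<close>: they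
  are generated there by products of minors in the first \<open>r\<close> and the last \<open>s\<close> of the \<open>K = r + s\<close>
  columns, with \<open>r = p - j\<close>, \<open>s = q - i\<close> on an edge and \<open>r = p\<close>, \<open>s = q\<close> in the chamber of
  \<open>\<rho>\<close>-tilde. The Fock inner product makes them unitary, hence irreducible.\<close>

section \<open>Lowering operators and the necessary inequality\<close>

text \<open>Why testing the single pair \<open>(r, m)\<close> suffices and needs no decomposition of
  a tensor product: the denominators in the explicit lowering recursion are
  \<open>\<Lambda>_r - \<Lambda>_c - 1\<close> for \<open>c\<close> to the right of \<open>r\<close>
  in the left block and \<open>\<Lambda>_c - \<Lambda>_m - 1\<close> for \<open>c\<close> to the
  left of \<open>m\<close> in the right block. As one run stops at \<open>r\<close> and the other
  starts at \<open>m\<close>, they are all positive. Where the number of columns comes from: up to a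
  constant, \<open>K\<close> columns produce the weights \<open>(-K - A | B)\<close> with
  \<open>A\<close> and \<open>B\<close> nonnegative, the shift by \<open>K\<close> arising when
  derivatives are moved past variables. Hence \<open>\<lambda>_n - \<lambda>_1 \<ge> K\<close>. On
  an edge, condition (2) makes this difference exactly \<open>n - i - j\<close>; with
  \<open>K\<close> equal to it, \<open>j\<close> entries of \<open>A\<close> and \<open>i\<close>
  entries of \<open>B\<close> vanish, so \<open>p - j\<close> columns for \<open>A\<close> and
  \<open>q - i\<close> for \<open>B\<close> are enough. In the chamber of
  \<open>\<rho>\<close>-tilde the difference is at least \<open>n\<close>, and \<open>K = n\<close>
  leaves room for arbitrary \<open>A\<close> and \<open>B\<close>.\<close>

locale gl_ops = vector_space scale
  for scale :: "complex \<Rightarrow> 'v::ab_group_add \<Rightarrow> 'v" +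
  fixes V :: "'v set" and n :: nat and e :: "nat \<Rightarrow> nat \<Rightarrow> 'v \<Rightarrow> 'v"
  assumes subspace_V: "subspace V"
    and e_closed: "i < n \<Longrightarrow> j < n \<Longrightarrow> v \<in> V \<Longrightarrow> e i j v \<in> V"
    and e_add: "i < n \<Longrightarrow> j < n \<Longrightarrow> u \<in> V \<Longrightarrow> v \<in> V \<Longrightarrow> e i j (u + v) = e i j u + e i j v"
    and e_scale: "i < n \<Longrightarrow> j < n \<Longrightarrow> v \<in> V \<Longrightarrow> e i j (scale c v) = scale c (e i j v)"
    and e_comm: "i < n \<Longrightarrow> j < n \<Longrightarrow> k < n \<Longrightarrow> l < n \<Longrightarrow> v \<in> V \<Longrightarrow>
      e i j (e k l v) = e k l (e i j v) + (if j = k then e i l v else 0) - (if i = l then e k j v else 0)"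
begin

lemma e_zero: "i < n \<Longrightarrow> j < n \<Longrightarrow> e i j 0 = 0"
  using e_scale[of i j 0 0] subspace_0[OF subspace_V] by simp

lemma e_sum:
  assumes "i < n" "j < n" "\<And>x. x \<in> A \<Longrightarrow> f x \<in> V"
  shows "e i j (\<Sum>x\<in>A. f x) = (\<Sum>x\<in>A. e i j (f x))"
  using assms(3)
proof (induction A rule: infinite_finite_induct)
  case (insert x A)
  then have "sum f A \<in> V" "f x \<in> V" by (auto intro!: subspace_sum[OF subspace_V])
  then show ?case using insert e_add[OF assms(1,2)] by simp
qed (use e_zero assms in auto)

text \<open>This automorphism of \<open>\<gg>\<ll>(n)\<close> keeps the raising operators and exchanges the two blocks, so that
  one lowering construction serves both.\<close>
lemma gl_ops_dual:
  "gl_ops scale V n (\<lambda>i j v. - e (n - 1 - j) (n - 1 - i) v)"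
proof unfold_locales
  have neg: "e i j (- v) = - e i j v" if "i < n" "j < n" "v \<in> V" for i j v
    using e_scale[OF that, of "-1"] by simp
  show "subspace V" by (rule subspace_V)
  fix i j assume ij: "i < n" "j < n"
  then have ij': "n - 1 - j < n" "n - 1 - i < n" by auto
  { fix v assume v: "v \<in> V"
    show "- e (n - 1 - j) (n - 1 - i) v \<in> V"
      using e_closed[OF ij' v] subspace_neg[OF subspace_V] by blast
    show "- e (n - 1 - j) (n - 1 - i) (scale c v) = scale c (- e (n - 1 - j) (n - 1 - i) v)" for c
      using e_scale[OF ij' v] by simp
    show "- e (n - 1 - j) (n - 1 - i) (u + v)
        = - e (n - 1 - j) (n - 1 - i) u + - e (n - 1 - j) (n - 1 - i) v" if "u \<in> V" for u
      using e_add[OF ij' that v] by simp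
    fix k l assume kl: "k < n" "l < n"
    then have kl': "n - 1 - l < n" "n - 1 - k < n" by auto
    have eqs: "(n - 1 - i = n - 1 - l) = (i = l)" "(n - 1 - j = n - 1 - k) = (j = k)"
      using ij kl by auto
    show "- e (n - 1 - j) (n - 1 - i) (- e (n - 1 - l) (n - 1 - k) v) =
          - e (n - 1 - l) (n - 1 - k) (- e (n - 1 - j) (n - 1 - i) v)
          + (if j = k then - e (n - 1 - l) (n - 1 - i) v else 0)
          - (if i = l then - e (n - 1 - j) (n - 1 - k) v else 0)"
      unfolding neg[OF ij' e_closed[OF kl' v]] neg[OF kl' e_closed[OF ij' v]]
      using e_comm[OF ij' kl' v] eqs by auto }
qed

end

text \<open>Only indices below \<open>hi\<close> are used, so this is gl(hi) inside gl(n). With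
  \<rho> added to \<open>l\<close>, \<open>gap\<close> reads
  \<open>\<Lambda>_st - \<Lambda>_c \<noteq> 1\<close>: the denominators in \<open>lower\<close> do
  not vanish.\<close>

locale lowering = gl_ops scale V n e
  for scale :: "complex \<Rightarrow> 'v::ab_group_add \<Rightarrow> 'v" and V n e +
  fixes st hi :: nat and l :: "nat \<Rightarrow> complex"
  assumes st_less: "st < hi" and hi_le: "hi \<le> n"
    and gap: "st < c \<Longrightarrow> c < hi \<Longrightarrow> l st - l c + of_nat (c - st - 1) \<noteq> 0"
begin

text \<open>If \<open>u\<close> is a highest weight vector of weight \<open>l\<close>, the vectors \<open>f\<^sub>c = lower c u\<close> are the coordinates of
  the highest weight vector \<open>\<Sum> e\<^sub>c\<^sup>* \<otimes> f\<^sub>c\<close> of weight \<open>l - \<epsilon>\<^sub>s\<^sub>t\<close> in the tensor product with the dual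
  of the standard representation; the recursion is forced by its Casimir eigenvalue equation, which is
  \<open>lower_row\<close> below.\<close>
function lower :: "nat \<Rightarrow> 'v \<Rightarrow> 'v" where
  "lower c u = (if c \<le> st then u
     else scale (1 / (l st - l c + of_nat (c - st - 1))) (\<Sum>a=st..<c. e c a (lower a u)))"
  by auto
termination by (relation "Wellfounded.measure fst") auto

declare lower.simps [simp del]

lemma lower_st [simp]: "lower st u = u"
  by (simp add: lower.simps)

lemma lower_eq:
  assumes "st < c" "c < hi"
  shows "scale (l st - l c + of_nat (c - st - 1)) (lower c u) = (\<Sum>a=st..<c. e c a (lower a u))"
  using assms gap[OF assms] by (subst lower.simps) simp

text \<open>Stated for a general \<open>Z\<close> because it is applied both to \<open>V\<close>
  and, in \<open>weight_bound\<close>, to the vectors annihilated by the noncompact raising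
  operators.\<close>

lemma lower_in_subspace:
  assumes "subspace Z" "\<And>a c v. a < hi \<Longrightarrow> c < hi \<Longrightarrow> v \<in> Z \<Longrightarrow> e c a v \<in> Z"
    and "u \<in> Z" "c < hi"
  shows "lower c u \<in> Z"
  using assms(4)
proof (induction c rule: less_induct)
  case (less c)
  have "(\<Sum>a=st..<c. e c a (lower a u)) \<in> Z"
    using less by (intro subspace_sum[OF assms(1)] assms(2)) auto
  then show ?case
    using assms(3) by (subst lower.simps) (auto intro: subspace_scale[OF assms(1)])
qed

lemma lower_closed:
  assumes "u \<in> V" "c < hi"
  shows "lower c u \<in> V"
  using subspace_V e_closed hi_le assms by (intro lower_in_subspace) auto

text \<open>\<open>lower c\<close> is a linear combination of words in block operators, so it
  commutes with every linear operator that commutes with these. This decouples the two blocks in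
  \<open>weight_bound\<close>.\<close>

lemma lower_commute:
  assumes T: "\<And>v. v \<in> V \<Longrightarrow> T v \<in> V" "\<And>u v. u \<in> V \<Longrightarrow> v \<in> V \<Longrightarrow> T (u + v) = T u + T v"
    "\<And>c v. v \<in> V \<Longrightarrow> T (scale c v) = scale c (T v)"
    "\<And>a c v. a < hi \<Longrightarrow> c < hi \<Longrightarrow> v \<in> V \<Longrightarrow> T (e c a v) = e c a (T v)"
    and u: "u \<in> V" and c: "c < hi"
  shows "T (lower c u) = lower c (T u)"
  using c
proof (induction c rule: less_induct)
  case (less c)
  have T0: "T 0 = 0" using T(3)[of 0 0] subspace_0[OF subspace_V] by simp
  have Tsum: "T (\<Sum>x\<in>A. f x) = (\<Sum>x\<in>A. T (f x))" if "finite A" "\<And>x. x \<in> A \<Longrightarrow> f x \<in> V" for A and f :: "nat \<Rightarrow> 'v"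
    using that
  proof (induction A rule: finite_induct)
    case (insert x A)
    then have "sum f A \<in> V" "f x \<in> V" by (auto intro!: subspace_sum[OF subspace_V])
    then show ?case using insert T(2) by simp
  qed (use T0 in auto)
  have mem: "e c a (lower a u) \<in> V" if "a < c" for a
    using that less.prems hi_le u by (intro e_closed lower_closed) auto
  show ?case
  proof (cases "c \<le> st")
    case True
    then show ?thesis by (simp add: lower.simps)
  next
    case False
    have "T (\<Sum>a=st..<c. e c a (lower a u)) = (\<Sum>a=st..<c. T (e c a (lower a u)))"
      by (rule Tsum) (use mem in auto)
    also have "\<dots> = (\<Sum>a=st..<c. e c a (lower a (T u)))"
      using less u by (intro sum.cong refl) (auto simp: T(4) lower_closed)
    finally have "T (\<Sum>a=st..<c. e c a (lower a u)) = (\<Sum>a=st..<c. e c a (lower a (T u)))" .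
    moreover have "(\<Sum>a=st..<c. e c a (lower a u)) \<in> V"
      by (rule subspace_sum[OF subspace_V]) (use mem in auto)
    ultimately show ?thesis
      using False by (simp add: lower.simps[of c] T(3))
  qed
qed

lemma lower_add:
  assumes "u \<in> V" "v \<in> V" "c < hi"
  shows "lower c (u + v) = lower c u + lower c v"
  using assms(3)
proof (induction c rule: less_induct)
  case (less c)
  have "(\<Sum>a=st..<c. e c a (lower a (u + v))) = (\<Sum>a=st..<c. e c a (lower a u) + e c a (lower a v))"
  proof (intro sum.cong refl)
    fix a assume "a \<in> {st..<c}"
    then show "e c a (lower a (u + v)) = e c a (lower a u) + e c a (lower a v)"
      using less hi_le assms lower_closed by (simp add: e_add)
  qed
  then show ?case
    by (simp add: lower.simps[of c] sum.distrib scale_right_distrib)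
qed

lemma lower_scale:
  assumes "u \<in> V" "c < hi"
  shows "lower c (scale x u) = scale x (lower c u)"
  using assms(2)
proof (induction c rule: less_induct)
  case (less c)
  have "(\<Sum>a=st..<c. e c a (lower a (scale x u))) = (\<Sum>a=st..<c. scale x (e c a (lower a u)))"
  proof (intro sum.cong refl)
    fix a assume "a \<in> {st..<c}"
    then show "e c a (lower a (scale x u)) = scale x (e c a (lower a u))"
      using less hi_le assms lower_closed by (simp add: e_scale)
  qed
  then show ?case
    by (simp add: lower.simps[of c] scale_sum_right[symmetric] mult.commute)
qed

lemma lower_sum:
  assumes "\<And>x. x \<in> A \<Longrightarrow> f x \<in> V" "c < hi"
  shows "lower c (\<Sum>x\<in>A. f x) = (\<Sum>x\<in>A. lower c (f x))"
  using assms(1)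
proof (induction A rule: infinite_finite_induct)
  case (insert x A)
  then have "sum f A \<in> V" "f x \<in> V" by (auto intro!: subspace_sum[OF subspace_V])
  then show ?case using insert lower_add assms(2) by simp
next
  case (infinite A)
  then show ?case using lower_scale[OF subspace_0[OF subspace_V] assms(2), of 0] by simp
next
  case empty
  then show ?case using lower_scale[OF subspace_0[OF subspace_V] assms(2), of 0] by simp
qed

context
  fixes u
  assumes u: "u \<in> V"
    and raise: "\<And>i j. i < j \<Longrightarrow> j < hi \<Longrightarrow> e i j u = 0"
    and weight: "\<And>i. i < hi \<Longrightarrow> e i i u = scale (l i) u"
begin

text \<open>Split the sum at \<open>a = i\<close>: the recursion gives the terms before, the weight
  gives the diagonal term, and each later term is one copy of \<open>lower i u\<close>; then
  \<open>l i\<close> cancels. The bound \<open>N\<close> is free because the induction in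
  \<open>lower_props\<close> needs the equation truncated at \<open>c\<close>, before
  \<open>lower c u\<close> itself is understood.\<close>

lemma lower_row_aux:
  assumes "N \<le> hi" "st \<le> i" "i < N"
    and wt: "e i i (lower i u) = scale (l i - (if i = st then 1 else 0) + 1) (lower i u)"
    and up: "\<And>a. i < a \<Longrightarrow> a < N \<Longrightarrow> e i a (lower a u) = lower i u"
  shows "(\<Sum>a=st..<N. e i a (lower a u)) = scale (l st + of_nat (N - 1 - st)) (lower i u)"
proof -
  have "{st..<N} = {st..<i} \<union> {i} \<union> {Suc i..<N}" using assms by auto
  then have "(\<Sum>a=st..<N. e i a (lower a u)) =
      (\<Sum>a=st..<i. e i a (lower a u)) + e i i (lower i u) + (\<Sum>a=Suc i..<N. e i a (lower a u))"
    by (simp add: sum.union_disjoint add.commute)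
  also have "(\<Sum>a=Suc i..<N. e i a (lower a u)) = (\<Sum>a=Suc i..<N. lower i u)"
    by (intro sum.cong refl up) auto
  also have "\<dots> = scale (of_nat (N - Suc i)) (lower i u)"
    by (simp add: sum_constant_scale)
  also have "(\<Sum>a=st..<i. e i a (lower a u)) = scale (if i = st then 0 else l st - l i + of_nat (i - st - 1)) (lower i u)"
    using lower_eq[of i u] assms by auto
  finally have "(\<Sum>a=st..<N. e i a (lower a u)) = scale ((if i = st then 0 else l st - l i + of_nat (i - st - 1))
      + (l i - (if i = st then 1 else 0) + 1) + of_nat (N - Suc i)) (lower i u)"
    unfolding wt by (simp only: scale_left_distrib)
  moreover have "(if i = st then 0 else l st - l i + of_nat (i - st - 1))
      + (l i - (if i = st then 1 else 0) + 1) + of_nat (N - Suc i) = l st + of_nat (N - 1 - st)"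
    using assms by (auto simp: of_nat_diff)
  ultimately show ?thesis by simp
qed

text \<open>These equations express that the tensor with coordinates \<open>lower c u\<close> is a
  highest weight vector of weight \<open>l - \<epsilon>_st\<close>. They are proved after
  multiplication by the denominator \<open>?d\<close>, which turns \<open>lower c u\<close> into a
  sum over earlier vectors.\<close>

lemma lower_props:
  assumes "st \<le> c" "c < hi"
  shows "(\<forall>i<hi. e i i (lower c u) = scale (l i - (if i = st then 1 else 0) + (if i = c then 1 else 0)) (lower c u))
    \<and> (\<forall>i j. i < j \<longrightarrow> j < hi \<longrightarrow> e i j (lower c u) = (if j = c \<and> st \<le> i then lower i u else 0))"
  using assms
proof (induction c rule: less_induct)
  case (less c)
  have wtI: "e i i (lower a u) = scale (l i - (if i = st then 1 else 0) + (if i = a then 1 else 0)) (lower a u)"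
    if "st \<le> a" "a < c" "i < hi" for a i using less that by auto
  have upI: "e i j (lower a u) = (if j = a \<and> st \<le> i then lower i u else 0)"
    if "st \<le> a" "a < c" "i < j" "j < hi" for a i j using less that by auto
  have mem: "lower a u \<in> V" if "a < hi" for a using lower_closed[OF u that] .
  have mem2: "e c a (lower a u) \<in> V" if "a < c" for a
    using that less.prems hi_le mem by (intro e_closed) auto
  show ?case
  proof (cases "c = st")
    case True
    then show ?thesis using raise weight by auto
  next
    case False
    then have c: "st < c" "c < hi" using less.prems by auto
    let ?d = "l st - l c + of_nat (c - st - 1)"
    have d: "?d \<noteq> 0" using gap[OF c] .
    have cancel: "x = y" if "scale ?d x = scale ?d y" for x y
      using that d by simp
    have exp: "scale ?d (e i j (lower c u)) = (\<Sum>a=st..<c. e c a (e i j (lower a u))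
        + (if j = c then e i a (lower a u) else 0) - (if i = a then e c j (lower a u) else 0))"
      if "i < hi" "j < hi" for i j
    proof -
      have "scale ?d (e i j (lower c u)) = e i j (scale ?d (lower c u))"
        using that hi_le mem c by (simp add: e_scale)
      also have "\<dots> = (\<Sum>a=st..<c. e i j (e c a (lower a u)))"
        unfolding lower_eq[OF c] using that hi_le mem2 by (intro e_sum) auto
      also have "\<dots> = (\<Sum>a=st..<c. e c a (e i j (lower a u))
        + (if j = c then e i a (lower a u) else 0) - (if i = a then e c j (lower a u) else 0))"
        using that hi_le mem c by (intro sum.cong refl e_comm) auto
      finally show ?thesis .
    qed
    have "e i i (lower c u) = scale (l i - (if i = st then 1 else 0) + (if i = c then 1 else 0)) (lower c u)"
      if i: "i < hi" for i
    proof (rule cancel)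
      have "e c a (e i i (lower a u)) + (if i = c then e i a (lower a u) else 0) - (if i = a then e c i (lower a u) else 0)
          = scale (l i - (if i = st then 1 else 0) + (if i = c then 1 else 0)) (e c a (lower a u))"
        if a: "a \<in> {st..<c}" for a
      proof -
        have "e c a (e i i (lower a u)) = scale (l i - (if i = st then 1 else 0) + (if i = a then 1 else 0)) (e c a (lower a u))"
          using a wtI[of a i] i hi_le c mem[of a] by (simp add: e_scale)
        then show ?thesis
          by (auto simp: scale_left_distrib scale_left_diff_distrib)
      qed
      then have "scale ?d (e i i (lower c u)) = (\<Sum>a=st..<c. scale (l i - (if i = st then 1 else 0) + (if i = c then 1 else 0)) (e c a (lower a u)))"
        unfolding exp[OF i i] by (intro sum.cong) auto
      also have "\<dots> = scale (l i - (if i = st then 1 else 0) + (if i = c then 1 else 0)) (scale ?d (lower c u))"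
        unfolding lower_eq[OF c] by (simp add: scale_sum_right)
      finally show "scale ?d (e i i (lower c u)) = scale ?d (scale (l i - (if i = st then 1 else 0) + (if i = c then 1 else 0)) (lower c u))"
        by (simp add: mult.commute)
    qed
    moreover have "e i j (lower c u) = (if j = c \<and> st \<le> i then lower i u else 0)"
      if ij: "i < j" "j < hi" for i j
    proof (rule cancel)
      have i: "i < hi" using ij by simp
      consider "j < c" | "j > c" | "j = c" by linarith
      then show "scale ?d (e i j (lower c u)) = scale ?d (if j = c \<and> st \<le> i then lower i u else 0)"
      proof cases
        case 1
        \<comment> \<open>For \<open>j < c\<close> the induction hypothesis contributes at
          \<open>a = j\<close> and the commutator at \<open>a = i\<close>; the two contributions are
          equal and cancel.\<close>
        have "e c a (e i j (lower a u)) + (if j = c then e i a (lower a u) else 0) - (if i = a then e c j (lower a u) else 0)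
          = (if a = j then if st \<le> i then e c j (lower i u) else 0 else 0) - (if a = i then e c j (lower i u) else 0)"
          if "a \<in> {st..<c}" for a
          using that upI[of a i j] ij 1 c hi_le by (auto simp: e_zero)
        then have "scale ?d (e i j (lower c u)) =
            (\<Sum>a=st..<c. (if a = j then if st \<le> i then e c j (lower i u) else 0 else 0) - (if a = i then e c j (lower i u) else 0))"
          unfolding exp[OF i ij(2)] by (intro sum.cong) auto
        also have "\<dots> = 0"
          unfolding sum_subtractf using 1 ij by (auto simp: sum.delta)
        finally show ?thesis using 1 by simp
      next
        case 2
        have "e c a (e i j (lower a u)) + (if j = c then e i a (lower a u) else 0) - (if i = a then e c j (lower a u) else 0) = 0"
          if "a \<in> {st..<c}" for a
          using that upI[of a i j] upI[of a c j] ij 2 c hi_le by (auto simp: e_zero)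
        then show ?thesis
          unfolding exp[OF i ij(2)] using 2 by (simp add: sum.neutral)
      next
        case 3
        have "e c a (e i j (lower a u)) + (if j = c then e i a (lower a u) else 0) - (if i = a then e c j (lower a u) else 0)
            = e i a (lower a u) - (if a = i then e c c (lower i u) else 0)"
          if "a \<in> {st..<c}" for a
          using that upI[of a i j] ij 3 c hi_le by (auto simp: e_zero)
        then have "scale ?d (e i j (lower c u)) =
            (\<Sum>a=st..<c. e i a (lower a u) - (if a = i then e c c (lower i u) else 0))"
          unfolding exp[OF i ij(2)] by (intro sum.cong) auto
        then have eq: "scale ?d (e i j (lower c u)) =
            (\<Sum>a=st..<c. e i a (lower a u)) - (if st \<le> i then e c c (lower i u) else 0)"
          using ij 3 by (simp add: sum_subtractf sum.delta)
        show ?thesis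
        proof (cases "st \<le> i")
          case True
          \<comment> \<open>This is where the denominator comes from: the truncated row sum has
            eigenvalue \<open>l st + of_nat (c - 1 - st)\<close>, \<open>e c c\<close> has weight
            \<open>l c\<close>, and the difference is \<open>?d\<close>.\<close>
          have "(\<Sum>a=st..<c. e i a (lower a u)) = scale (l st + of_nat (c - 1 - st)) (lower i u)"
            by (rule lower_row_aux) (use True ij 3 c upI wtI in auto)
          moreover have "e c c (lower i u) = scale (l c) (lower i u)"
            using wtI[of i c] True ij 3 c by auto
          ultimately show ?thesis
            unfolding eq using True 3 by (simp add: scale_left_diff_distrib[symmetric] algebra_simps)
        next
          case False
          then have "(\<Sum>a=st..<c. e i a (lower a u)) = 0"
            using upI ij 3 by (intro sum.neutral) auto
          then show ?thesis unfolding eq using False by simp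
        qed
      qed
    qed
    ultimately show ?thesis by blast
  qed
qed

lemma lower_row:
  assumes "st \<le> c" "c < hi"
  shows "(\<Sum>a=st..<hi. e c a (lower a u)) = scale (l st + of_nat (hi - 1 - st)) (lower c u)"
  using lower_props assms by (intro lower_row_aux) auto

end

end

section \<open>A positive definite form and the square norm inequality\<close>

locale gl_unitary = gl_ops scale V n e
  for scale :: "complex \<Rightarrow> 'v::ab_group_add \<Rightarrow> 'v" and V n e +
  fixes p :: nat and B :: "'v \<Rightarrow> 'v \<Rightarrow> complex"
  assumes B_add: "u \<in> V \<Longrightarrow> v \<in> V \<Longrightarrow> x \<in> V \<Longrightarrow> B (u + v) x = B u x + B v x"
    and B_scale: "u \<in> V \<Longrightarrow> x \<in> V \<Longrightarrow> B (scale c u) x = c * B u x"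
    and B_cnj: "u \<in> V \<Longrightarrow> x \<in> V \<Longrightarrow> B x u = cnj (B u x)"
    and B_pos: "u \<in> V \<Longrightarrow> u \<noteq> 0 \<Longrightarrow> Re (B u u) > 0"
    and B_adj: "i < p \<Longrightarrow> p \<le> j \<Longrightarrow> j < n \<Longrightarrow> u \<in> V \<Longrightarrow> v \<in> V \<Longrightarrow>
      B (e i j u) v = - B u (e j i v)"
begin

lemma B_zero: "x \<in> V \<Longrightarrow> B 0 x = 0"
  using B_scale[of 0 x 0] subspace_0[OF subspace_V] by simp

lemma B_sum_right:
  assumes "\<And>a. a \<in> A \<Longrightarrow> f a \<in> V" "x \<in> V"
  shows "B x (\<Sum>a\<in>A. f a) = (\<Sum>a\<in>A. B x (f a))"
  using assms(1)
proof (induction A rule: infinite_finite_induct)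
  case (insert a A)
  then have V: "sum f A \<in> V" "f a \<in> V" by (auto intro!: subspace_sum[OF subspace_V])
  have "B x (f a + sum f A) = cnj (B (f a + sum f A) x)"
    using V assms(2) subspace_add[OF subspace_V] by (intro B_cnj) auto
  also have "\<dots> = B x (f a) + B x (sum f A)"
    using B_add[OF V(2,1) assms(2)] B_cnj[OF _ assms(2)] V by simp
  finally show ?case using insert by simp
next
  case (infinite A)
  then show ?case using B_zero[OF assms(2)] B_cnj[OF subspace_0[OF subspace_V] assms(2)] by simp
next
  case empty
  then show ?case using B_zero[OF assms(2)] B_cnj[OF subspace_0[OF subspace_V] assms(2)] by simp
qed

text \<open>The vectors \<open>f a b\<close> below are the coordinates of the \<open>\<kk>\<close>-highest weight vector of weight
  \<open>\<lambda> - (\<epsilon>\<^sub>r - \<epsilon>\<^sub>m)\<close> in \<open>\<pp>\<^sup>- \<otimes> F\<^sub>\<lambda>\<close>; the square norm of its image in the module is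
  a positive multiple of the difference of the two sides.\<close>
lemma weight_bound:
  fixes l :: "nat \<Rightarrow> real"
  assumes v: "v \<in> V" "v \<noteq> 0"
    and raise: "\<And>i j. i < j \<Longrightarrow> j < n \<Longrightarrow> e i j v = 0"
    and weight: "\<And>i. i < n \<Longrightarrow> e i i v = scale (of_real (l i)) v"
    and r: "r < p" and m: "p \<le> m" "m < n"
    and gap_left: "\<And>c. r < c \<Longrightarrow> c < p \<Longrightarrow> l r - l c + real (c - r - 1) > 0"
    and gap_right: "\<And>c. p \<le> c \<Longrightarrow> c < m \<Longrightarrow> l c - l m + real (m - c - 1) > 0"
  shows "l r + real (p - 1 - r) \<le> l m - real (m - p)"
proof -
  interpret L: lowering scale V n e r p "\<lambda>i. of_real (l i)"
  proof
    fix c assume "r < c" "c < p"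
    then have "of_real (l r - l c + real (c - r - 1)) \<noteq> (0::complex)"
      using gap_left by (metis less_irrefl of_real_eq_0_iff)
    then show "complex_of_real (l r) - complex_of_real (l c) + of_nat (c - r - 1) \<noteq> 0" by simp
  qed (use r m in auto)
  interpret dual: gl_ops scale V n "\<lambda>i j v. - e (n - 1 - j) (n - 1 - i) v"
    by (rule gl_ops_dual)
  \<comment> \<open>Reversing the indices turns the right block \<open>{p..<n}\<close> into
    \<open>{..<n - p}\<close> and the start \<open>m\<close> into \<open>n - 1 - m\<close>, and
    negates the weights. In the original numbering the recursion runs from \<open>m\<close> down to
    \<open>p\<close>.\<close>
  interpret R: lowering scale V n "\<lambda>i j v. - e (n - 1 - j) (n - 1 - i) v" "n - 1 - m" "n - p"
    "\<lambda>i. - of_real (l (n - 1 - i))"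
  proof
    fix c assume c: "n - 1 - m < c" "c < n - p"
    then have "l (n - 1 - c) - l m + real (m - (n - 1 - c) - 1) > 0"
      using m by (intro gap_right) auto
    moreover have "m - (n - 1 - c) - 1 = c - (n - 1 - m) - 1" using c m by auto
    ultimately have "of_real (l (n - 1 - c) - l m + real (c - (n - 1 - m) - 1)) \<noteq> (0::complex)"
      by (metis less_irrefl of_real_eq_0_iff)
    then show "- complex_of_real (l (n - 1 - (n - 1 - m))) - - complex_of_real (l (n - 1 - c)) + of_nat (c - (n - 1 - m) - 1) \<noteq> 0"
      using m by (simp add: algebra_simps)
  qed (use m in auto)
  define g where "g b = R.lower (n - 1 - b) v" for b
  define f where "f a b = L.lower a (g b)" for a b
  define tau where "tau = l r + real (p - 1 - r)"
  define tau' where "tau' = l m - real (m - p)"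
  have zero: "R.lower c 0 = 0" if "c < n - p" for c
    using R.lower_scale[OF subspace_0[OF subspace_V] that, of 0] by simp
  have gV: "g b \<in> V" if "p \<le> b" "b < n" for b
    unfolding g_def using that v by (intro R.lower_closed) auto
  have fV: "f a b \<in> V" if "a < p" "p \<le> b" "b < n" for a b
    unfolding f_def using that gV by (intro L.lower_closed) auto
  have gT: "e i j (g b) = R.lower (n - 1 - b) (e i j v)" if "i < p" "j < p" "p \<le> b" "b < n" for i j b
    unfolding g_def
  proof (rule R.lower_commute)
    fix a c u assume "a < n - p" "c < n - p" "u \<in> V"
    moreover have "e i j (- e (n - 1 - a) (n - 1 - c) u) = - e i j (e (n - 1 - a) (n - 1 - c) u)"
      using e_scale[of i j "e (n - 1 - a) (n - 1 - c) u" "-1"] that m \<open>u \<in> V\<close> by (simp add: e_closed)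
    ultimately show "e i j (- e (n - 1 - a) (n - 1 - c) u) = - e (n - 1 - a) (n - 1 - c) (e i j u)"
      using e_comm[of i j "n - 1 - a" "n - 1 - c" u] that m by auto
  qed (use that m v e_closed e_add e_scale in auto)
  have g_raise: "e i j (g b) = 0" if "i < j" "j < p" "p \<le> b" "b < n" for i j b
    using gT[of i j b] that m raise[of i j] zero by auto
  have g_weight: "e i i (g b) = scale (of_real (l i)) (g b)" if "i < p" "p \<le> b" "b < n" for i b
  proof -
    have "e i i v = scale (of_real (l i)) v" using weight that m by simp
    then show ?thesis
      using gT[of i i b] that R.lower_scale[OF v(1), of "n - 1 - b" "of_real (l i)"]
      by (simp only: g_def)
  qed
  have f_row: "(\<Sum>a=r..<p. e c a (f a b)) = scale tau (f c b)"
    if "r \<le> c" "c < p" "p \<le> b" "b < n" for b c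
    using L.lower_row[of "g b" c] gV g_raise g_weight that by (simp add: f_def tau_def)
  \<comment> \<open>The row equation of the dual operators read backwards; the sign in the
    automorphism turns its eigenvalue into \<open>l m - (m - p)\<close>.\<close>
  have g_row: "(\<Sum>b=p..m. e b d (g b)) = scale tau' (g d)" if d: "p \<le> d" "d \<le> m" for d
  proof -
    have "(\<Sum>b=p..m. e b d (g b)) = (\<Sum>x=n - 1 - m..<n - p. e (n - 1 - x) d (g (n - 1 - x)))"
      by (rule sum.reindex_bij_witness[of _ "\<lambda>x. n - 1 - x" "\<lambda>b. n - 1 - b"]) (use m in auto)
    also have "\<dots> = - (\<Sum>x=n - 1 - m..<n - p. - e (n - 1 - x) (n - 1 - (n - 1 - d)) (R.lower x v))"
      using d m unfolding sum_negf minus_minus by (intro sum.cong) (auto simp: g_def)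
    also have "(\<Sum>x=n - 1 - m..<n - p. - e (n - 1 - x) (n - 1 - (n - 1 - d)) (R.lower x v)) =
      scale (- of_real (l (n - 1 - (n - 1 - m))) + of_nat (n - p - 1 - (n - 1 - m))) (R.lower (n - 1 - d) v)"
    proof (rule R.lower_row)
      fix i j assume "i < j" "j < n - p"
      then show "- e (n - 1 - j) (n - 1 - i) v = 0" using raise[of "n - 1 - j" "n - 1 - i"] by auto
    next
      fix i assume "i < n - p"
      then show "- e (n - 1 - i) (n - 1 - i) v = scale (- of_real (l (n - 1 - i))) v" using weight by auto
    qed (use d m v in auto)
    also have "- \<dots> = scale tau' (g d)"
    proof -
      have "n - p - 1 - (n - 1 - m) = m - p" "n - 1 - (n - 1 - m) = m" using m by auto
      then show ?thesis unfolding g_def tau'_def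
        by (simp add: scale_minus_left[symmetric] del: scale_minus_left)
    qed
    finally show ?thesis .
  qed
  have f_col: "(\<Sum>b=p..m. e b d (f a b)) = scale tau' (f a d)" if ad: "r \<le> a" "a < p" "p \<le> d" "d \<le> m" for a d
  proof -
    have "e b d (f a b) = L.lower a (e b d (g b))" if b: "p \<le> b" "b \<le> m" for b
      unfolding f_def
    proof (rule L.lower_commute)
      fix a c u assume "a < p" "c < p" "u \<in> V"
      then show "e b d (e c a u) = e c a (e b d u)"
        using e_comm[of b d c a u] ad b m by auto
    qed (use ad b m gV e_closed e_add e_scale in auto)
    then have "(\<Sum>b=p..m. e b d (f a b)) = L.lower a (\<Sum>b=p..m. e b d (g b))"
      using ad m gV e_closed by (subst L.lower_sum) auto
    then show ?thesis
      using ad m gV by (simp add: g_row L.lower_scale f_def)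
  qed
  \<comment> \<open>\<open>Z\<close> is stable under both blocks, because the commutator of a block
    operator with a noncompact raising operator is a combination of such raising operators. So it
    contains every \<open>f a b\<close>, even though these need not be highest weight
    vectors.\<close>
  define Z where "Z = {u \<in> V. \<forall>c d. c < p \<longrightarrow> p \<le> d \<longrightarrow> d < n \<longrightarrow> e c d u = 0}"
  have Z_sub: "subspace Z"
    unfolding Z_def using subspace_V m
    by (intro subspaceI) (auto simp: subspace_0 subspace_add subspace_scale e_zero e_add e_scale)
  have Z_e: "e i j u \<in> Z" if "u \<in> Z" "i < n" "j < n" "(i < p) = (j < p)" for i j u
    using that e_closed e_comm[of _ _ i j u] e_zero m unfolding Z_def by auto
  have "v \<in> Z" using v raise unfolding Z_def by auto
  then have gZ: "g b \<in> Z" if "p \<le> b" "b < n" for b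
    unfolding g_def using that m
    by (intro R.lower_in_subspace[OF Z_sub] subspace_neg[OF Z_sub] Z_e) auto
  have fZ: "f a b \<in> Z" if "a < p" "p \<le> b" "b < n" for a b
    unfolding f_def using that gZ Z_e m by (intro L.lower_in_subspace[OF Z_sub]) auto
  define w where "w = (\<Sum>a=r..<p. \<Sum>b=p..m. e b a (f a b))"
  have wV: "w \<in> V" unfolding w_def using fV e_closed m
    by (intro subspace_sum[OF subspace_V]) auto
  \<comment> \<open>As \<open>f a b\<close> lies in \<open>Z\<close>, only the commutator of
    \<open>e c d\<close> and \<open>e b a\<close> acts on it. Its two terms produce the row sum over
    the left block and the column sum over the right block, with eigenvalues \<open>tau\<close> and
    \<open>tau'\<close>.\<close>
  have ew: "e c d w = scale (tau - tau') (f c d)" if cd: "r \<le> c" "c < p" "p \<le> d" "d \<le> m" for c d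
  proof -
    have "e c d w = (\<Sum>a=r..<p. \<Sum>b=p..m. e c d (e b a (f a b)))"
      unfolding w_def using cd m fV e_closed
      by (subst e_sum, auto intro!: subspace_sum[OF subspace_V] sum.cong e_sum)
    also have "\<dots> = (\<Sum>a=r..<p. \<Sum>b=p..m. (if d = b then e c a (f a b) else 0) - (if c = a then e b d (f a b) else 0))"
    proof (intro sum.cong refl)
      fix a b assume ab: "a \<in> {r..<p}" "b \<in> {p..m}"
      then have "e c d (f a b) = 0" using fZ[of a b] cd m unfolding Z_def by auto
      then show "e c d (e b a (f a b)) = (if d = b then e c a (f a b) else 0) - (if c = a then e b d (f a b) else 0)"
        using e_comm[of c d b a "f a b"] ab cd m fV[of a b] e_zero by auto
    qed
    also have "\<dots> = (\<Sum>a=r..<p. e c a (f a d)) - (\<Sum>a=r..<p. if c = a then \<Sum>b=p..m. e b d (f a b) else 0)"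
      unfolding sum_subtractf using cd by (intro arg_cong2[of _ _ _ _ minus] sum.cong) auto
    also have "(\<Sum>a=r..<p. if c = a then \<Sum>b=p..m. e b d (f a b) else 0) = (\<Sum>b=p..m. e b d (f c b))"
      using cd by auto
    finally show ?thesis
      using f_row f_col cd m by (simp add: scale_left_diff_distrib)
  qed
  have "B w w = (\<Sum>a=r..<p. B w (\<Sum>b=p..m. e b a (f a b)))"
    by (subst (2) w_def, rule B_sum_right) (use wV fV e_closed m in \<open>auto intro!: subspace_sum[OF subspace_V]\<close>)
  also have "\<dots> = (\<Sum>a=r..<p. \<Sum>b=p..m. B w (e b a (f a b)))"
    by (intro sum.cong refl B_sum_right) (use wV fV e_closed m in auto)
  also have "\<dots> = (\<Sum>a=r..<p. \<Sum>b=p..m. of_real (tau' - tau) * B (f a b) (f a b))"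
  proof (intro sum.cong refl)
    fix a b assume ab: "a \<in> {r..<p}" "b \<in> {p..m}"
    then have "B w (e b a (f a b)) = - B (e a b w) (f a b)"
      using B_adj[of a b w "f a b"] wV fV[of a b] m by auto
    also have "B (e a b w) (f a b) = of_real (tau - tau') * B (f a b) (f a b)"
      using ab m fV[of a b] ew[of a b] B_scale[of "f a b" "f a b" "of_real tau - of_real tau'"]
      by simp
    also have "- \<dots> = of_real (tau' - tau) * B (f a b) (f a b)"
      by (simp add: algebra_simps)
    finally show "B w (e b a (f a b)) = of_real (tau' - tau) * B (f a b) (f a b)" .
  qed
  finally have Bww: "Re (B w w) = (tau' - tau) * (\<Sum>a=r..<p. \<Sum>b=p..m. Re (B (f a b) (f a b)))"
    by (simp add: sum_distrib_left)
  have nonneg: "Re (B u u) \<ge> 0" if "u \<in> V" for u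
    using B_pos[OF that] B_zero[OF that] by (cases "u = 0") auto
  have "f r m = v" by (simp only: f_def g_def L.lower_st R.lower_st)
  then have "(\<Sum>b=p..m. Re (B (f r b) (f r b))) > 0"
    using m r v nonneg[OF fV] B_pos by (intro sum_pos2[of _ m]) auto
  moreover have "(\<Sum>b=p..m. Re (B (f a b) (f a b))) \<ge> 0" if "a < p" for a
    using m that by (intro sum_nonneg nonneg fV) auto
  ultimately have "(\<Sum>a=r..<p. \<Sum>b=p..m. Re (B (f a b) (f a b))) > 0"
    using r by (intro sum_pos2[of _ r "\<lambda>a. \<Sum>b=p..m. Re (B (f a b) (f a b))"]) auto
  moreover have "0 \<le> (tau' - tau) * (\<Sum>a=r..<p. \<Sum>b=p..m. Re (B (f a b) (f a b)))"
    using nonneg[OF wV] unfolding Bww .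
  ultimately have "tau' - tau \<ge> 0"
    by (simp add: zero_le_mult_iff)
  then show ?thesis by (simp add: tau_def tau'_def)
qed

end

section \<open>Matrix units and the real form su(p,q)\<close>

lemma mult_mat_index:
  assumes "X \<in> carrier_mat n n" "Y \<in> carrier_mat n n" "a < n" "b < n"
  shows "(X * Y) $$ (a, b) = (\<Sum>c<n. X $$ (a, c) * Y $$ (c, b))"
  using assms by (auto simp: scalar_prod_def lessThan_atLeast0 intro!: sum.cong)

lemma sl_carrier: "X \<in> sl n \<Longrightarrow> X \<in> carrier_mat n n"
  by (simp add: sl_def)

lemma su_iff:
  assumes "X \<in> sl (p + q)"
  shows "X \<in> su p q \<longleftrightarrow> (\<forall>a<p + q. \<forall>b<p + q.
    cnj (X $$ (b, a)) * (if b < p then 1 else - 1) = - ((if a < p then 1 else - 1) * X $$ (a, b)))"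
proof -
  let ?n = "p + q"
  note X = sl_carrier[OF assms]
  have S: "sig_mat p q \<in> carrier_mat ?n ?n" by (simp add: sig_mat_def)
  have A: "mat_adjoint X \<in> carrier_mat ?n ?n" using X by (simp add: mat_adjoint_def mat_of_rows_def)
  have Sij: "sig_mat p q $$ (a, b) = (if a = b then if a < p then 1 else - 1 else 0)"
    if "a < ?n" "b < ?n" for a b using that by (simp add: sig_mat_def mat_diag_def)
  have Aij: "mat_adjoint X $$ (a, b) = cnj (X $$ (b, a))" if "a < ?n" "b < ?n" for a b
    using that X by (simp add: mat_adjoint_def mat_of_rows_def)
  have 1: "(mat_adjoint X * sig_mat p q) $$ (a, b) = cnj (X $$ (b, a)) * (if b < p then 1 else - 1)"
    if "a < ?n" "b < ?n" for a b
  proof -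
    have "(mat_adjoint X * sig_mat p q) $$ (a, b)
        = (\<Sum>c<?n. if c = b then cnj (X $$ (b, a)) * (if b < p then 1 else - 1) else 0)"
      unfolding mult_mat_index[OF A S that] by (intro sum.cong refl) (use that in \<open>auto simp: Sij Aij\<close>)
    then show ?thesis using that by simp
  qed
  have 2: "(- (sig_mat p q * X)) $$ (a, b) = - ((if a < p then 1 else - 1) * X $$ (a, b))"
    if "a < ?n" "b < ?n" for a b
  proof -
    have "(sig_mat p q * X) $$ (a, b) = (\<Sum>c<?n. if c = a then (if a < p then 1 else - 1) * X $$ (a, b) else 0)"
      unfolding mult_mat_index[OF S X that] by (intro sum.cong refl) (use that in \<open>auto simp: Sij\<close>)
    then show ?thesis using that X S by simp
  qed
  have "mat_adjoint X * sig_mat p q = - (sig_mat p q * X) \<longleftrightarrow>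
    (\<forall>a<?n. \<forall>b<?n. (mat_adjoint X * sig_mat p q) $$ (a, b) = (- (sig_mat p q * X)) $$ (a, b))"
    (is "?M = ?N \<longleftrightarrow> ?R")
  proof
    assume ?R
    then show "?M = ?N" using X S A by (intro eq_matI) (simp_all del: index_mult_mat(1) index_uminus_mat(1))
  qed (simp only: simp_thms)
  then show ?thesis using assms 1 2 by (simp add: su_def)
qed

text \<open>Since only traceless matrices act, the diagonal matrix units are shifted by a multiple of the
  identity; this preserves the bracket relations of \<open>\<gg>\<ll>(n)\<close>.\<close>
definition gl_unit :: "nat \<Rightarrow> nat \<Rightarrow> nat \<Rightarrow> complex mat" where
  "gl_unit n i j = mat n n (\<lambda>(a, b).
     (if a = i \<and> b = j then 1 else 0) - (if i = j \<and> a = b then 1 / of_nat n else 0))"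

lemma gl_unit_carrier [simp]: "gl_unit n i j \<in> carrier_mat n n"
  by (simp add: gl_unit_def)

lemma gl_unit_dim [simp]: "dim_row (gl_unit n i j) = n" "dim_col (gl_unit n i j) = n"
  by (simp_all add: gl_unit_def)

lemma gl_unit_index: "a < n \<Longrightarrow> b < n \<Longrightarrow> gl_unit n i j $$ (a, b) =
    (if a = i \<and> b = j then 1 else 0) - (if i = j \<and> a = b then 1 / of_nat n else 0)"
  by (simp add: gl_unit_def)

lemma gl_unit_sl:
  assumes "i < n" "j < n"
  shows "gl_unit n i j \<in> sl n"
proof -
  have "(\<Sum>a<n. gl_unit n i j $$ (a, a)) =
      (\<Sum>a<n. (if a = i then if i = j then 1 else 0 else 0) - (if i = j then 1 / of_nat n else 0))"
    by (intro sum.cong) (auto simp: gl_unit_index)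
  also have "\<dots> = 0"
    using assms by (simp add: sum_subtractf)
  finally show ?thesis by (simp add: sl_def)
qed

lemma gl_unit_mult_index:
  assumes "i < n" "j < n" "k < n" "l < n" "a < n" "b < n"
  shows "(gl_unit n i j * gl_unit n k l) $$ (a, b) =
    (if a = i then gl_unit n k l $$ (j, b) else 0) - (if i = j then gl_unit n k l $$ (a, b) / of_nat n else 0)"
proof -
  have "(gl_unit n i j * gl_unit n k l) $$ (a, b) =
      (\<Sum>c<n. (if c = j then if a = i then gl_unit n k l $$ (j, b) else 0 else 0)
         - (if c = a then if i = j then gl_unit n k l $$ (a, b) / of_nat n else 0 else 0))"
    unfolding mult_mat_index[OF gl_unit_carrier gl_unit_carrier assms(5,6)]
    by (intro sum.cong refl) (use assms in \<open>auto simp: gl_unit_index[of _ _ _ i j] algebra_simps\<close>)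
  also have "\<dots> = (\<Sum>c<n. if c = j then if a = i then gl_unit n k l $$ (j, b) else 0 else 0)
         - (\<Sum>c<n. if c = a then if i = j then gl_unit n k l $$ (a, b) / of_nat n else 0 else 0)"
    by (rule sum_subtractf)
  finally show ?thesis using assms by simp
qed

text \<open>The Kronecker deltas are written as scalar factors so that the linearity axioms of the
  action apply directly.\<close>

lemma gl_unit_bracket:
  assumes "i < n" "j < n" "k < n" "l < n"
  shows "gl_unit n i j * gl_unit n k l - gl_unit n k l * gl_unit n i j =
    (if j = k then 1 else 0) \<cdot>\<^sub>m gl_unit n i l + (if i = l then - 1 else 0) \<cdot>\<^sub>m gl_unit n k j"
proof (rule eq_matI)
  fix a b
  assume "a < dim_row ((if j = k then 1 else 0) \<cdot>\<^sub>m gl_unit n i l + (if i = l then - 1 else 0) \<cdot>\<^sub>m gl_unit n k j)"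
    and "b < dim_col ((if j = k then 1 else 0) \<cdot>\<^sub>m gl_unit n i l + (if i = l then - 1 else 0) \<cdot>\<^sub>m gl_unit n k j)"
  then have ab: "a < n" "b < n" by auto
  have "(gl_unit n i j * gl_unit n k l - gl_unit n k l * gl_unit n i j) $$ (a, b)
     = (gl_unit n i j * gl_unit n k l) $$ (a, b) - (gl_unit n k l * gl_unit n i j) $$ (a, b)"
    using ab by (auto simp del: index_mult_mat(1))
  also have "\<dots> = ((if j = k then 1 else 0) \<cdot>\<^sub>m gl_unit n i l + (if i = l then - 1 else 0) \<cdot>\<^sub>m gl_unit n k j) $$ (a, b)"
    unfolding gl_unit_mult_index[OF assms ab] gl_unit_mult_index[OF assms(3,4,1,2) ab]
    using ab assms by (cases "i = j"; cases "k = l"; simp add: gl_unit_index diff_divide_distrib)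
  finally show "(gl_unit n i j * gl_unit n k l - gl_unit n k l * gl_unit n i j) $$ (a, b) =
     ((if j = k then 1 else 0) \<cdot>\<^sub>m gl_unit n i l + (if i = l then - 1 else 0) \<cdot>\<^sub>m gl_unit n k j) $$ (a, b)" .
qed auto

lemma sl_smult: "X \<in> sl n \<Longrightarrow> c \<cdot>\<^sub>m X \<in> sl n"
  by (auto simp: sl_def sum_distrib_left[symmetric])

lemma sl_add: "X \<in> sl n \<Longrightarrow> Y \<in> sl n \<Longrightarrow> X + Y \<in> sl n"
  by (auto simp: sl_def sum.distrib)

context sl_module
begin

lemma gl_ops_act:
  "gl_ops scale V (p + q) (\<lambda>i j. act (gl_unit (p + q) i j))"
proof unfold_locales
  let ?n = "p + q"
  fix i j k l v assume *: "i < ?n" "j < ?n" "k < ?n" "l < ?n" "v \<in> V"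
  note U = gl_unit_sl[of _ ?n]
  have "act (gl_unit ?n i j) (act (gl_unit ?n k l) v) - act (gl_unit ?n k l) (act (gl_unit ?n i j) v) =
     act ((if j = k then 1 else 0) \<cdot>\<^sub>m gl_unit ?n i l + (if i = l then - 1 else 0) \<cdot>\<^sub>m gl_unit ?n k j) v"
    using act_bracket[OF U U, of i j k l v] gl_unit_bracket[of i ?n j k l] * by simp
  also have "\<dots> = scale (if j = k then 1 else 0) (act (gl_unit ?n i l) v)
      + scale (if i = l then - 1 else 0) (act (gl_unit ?n k j) v)"
    using * U sl_smult[OF U] by (subst act_add_mat) (auto simp: act_smult_mat)
  finally show "act (gl_unit ?n i j) (act (gl_unit ?n k l) v) = act (gl_unit ?n k l) (act (gl_unit ?n i j) v)
    + (if j = k then act (gl_unit ?n i l) v else 0) - (if i = l then act (gl_unit ?n k j) v else 0)"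
    by (auto simp: algebra_simps)
qed (auto simp: subspace_V act_closed act_add_vec act_scale_vec gl_unit_sl)

text \<open>The root vectors \<open>?E\<close> and \<open>?F\<close> lie only in the
  complexification, but \<open>?E + ?F\<close> and \<open>\<i> ?E - \<i> ?F\<close> lie in the real
  form. As \<open>B\<close> is antilinear in its second argument, the two invariance relations
  differ in sign, and adding them isolates \<open>?E\<close> on the left and \<open>?F\<close> on
  the right.\<close>

lemma su_adjoint:
  assumes "positive_definite_hermitian B" "\<forall>X\<in>su p q. \<forall>u\<in>V. \<forall>v\<in>V. B (act X u) v = - B u (act X v)"
    and "i < p" "p \<le> j" "j < p + q" "u \<in> V" "v \<in> V"
  shows "B (act (gl_unit (p + q) i j) u) v = - B u (act (gl_unit (p + q) j i) v)"
proof -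
  let ?n = "p + q"
  let ?E = "gl_unit ?n i j" and ?F = "gl_unit ?n j i"
  have EF: "?E \<in> sl ?n" "?F \<in> sl ?n" using assms by (auto intro: gl_unit_sl)
  have Eind: "?E $$ (a, b) = (if a = i \<and> b = j then 1 else 0)" "?F $$ (a, b) = (if a = j \<and> b = i then 1 else 0)"
    if "a < ?n" "b < ?n" for a b using that assms by (auto simp: gl_unit_index)
  have X: "?E + ?F \<in> su p q"
    using assms by (subst su_iff) (auto simp: sl_add EF Eind)
  have Y: "\<i> \<cdot>\<^sub>m ?E + (- \<i>) \<cdot>\<^sub>m ?F \<in> su p q"
    using assms by (subst su_iff) (auto simp: sl_add sl_smult EF Eind)
  have V: "act ?E u \<in> V" "act ?F u \<in> V" "act ?E v \<in> V" "act ?F v \<in> V"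
    using assms EF act_closed by auto
  have B_add: "B (x + y) z = B x z + B y z" if "x \<in> V" "y \<in> V" "z \<in> V" for x y z
    using assms(1) that unfolding positive_definite_hermitian_def by blast
  have B_scale: "B (scale c x) z = c * B x z" if "x \<in> V" "z \<in> V" for x z c
    using assms(1) that unfolding positive_definite_hermitian_def by blast
  have B_cnj: "B z x = cnj (B x z)" if "x \<in> V" "z \<in> V" for x z
    using assms(1) that unfolding positive_definite_hermitian_def by blast
  have B_add_r: "B z (x + y) = B z x + B z y" if "x \<in> V" "y \<in> V" "z \<in> V" for x y z
    using B_add[OF that] B_cnj[OF subspace_add[OF subspace_V that(1,2)] that(3)]
      B_cnj[OF that(1,3)] B_cnj[OF that(2,3)] by simp
  have B_scale_r: "B z (scale c x) = cnj c * B z x" if "x \<in> V" "z \<in> V" for x z c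
    using B_scale[OF that] B_cnj[OF subspace_scale[OF subspace_V that(1)] that(2)] B_cnj[OF that]
    by simp
  have sV: "scale c x \<in> V" if "x \<in> V" for c x using subspace_scale[OF subspace_V] that .
  have 1: "B (act ?E u) v + B (act ?F u) v = - (B u (act ?E v) + B u (act ?F v))"
    using assms(2)[rule_format, OF X assms(6,7)]
    unfolding act_add_mat[OF EF assms(6)] act_add_mat[OF EF assms(7)]
      B_add[OF V(1,2) assms(7)] B_add_r[OF V(3,4) assms(6)] .
  have 2: "\<i> * B (act ?E u) v + - \<i> * B (act ?F u) v
      = - (cnj \<i> * B u (act ?E v) + cnj (- \<i>) * B u (act ?F v))"
    using assms(2)[rule_format, OF Y assms(6,7)]
    unfolding act_add_mat[OF sl_smult[OF EF(1)] sl_smult[OF EF(2)] assms(6)]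
      act_add_mat[OF sl_smult[OF EF(1)] sl_smult[OF EF(2)] assms(7)]
      act_smult_mat[OF EF(1) assms(6)] act_smult_mat[OF EF(2) assms(6)]
      act_smult_mat[OF EF(1) assms(7)] act_smult_mat[OF EF(2) assms(7)]
      B_add[OF sV[OF V(1)] sV[OF V(2)] assms(7)] B_add_r[OF sV[OF V(3)] sV[OF V(4)] assms(6)]
      B_scale[OF V(1) assms(7)] B_scale[OF V(2) assms(7)]
      B_scale_r[OF V(3) assms(6)] B_scale_r[OF V(4) assms(6)] .
  have "\<i> * (B (act ?E u) v - B (act ?F u) v) = \<i> * (B u (act ?E v) - B u (act ?F v))"
    using 2 by (simp add: algebra_simps)
  then have 3: "B (act ?E u) v - B (act ?F u) v = B u (act ?E v) - B u (act ?F v)"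
    by simp
  have "2 * B (act ?E u) v = - 2 * B u (act ?F v)"
  proof -
    have "2 * B (act ?E u) v = (B (act ?E u) v + B (act ?F u) v) + (B (act ?E u) v - B (act ?F u) v)" by simp
    also have "\<dots> = - 2 * B u (act ?F v)" unfolding 1 3 by simp
    finally show ?thesis .
  qed
  then show ?thesis by simp
qed

lemma unitarizable_weight_bound:
  assumes "unitarizable" "highest_weight_vector lam v"
    and r: "1 \<le> r" "r \<le> p" and m: "p < m" "m \<le> p + q"
    and gap_left: "\<And>c. r < c \<Longrightarrow> c \<le> p \<Longrightarrow> lam r - lam c + real (c - r - 1) > 0"
    and gap_right: "\<And>c. p < c \<Longrightarrow> c < m \<Longrightarrow> lam c - lam m + real (m - c - 1) > 0"
  shows "lam r + real (p - r) \<le> lam m - real (m - p - 1)"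
proof -
  let ?n = "p + q"
  obtain B where B: "positive_definite_hermitian B" "\<forall>X\<in>su p q. \<forall>u\<in>V. \<forall>v\<in>V. B (act X u) v = - B u (act X v)"
    using assms(1) unfolding unitarizable_def by blast
  interpret gl_ops scale V ?n "\<lambda>i j. act (gl_unit ?n i j)" by (rule gl_ops_act)
  interpret gl_unitary scale V ?n "\<lambda>i j. act (gl_unit ?n i j)" p B
  proof unfold_locales
    show "B (act (gl_unit ?n i j) u) v = - B u (act (gl_unit ?n j i) v)"
      if "i < p" "p \<le> j" "j < ?n" "u \<in> V" "v \<in> V" for i j u v
      by (rule su_adjoint[OF B that])
  qed (use B(1) in \<open>unfold positive_definite_hermitian_def, blast\<close>)+
  \<comment> \<open>\<open>gl_unit\<close> on the diagonal is a matrix unit minus a multiple of the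
    identity, so its weights are \<open>lam\<close> minus the average. The bound involves only
    differences, and the average drops out.\<close>
  define mean where "mean = (\<Sum>k=1..?n. lam k) / real ?n"
  note hw = assms(2)[unfolded highest_weight_vector_def]
  have "(lam (Suc (r - 1)) - mean) + real (p - 1 - (r - 1)) \<le> (lam (Suc (m - 1)) - mean) - real (m - 1 - p)"
  proof (rule weight_bound[where l = "\<lambda>i. lam (Suc i) - mean"])
    show "v \<in> V" "v \<noteq> 0" using hw by auto
    show "act (gl_unit ?n i j) v = 0" if "i < j" "j < ?n" for i j
    proof -
      have "gl_unit ?n i j \<in> n_plus ?n"
        using that by (auto simp: n_plus_def gl_unit_index)
      then show ?thesis using hw by blast
    qed
    show "act (gl_unit ?n i i) v = scale (complex_of_real (lam (Suc i) - mean)) v" if i: "i < ?n" for i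
    proof -
      have "gl_unit ?n i i \<in> cartan ?n"
        using i gl_unit_sl[OF i i] by (auto simp: cartan_def diagonal_mat_def gl_unit_index)
      moreover have "(\<Sum>k=1..?n. complex_of_real (lam k) * gl_unit ?n i i $$ (k - 1, k - 1)) = complex_of_real (lam (Suc i) - mean)"
      proof -
        have "(\<Sum>k=1..?n. complex_of_real (lam k) * gl_unit ?n i i $$ (k - 1, k - 1)) =
           (\<Sum>k=1..?n. (if k = Suc i then of_real (lam (Suc i)) else 0) - of_real (lam k) / of_nat ?n)"
          by (intro sum.cong) (auto simp: gl_unit_index algebra_simps)
        also have "\<dots> = complex_of_real (lam (Suc i) - mean)"
          using i by (simp add: sum_subtractf mean_def sum_divide_distrib)
        finally show ?thesis .
      qed
      ultimately show ?thesis using hw by simp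
    qed
  next
    fix c assume "r - 1 < c" "c < p"
    then show "lam (Suc (r - 1)) - mean - (lam (Suc c) - mean) + real (c - (r - 1) - 1) > 0"
      using gap_left[of "Suc c"] r by auto
  next
    fix c assume "p \<le> c" "c < m - 1"
    then show "lam (Suc c) - mean - (lam (Suc (m - 1)) - mean) + real (m - 1 - c - 1) > 0"
      using gap_right[of "Suc c"] m by auto
  qed (use r m in auto)
  then show ?thesis using r m by auto
qed

end

text \<open>Adding \<open>rho\<close> absorbs the index shifts: the positivity conditions of
  \<open>unitarizable_weight_bound\<close> become differences larger than 1, and its conclusion a
  difference of at most 1.\<close>

lemma unitary_parameter_bound:
  assumes "unitary_parameter p q \<Lambda>"
    and r: "1 \<le> r" "r \<le> p" and m: "p < m" "m \<le> p + q"
    and gap_left: "\<And>c. r < c \<Longrightarrow> c \<le> p \<Longrightarrow> \<Lambda> r - \<Lambda> c > 1"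
    and gap_right: "\<And>c. p < c \<Longrightarrow> c < m \<Longrightarrow> \<Lambda> c - \<Lambda> m > 1"
  shows "\<Lambda> r - \<Lambda> m \<le> 1"
proof -
  obtain V :: "(nat \<Rightarrow> complex) set" and act where mod: "sl_module fun_scale p q V act"
    and L: "sl_module.realizes_L fun_scale p q V act (\<lambda>i. \<Lambda> i - rho (p + q) i)"
    and U: "sl_module.unitarizable fun_scale p q V act"
    using assms(1) unfolding unitary_parameter_def by blast
  interpret sl_module fun_scale p q V act by (rule mod)
  obtain v where "highest_weight_vector (\<lambda>i. \<Lambda> i - rho (p + q) i) v"
    using L unfolding realizes_L_def by blast
  from unitarizable_weight_bound[OF U this r m]
  have "\<Lambda> r - rho (p + q) r + real (p - r) \<le> \<Lambda> m - rho (p + q) m - real (m - p - 1)"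
    using gap_left gap_right r m by (fastforce simp: rho_def of_nat_diff)
  then show ?thesis using r m by (simp add: rho_def of_nat_diff)
qed

section \<open>Unitary highest weight modules from operators\<close>

text \<open>Applying \<open>H - \<mu> j\<close> to the sum removes the component \<open>j\<close>
  and rescales the others by nonzero factors, so induction on \<open>I\<close> applies.\<close>

lemma (in vector_space) subspace_eigenvectors:
  assumes W: "subspace W" and H_add: "\<And>u v. H (u + v) = H u + H v"
    and H_scale: "\<And>c v. H (scale c v) = scale c (H v)"
    and HW: "\<And>w. w \<in> W \<Longrightarrow> H w \<in> W"
    and "finite I" and "\<And>d. d \<in> I \<Longrightarrow> H (x d) = scale (\<mu> d) (x d)"
    and "inj_on \<mu> I" and "(\<Sum>d\<in>I. x d) \<in> W" and "d \<in> I"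
  shows "x d \<in> W"
  using assms(5-9)
proof (induction I arbitrary: x d rule: finite_induct)
  case (insert j I)
  have H0: "H 0 = 0" using H_scale[of 0 0] by simp
  have Hsum: "H (\<Sum>d\<in>A. x d) = (\<Sum>d\<in>A. H (x d))" if "finite A" for A
    using that by (induction A rule: finite_induct) (simp_all add: H0 H_add)
  have "H (\<Sum>d\<in>insert j I. x d) = (\<Sum>d\<in>insert j I. scale (\<mu> d) (x d))"
    using insert.hyps insert.prems(1) by (subst Hsum) (auto intro!: sum.cong)
  then have "H (\<Sum>d\<in>insert j I. x d) - scale (\<mu> j) (\<Sum>d\<in>insert j I. x d)
      = (\<Sum>d\<in>insert j I. scale (\<mu> d - \<mu> j) (x d))"
    by (simp only: scale_sum_right sum_subtractf scale_left_diff_distrib)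
  also have "\<dots> = (\<Sum>d\<in>I. scale (\<mu> d - \<mu> j) (x d))"
    using insert.hyps by simp
  finally have sumI: "(\<Sum>d\<in>I. scale (\<mu> d - \<mu> j) (x d)) \<in> W"
    using W HW[OF insert.prems(3)] insert.prems(3) subspace_diff subspace_scale by metis
  have xI: "x d \<in> W" if "d \<in> I" for d
  proof -
    have "scale (\<mu> d - \<mu> j) (x d) \<in> W"
      by (rule insert.IH[of "\<lambda>d. scale (\<mu> d - \<mu> j) (x d)"])
        (use insert.prems sumI that in \<open>auto simp: H_scale mult.commute\<close>)
    then have "scale (1 / (\<mu> d - \<mu> j)) (scale (\<mu> d - \<mu> j) (x d)) \<in> W"
      using W subspace_scale by blast
    moreover have "\<mu> d \<noteq> \<mu> j"
      using insert.prems(2) insert.hyps that by (auto simp: inj_on_def)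
    ultimately show ?thesis by simp
  qed
  have "(\<Sum>d\<in>insert j I. x d) - (\<Sum>d\<in>I. x d) \<in> W"
    using W insert.prems(3) subspace_sum[OF W, of I x] xI subspace_diff by blast
  then have "x j \<in> W" using insert.hyps by simp
  then show ?case using xI insert.prems(4) by auto
qed simp

text \<open>What the Fock space has to supply. The ambient module may be highly reducible; the
  irreducible module is the submodule \<open>M\<close> generated by \<open>v0\<close>. The sign in
  \<open>B_adj\<close> is negative exactly for the noncompact roots.\<close>

locale hw_unitary = gl_ops scale UNIV "p + q" e
  for scale :: "complex \<Rightarrow> 'v::ab_group_add \<Rightarrow> 'v" and p q e +
  fixes B :: "'v \<Rightarrow> 'v \<Rightarrow> complex" and l :: "nat \<Rightarrow> real" and v0 :: 'v
  assumes pq: "p \<ge> 1"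
    and B_add: "B (u + v) x = B u x + B v x"
    and B_scale: "B (scale c u) x = c * B u x"
    and B_cnj: "B x u = cnj (B u x)"
    and B_pos: "u \<noteq> 0 \<Longrightarrow> Re (B u u) > 0"
    and B_adj: "i < p + q \<Longrightarrow> j < p + q \<Longrightarrow>
      B (e i j u) v = (if i < p then - 1 else 1) * (if j < p then - 1 else 1) * B u (e j i v)"
    and v0: "v0 \<noteq> 0"
    and raise: "i < j \<Longrightarrow> j < p + q \<Longrightarrow> e i j v0 = 0"
    and weight: "i < p + q \<Longrightarrow> e i i v0 = scale (of_real (l i)) v0"
    and k_finite: "\<exists>F S. subspace F \<and> u \<in> F \<and> finite S \<and> F \<subseteq> span S \<and>
      (\<forall>i<p + q. \<forall>j<p + q. (i < p) = (j < p) \<longrightarrow> (\<forall>x\<in>F. e i j x \<in> F))"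
begin

abbreviation "nn \<equiv> p + q"

lemma B_zero [simp]: "B 0 x = 0" "B x 0 = 0"
  using B_scale[of 0 0 x] B_cnj[of x 0] by simp_all

lemma B_right: "B x (u + v) = B x u + B x v" "B x (scale c u) = cnj c * B x u"
  using B_cnj[of x "u + v"] B_cnj[of x "scale c u"] B_add[of u v x] B_scale[of c u x]
    B_cnj[of x u] B_cnj[of x v] by simp_all

lemma B_sum: "B (\<Sum>a\<in>A. f a) x = (\<Sum>a\<in>A. B (f a) x)" "B x (\<Sum>a\<in>A. f a) = (\<Sum>a\<in>A. B x (f a))"
  by (induction A rule: infinite_finite_induct) (simp_all add: B_add B_right)

text \<open>Only lowering operators generate, so that each such step strictly lowers the degree used
  in \<open>M_decompose\<close>. Stability under the other operators is recovered in
  \<open>M_closed\<close> by commuting them towards \<open>v0\<close>.\<close>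

inductive_set M :: "'v set" where
  M_v0: "v0 \<in> M"
| M_add: "u \<in> M \<Longrightarrow> v \<in> M \<Longrightarrow> u + v \<in> M"
| M_scale: "u \<in> M \<Longrightarrow> scale c u \<in> M"
| M_lower: "u \<in> M \<Longrightarrow> j < i \<Longrightarrow> i < nn \<Longrightarrow> e i j u \<in> M"

lemma subspace_M: "subspace M"
  using M_add M_scale M_scale[OF M_v0, of 0] by (intro subspaceI) auto

lemma M_closed: "u \<in> M \<Longrightarrow> i < nn \<Longrightarrow> j < nn \<Longrightarrow> e i j u \<in> M"
proof (induction arbitrary: i j rule: M.induct)
  case M_v0
  consider "i < j" | "i = j" | "j < i" by linarith
  then show ?case
    using M_v0 subspace_0[OF subspace_M]
    by cases (auto simp: raise weight intro: M.intros)
next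
  case (M_lower u k m)
  then have "e i j (e m k u) = e m k (e i j u) + (if j = m then e i k u else 0) - (if i = k then e m j u else 0)"
    by (intro e_comm) auto
  moreover have "e m k (e i j u) \<in> M" by (rule M.M_lower) (use M_lower in auto)
  ultimately show ?case
    using M_lower subspace_0[OF subspace_M] by (auto intro!: subspace_add[OF subspace_M] subspace_diff[OF subspace_M])
qed (auto simp: e_add e_scale intro: M.intros)

definition act :: "complex mat \<Rightarrow> 'v \<Rightarrow> 'v" where
  "act X u = (\<Sum>i<nn. \<Sum>j<nn. scale (X $$ (i, j)) (e i j u))"

lemma act_M: "u \<in> M \<Longrightarrow> act X u \<in> M"
  unfolding act_def by (intro subspace_sum[OF subspace_M] subspace_scale[OF subspace_M] M_closed) auto

lemma act_add: "act X (u + v) = act X u + act X v"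
  by (simp add: act_def e_add scale_right_distrib sum.distrib)

lemma act_scale: "act X (scale c u) = scale c (act X u)"
  by (simp add: act_def e_scale scale_sum_right mult.commute)

lemma act_mat_add:
  assumes "X \<in> carrier_mat nn nn" "Y \<in> carrier_mat nn nn"
  shows "act (X + Y) u = act X u + act Y u"
  unfolding act_def sum.distrib[symmetric] using assms
  by (intro sum.cong refl) (simp add: scale_left_distrib)

lemma act_mat_smult:
  assumes "X \<in> carrier_mat nn nn"
  shows "act (c \<cdot>\<^sub>m X) u = scale c (act X u)"
  unfolding act_def scale_sum_right using assms
  by (intro sum.cong refl) simp

lemma act_act:
  "act X (act Y u) = (\<Sum>i<nn. \<Sum>j<nn. \<Sum>k<nn. \<Sum>m<nn. scale (X $$ (i, j) * Y $$ (k, m)) (e i j (e k m u)))"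
  unfolding act_def
  by (intro sum.cong refl) (simp add: e_sum e_scale scale_sum_right)

text \<open>The commutation rule contracts one index in each of two fourfold sums; what remains are
  the entries of \<open>X * Y\<close> and of \<open>Y * X\<close>.\<close>

lemma act_mat_bracket:
  assumes X: "X \<in> carrier_mat nn nn" and Y: "Y \<in> carrier_mat nn nn"
  shows "act (X * Y - Y * X) u = act X (act Y u) - act Y (act X u)"
proof -
  have swap: "act Y (act X u) = (\<Sum>i<nn. \<Sum>j<nn. \<Sum>k<nn. \<Sum>m<nn. scale (X $$ (i, j) * Y $$ (k, m)) (e k m (e i j u)))"
  proof -
    have "act Y (act X u) = (\<Sum>k<nn. \<Sum>m<nn. \<Sum>i<nn. \<Sum>j<nn. scale (Y $$ (k, m) * X $$ (i, j)) (e k m (e i j u)))"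
      by (rule act_act)
    also have "\<dots> = (\<Sum>k<nn. \<Sum>i<nn. \<Sum>m<nn. \<Sum>j<nn. scale (Y $$ (k, m) * X $$ (i, j)) (e k m (e i j u)))"
      by (intro sum.cong refl sum.swap)
    also have "\<dots> = (\<Sum>i<nn. \<Sum>k<nn. \<Sum>m<nn. \<Sum>j<nn. scale (Y $$ (k, m) * X $$ (i, j)) (e k m (e i j u)))"
      by (rule sum.swap)
    also have "\<dots> = (\<Sum>i<nn. \<Sum>k<nn. \<Sum>j<nn. \<Sum>m<nn. scale (Y $$ (k, m) * X $$ (i, j)) (e k m (e i j u)))"
      by (intro sum.cong refl sum.swap)
    also have "\<dots> = (\<Sum>i<nn. \<Sum>j<nn. \<Sum>k<nn. \<Sum>m<nn. scale (Y $$ (k, m) * X $$ (i, j)) (e k m (e i j u)))"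
      by (intro sum.cong refl sum.swap)
    finally show ?thesis by (simp add: mult.commute)
  qed
  have "act X (act Y u) - act Y (act X u) =
      (\<Sum>i<nn. \<Sum>j<nn. \<Sum>k<nn. \<Sum>m<nn. (if k = j then scale (X $$ (i, j) * Y $$ (k, m)) (e i m u) else 0)
        - (if m = i then scale (X $$ (i, j) * Y $$ (k, m)) (e k j u) else 0))"
    unfolding act_act[of X Y] swap sum_subtractf[symmetric] scale_right_diff_distrib[symmetric]
  proof (intro sum.cong refl)
    fix i j k m assume "i \<in> {..<nn}" "j \<in> {..<nn}" "k \<in> {..<nn}" "m \<in> {..<nn}"
    then have "e i j (e k m u) - e k m (e i j u) = (if k = j then e i m u else 0) - (if m = i then e k j u else 0)"
      using e_comm[of i j k m u] by auto
    then show "scale (X $$ (i, j) * Y $$ (k, m)) (e i j (e k m u) - e k m (e i j u)) =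
      (if k = j then scale (X $$ (i, j) * Y $$ (k, m)) (e i m u) else 0)
        - (if m = i then scale (X $$ (i, j) * Y $$ (k, m)) (e k j u) else 0)"
      by (simp add: scale_right_diff_distrib)
  qed
  also have "\<dots> = (\<Sum>i<nn. \<Sum>j<nn. \<Sum>k<nn. \<Sum>m<nn. if k = j then scale (X $$ (i, j) * Y $$ (k, m)) (e i m u) else 0)
     - (\<Sum>i<nn. \<Sum>j<nn. \<Sum>k<nn. \<Sum>m<nn. if m = i then scale (X $$ (i, j) * Y $$ (k, m)) (e k j u) else 0)"
    by (simp only: sum_subtractf)
  also have "(\<Sum>i<nn. \<Sum>j<nn. \<Sum>k<nn. \<Sum>m<nn. if k = j then scale (X $$ (i, j) * Y $$ (k, m)) (e i m u) else 0) =
     (\<Sum>i<nn. \<Sum>j<nn. \<Sum>m<nn. scale (X $$ (i, j) * Y $$ (j, m)) (e i m u))"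
  proof (rule sum.cong[OF refl], rule sum.cong[OF refl])
    fix i j assume "j \<in> {..<nn}"
    then show "(\<Sum>k<nn. \<Sum>m<nn. if k = j then scale (X $$ (i, j) * Y $$ (k, m)) (e i m u) else 0) =
      (\<Sum>m<nn. scale (X $$ (i, j) * Y $$ (j, m)) (e i m u))"
      by (subst sum.swap) simp
  qed
  also have "(\<Sum>i<nn. \<Sum>j<nn. \<Sum>k<nn. \<Sum>m<nn. if m = i then scale (X $$ (i, j) * Y $$ (k, m)) (e k j u) else 0) =
     (\<Sum>i<nn. \<Sum>j<nn. \<Sum>k<nn. scale (X $$ (i, j) * Y $$ (k, i)) (e k j u))"
    by (intro sum.cong refl) simp
  also have "(\<Sum>i<nn. \<Sum>j<nn. \<Sum>m<nn. scale (X $$ (i, j) * Y $$ (j, m)) (e i m u)) =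
     (\<Sum>i<nn. \<Sum>m<nn. \<Sum>j<nn. scale (X $$ (i, j) * Y $$ (j, m)) (e i m u))"
    by (intro sum.cong refl sum.swap)
  also have "\<dots> = (\<Sum>i<nn. \<Sum>m<nn. scale ((X * Y) $$ (i, m)) (e i m u))"
    by (intro sum.cong refl) (simp add: mult_mat_index[OF X Y] scale_sum_left del: index_mult_mat(1))
  also have "(\<Sum>i<nn. \<Sum>j<nn. \<Sum>k<nn. scale (X $$ (i, j) * Y $$ (k, i)) (e k j u)) =
      (\<Sum>j<nn. \<Sum>i<nn. \<Sum>k<nn. scale (X $$ (i, j) * Y $$ (k, i)) (e k j u))"
    by (rule sum.swap)
  also have "\<dots> = (\<Sum>j<nn. \<Sum>k<nn. \<Sum>i<nn. scale (X $$ (i, j) * Y $$ (k, i)) (e k j u))"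
    by (intro sum.cong refl sum.swap)
  also have "\<dots> = (\<Sum>k<nn. \<Sum>j<nn. \<Sum>i<nn. scale (X $$ (i, j) * Y $$ (k, i)) (e k j u))"
    by (rule sum.swap)
  also have "\<dots> = (\<Sum>k<nn. \<Sum>j<nn. scale ((Y * X) $$ (k, j)) (e k j u))"
    by (intro sum.cong refl) (simp add: mult_mat_index[OF Y X] scale_sum_left mult.commute del: index_mult_mat(1))
  also have "(\<Sum>i<nn. \<Sum>m<nn. scale ((X * Y) $$ (i, m)) (e i m u)) - \<dots> = act (X * Y - Y * X) u"
    unfolding act_def sum_subtractf[symmetric] scale_left_diff_distrib[symmetric]
    using X Y by (intro sum.cong refl) (simp del: index_mult_mat(1))
  finally show ?thesis by simp
qed

sublocale sl: sl_module scale p q M act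
  by unfold_locales
    (use act_M act_add act_scale act_mat_add act_mat_smult act_mat_bracket sl_carrier subspace_M in auto)

lemma act_gl_unit:
  assumes "i < nn" "j < nn" "i \<noteq> j"
  shows "act (gl_unit nn i j) u = e i j u"
proof -
  have "act (gl_unit nn i j) u = (\<Sum>a<nn. \<Sum>b<nn. if a = i then if b = j then e i j u else 0 else 0)"
    unfolding act_def using assms by (intro sum.cong refl) (auto simp: gl_unit_index)
  also have "\<dots> = (\<Sum>a<nn. if a = i then \<Sum>b<nn. if b = j then e i j u else 0 else 0)"
    by (intro sum.cong refl) auto
  finally show ?thesis using assms by simp
qed

text \<open>Half the sum of the positive coroots. It is traceless, so it belongs to the acting Lie
  algebra, and the root vector \<open>e i j\<close> changes its eigenvalue by the height
  \<open>j - i\<close>.\<close>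

definition grading :: "complex mat" where
  "grading = mat nn nn (\<lambda>(a, b). if a = b then (of_nat nn - 1) / 2 - of_nat a else 0)"

lemma grading_sl: "grading \<in> sl nn"
proof -
  have "(\<Sum>a<m. of_nat a :: complex) = of_nat m * (of_nat m - 1) / 2" for m
    by (induction m) (simp_all add: field_simps)
  then show ?thesis
    by (simp add: sl_def grading_def sum_subtractf)
qed

lemma act_grading: "act grading u = (\<Sum>i<nn. scale ((of_nat nn - 1) / 2 - of_nat i) (e i i u))"
proof -
  have "act grading u = (\<Sum>i<nn. \<Sum>j<nn. if j = i then scale ((of_nat nn - 1) / 2 - of_nat i) (e i i u) else 0)"
    unfolding act_def by (intro sum.cong refl) (auto simp: grading_def)
  then show ?thesis by simp
qed

lemma grading_lower:
  assumes "j < i" "i < nn" "act grading u = scale c u"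
  shows "act grading (e i j u) = scale (c - of_nat (i - j)) (e i j u)"
proof -
  let ?g = "\<lambda>k. (of_nat nn - 1) / 2 - (of_nat k :: complex)"
  have "act grading (e i j u) = (\<Sum>k<nn. scale (?g k) (e i j (e k k u))
      + (if k = i then scale (?g k) (e k j u) else 0) - (if k = j then scale (?g k) (e i k u) else 0))"
    unfolding act_grading using assms
    by (intro sum.cong refl) (auto simp: e_comm[of _ _ i j] scale_right_distrib scale_right_diff_distrib)
  also have "\<dots> = (\<Sum>k<nn. scale (?g k) (e i j (e k k u))) + scale (?g i) (e i j u) - scale (?g j) (e i j u)"
    unfolding sum.distrib sum_subtractf using assms by simp
  also have "(\<Sum>k<nn. scale (?g k) (e i j (e k k u))) = e i j (act grading u)"
    unfolding act_grading using assms by (simp add: e_sum e_scale)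
  also have "\<dots> = scale c (e i j u)"
    using assms by (simp add: e_scale)
  finally have "act grading (e i j u) = scale (c + ?g i - ?g j) (e i j u)"
    by (simp only: scale_left_distrib scale_left_diff_distrib)
  moreover have "c + ?g i - ?g j = c - of_nat (i - j)"
    using assms by (simp add: of_nat_diff)
  ultimately show ?thesis by simp
qed

definition top_degree :: complex where
  "top_degree = (\<Sum>i<nn. ((of_nat nn - 1) / 2 - of_nat i) * of_real (l i))"

lemma grading_v0: "act grading v0 = scale top_degree v0"
  unfolding act_grading top_degree_def by (simp add: weight scale_sum_left)

text \<open>\<open>M\<close> is \<open>\<complex> v0\<close> plus eigenvectors of \<open>grading\<close> for strictly smaller eigenvalues; this replaces the
  Poincare-Birkhoff-Witt theorem in the proof of irreducibility.\<close>
lemma M_decompose: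
  assumes "u \<in> M"
  shows "\<exists>x D c. u = (\<Sum>d\<le>D. x d) \<and> x 0 = scale c v0 \<and>
    (\<forall>d. act grading (x d) = scale (top_degree - of_nat d) (x d)) \<and> (\<forall>d>D. x d = 0) \<and>
    (\<forall>d\<ge>1. B (x d) v0 = 0)"
  using assms
proof induction
  case M_v0
  have z: "act grading 0 = 0" using act_scale[of grading 0 0] by simp
  show ?case
    by (rule exI[of _ "\<lambda>d. if d = 0 then v0 else 0"], rule exI[of _ 0], rule exI[of _ 1])
      (simp add: grading_v0 z)
next
  case (M_add u v)
  obtain x D c where x: "u = (\<Sum>d\<le>D. x d)" "x 0 = scale c v0" "\<forall>d>D. x d = 0" "\<forall>d\<ge>1. B (x d) v0 = 0"
    "\<forall>d. act grading (x d) = scale (top_degree - of_nat d) (x d)"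
    using M_add.IH(1) by blast
  obtain y D' c' where y: "v = (\<Sum>d\<le>D'. y d)" "y 0 = scale c' v0" "\<forall>d>D'. y d = 0" "\<forall>d\<ge>1. B (y d) v0 = 0"
    "\<forall>d. act grading (y d) = scale (top_degree - of_nat d) (y d)"
    using M_add.IH(2) by blast
  have "u = (\<Sum>d\<le>max D D'. x d)" unfolding x(1) using x(3) by (intro sum.mono_neutral_left) auto
  moreover have "v = (\<Sum>d\<le>max D D'. y d)" unfolding y(1) using y(3) by (intro sum.mono_neutral_left) auto
  ultimately have "u + v = (\<Sum>d\<le>max D D'. x d + y d)" by (simp add: sum.distrib)
  then show ?case using x y
    by (intro exI[of _ "\<lambda>d. x d + y d"] exI[of _ "max D D'"] exI[of _ "c + c'"])
      (auto simp: act_add B_add scale_left_distrib scale_right_distrib)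
next
  case (M_scale u a)
  obtain x D c where x: "u = (\<Sum>d\<le>D. x d)" "x 0 = scale c v0" "\<forall>d>D. x d = 0" "\<forall>d\<ge>1. B (x d) v0 = 0"
    "\<forall>d. act grading (x d) = scale (top_degree - of_nat d) (x d)"
    using M_scale.IH by blast
  then show ?case
    by (intro exI[of _ "\<lambda>d. scale a (x d)"] exI[of _ D] exI[of _ "a * c"])
      (auto simp: act_scale B_scale scale_sum_right mult.commute)
next
  case (M_lower u j i)
  obtain x D c where x: "u = (\<Sum>d\<le>D. x d)" "x 0 = scale c v0" "\<forall>d>D. x d = 0" "\<forall>d\<ge>1. B (x d) v0 = 0"
    "\<forall>d. act grading (x d) = scale (top_degree - of_nat d) (x d)"
    using M_lower.IH by blast
  define y where "y d = (if i - j \<le> d then e i j (x (d - (i - j))) else 0)" for d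
  have z: "act grading 0 = 0" using act_scale[of grading 0 0] by simp
  have "e i j u = (\<Sum>d\<le>D. e i j (x d))" unfolding x(1) using M_lower by (intro e_sum) auto
  also have "\<dots> = (\<Sum>d\<in>{i - j..D + (i - j)}. y d)"
    by (rule sum.reindex_bij_witness[of _ "\<lambda>d. d - (i - j)" "\<lambda>d. d + (i - j)"]) (auto simp: y_def)
  also have "\<dots> = (\<Sum>d\<le>D + (i - j). y d)"
    by (intro sum.mono_neutral_left) (auto simp: y_def)
  finally have "e i j u = (\<Sum>d\<le>D + (i - j). y d)" .
  moreover have "y 0 = scale 0 v0" using M_lower by (simp add: y_def)
  moreover have "act grading (y d) = scale (top_degree - of_nat d) (y d)" for d
    using grading_lower[OF M_lower(2,3) x(5)[rule_format, of "d - (i - j)"]]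
    by (auto simp: y_def z of_nat_diff)
  moreover have "y d = 0" if "d > D + (i - j)" for d
    using that x(3) M_lower e_zero by (auto simp: y_def)
  \<comment> \<open>The adjoint of a lowering operator is, up to sign, a raising operator, and these
    annihilate \<open>v0\<close>.\<close>
  moreover have "B (y d) v0 = 0" for d
    using M_lower raise[of j i] by (auto simp: y_def B_adj)
  ultimately show ?case by blast
qed

text \<open>If \<open>W\<close> is orthogonal to \<open>v0\<close>, moving lowering operators across
  the form makes it orthogonal to all of \<open>M\<close>, hence zero by positivity. Otherwise some
  vector of \<open>W\<close> has a nonzero component along \<open>v0\<close>; the grading operator
  extracts it, so \<open>v0\<close> lies in \<open>W\<close>.\<close>

lemma irreducible: "sl.irreducible_module"
  unfolding sl.irreducible_module_def
proof (intro conjI allI impI)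
  show "M \<noteq> {0}" using M_v0 v0 by auto
  fix W assume "sl.stable (sl nn) W"
  then have W: "subspace W" "W \<subseteq> M" "\<And>X w. X \<in> sl nn \<Longrightarrow> w \<in> W \<Longrightarrow> act X w \<in> W"
    unfolding sl.stable_def by auto
  have We: "e i j w \<in> W" if "w \<in> W" "i < nn" "j < nn" "i \<noteq> j" for w i j
    using W(3)[OF gl_unit_sl, of i j w] act_gl_unit that by simp
  show "W = {0} \<or> W = M"
  proof (cases "\<forall>w\<in>W. B w v0 = 0")
    case True
    have "\<forall>w\<in>W. B w u = 0" if "u \<in> M" for u
      using that
    proof induction
      case (M_lower u j i)
      show ?case
      proof
        fix w assume "w \<in> W"
        then have "B u (e j i w) = 0"
          using We[of w j i] M_lower B_cnj[of u "e j i w"] by auto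
        then have "B (e i j u) w = 0" using M_lower by (simp add: B_adj)
        then show "B w (e i j u) = 0" using B_cnj[of w "e i j u"] by simp
      qed
    qed (use True in \<open>auto simp: B_right\<close>)
    then have "W \<subseteq> {0}" using W(2) B_pos by force
    then show ?thesis using subspace_0[OF W(1)] by blast
  next
    case False
    then obtain w where w: "w \<in> W" "B w v0 \<noteq> 0" by blast
    then obtain x D c where x: "w = (\<Sum>d\<le>D. x d)" "x 0 = scale c v0" "\<forall>d\<ge>1. B (x d) v0 = 0"
      "\<forall>d. act grading (x d) = scale (top_degree - of_nat d) (x d)"
      using M_decompose W(2) by blast
    have "B w v0 = (\<Sum>d\<le>D. if d = 0 then B (x 0) v0 else 0)"
      unfolding x(1) B_sum using x(3) by (intro sum.cong refl) auto
    then have "c \<noteq> 0" using w(2) x(2) by auto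
    have "x 0 \<in> W"
    proof (rule subspace_eigenvectors[where H = "act grading" and \<mu> = "\<lambda>d. top_degree - of_nat d" and I = "{..D}"])
      show "inj_on (\<lambda>d. top_degree - of_nat d) {..D}" by (auto simp: inj_on_def)
    qed (use W grading_sl x w act_add act_scale in auto)
    then have "scale (1 / c) (x 0) \<in> W" using W(1) subspace_scale by blast
    then have "v0 \<in> W" using x(2) \<open>c \<noteq> 0\<close> by simp
    have "u \<in> W" if "u \<in> M" for u
      using that
      by induction (use \<open>v0 \<in> W\<close> We W(1) subspace_add subspace_scale in auto)
    then show ?thesis using W(2) by blast
  qed
qed

lemma locally_finite: "sl.locally_k_finite"
  unfolding sl.locally_k_finite_def
proof
  fix u assume u: "u \<in> M"
  obtain F S where FS: "subspace F \<and> u \<in> F \<and> finite S \<and> F \<subseteq> span S \<and>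
      (\<forall>i<nn. \<forall>j<nn. (i < p) = (j < p) \<longrightarrow> (\<forall>x\<in>F. e i j x \<in> F))"
    using k_finite[of u] by (elim exE)
  then have F: "subspace F" "u \<in> F" "finite S" "F \<subseteq> span S"
    "\<And>i j x. i < nn \<Longrightarrow> j < nn \<Longrightarrow> (i < p) = (j < p) \<Longrightarrow> x \<in> F \<Longrightarrow> e i j x \<in> F"
    by simp_all
  have "act X x \<in> F" if "X \<in> k_alg p q" "x \<in> F" for X x
    unfolding act_def
  proof (intro subspace_sum[OF F(1)])
    fix i j assume "i \<in> {..<nn}" "j \<in> {..<nn}"
    then show "scale (X $$ (i, j)) (e i j x) \<in> F"
      using that F(5)[of i j x] subspace_scale[OF F(1)] subspace_0[OF F(1)]
      by (cases "(i < p) = (j < p)") (auto simp: k_alg_def)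
  qed
  then have "sl.stable (k_alg p q) (M \<inter> F)"
    unfolding sl.stable_def using subspace_inter[OF subspace_M F(1)] act_M by auto
  then show "\<exists>W S. sl.stable (k_alg p q) W \<and> u \<in> W \<and> finite S \<and> W \<subseteq> span S"
    using u F by blast
qed

lemma highest_weight:
  assumes lam: "\<And>i. i < nn \<Longrightarrow> lam (Suc i) = l i + C"
  shows "sl.highest_weight_vector lam v0"
  unfolding sl.highest_weight_vector_def
proof (intro conjI ballI)
  fix X assume X: "X \<in> n_plus nn"
  have "scale (X $$ (i, j)) (e i j v0) = 0" if "i < nn" "j < nn" for i j
    using X that raise[of i j] by (cases "i < j") (auto simp: n_plus_def)
  then show "act X v0 = 0" unfolding act_def by (intro sum.neutral ballI) auto
next
  fix H assume H: "H \<in> cartan nn"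
  have tr: "(\<Sum>i<nn. H $$ (i, i)) = 0" using H by (simp add: cartan_def sl_def)
  have "act H v0 = (\<Sum>i<nn. \<Sum>j<nn. if j = i then scale (of_real (l i) * H $$ (i, i)) v0 else 0)"
    unfolding act_def
  proof (intro sum.cong refl)
    fix i j assume "i \<in> {..<nn}" "j \<in> {..<nn}"
    then show "scale (H $$ (i, j)) (e i j v0) = (if j = i then scale (of_real (l i) * H $$ (i, i)) v0 else 0)"
      using H weight[of i] by (auto simp: cartan_def diagonal_mat_def sl_def mult.commute)
  qed
  also have "\<dots> = scale (\<Sum>i<nn. of_real (l i) * H $$ (i, i)) v0"
    by (simp add: scale_sum_left)
  \<comment> \<open>On traceless diagonal matrices a constant added to all weights is invisible;
    this is the freedom of weights modulo constants.\<close>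
  also have "(\<Sum>i<nn. of_real (l i) * H $$ (i, i)) = (\<Sum>i<nn. of_real (l i) * H $$ (i, i)) + of_real C * (\<Sum>i<nn. H $$ (i, i))"
    using tr by simp
  also have "\<dots> = (\<Sum>i<nn. of_real (lam (Suc i)) * H $$ (i, i))"
    unfolding sum_distrib_left sum.distrib[symmetric]
    by (intro sum.cong refl) (simp add: lam distrib_right)
  also have "\<dots> = (\<Sum>i=1..nn. of_real (lam i) * H $$ (i - 1, i - 1))"
    by (rule sum.reindex_bij_witness[of _ "\<lambda>i. i - 1" Suc]) auto
  finally show "act H v0 = scale (\<Sum>i=1..nn. of_real (lam i) * H $$ (i - 1, i - 1)) v0" .
qed (use M_v0 v0 in auto)

lemma unitarizable: "sl.unitarizable"
  unfolding sl.unitarizable_def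
proof (intro exI[of _ B] conjI ballI)
  show "sl.positive_definite_hermitian B"
    unfolding sl.positive_definite_hermitian_def using B_add B_scale B_cnj B_pos by blast
  fix X u v assume X: "X \<in> su p q" and "u \<in> M" "v \<in> M"
  have X': "X \<in> sl nn" using X by (simp add: su_def)
  have "B (act X u) v = (\<Sum>i<nn. \<Sum>j<nn. X $$ (i, j) * B (e i j u) v)"
    unfolding act_def B_sum by (simp add: B_scale)
  also have "\<dots> = (\<Sum>i<nn. \<Sum>j<nn. - (cnj (X $$ (j, i)) * B u (e j i v)))"
  proof (intro sum.cong refl)
    fix i j assume "i \<in> {..<nn}" "j \<in> {..<nn}"
    moreover from this have "cnj (X $$ (j, i)) * (if j < p then 1 else - 1) = - ((if i < p then 1 else - 1) * X $$ (i, j))"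
      using X su_iff[OF X'] by auto
    ultimately show "X $$ (i, j) * B (e i j u) v = - (cnj (X $$ (j, i)) * B u (e j i v))"
      by (auto simp: B_adj split: if_splits)
  qed
  also have "\<dots> = (\<Sum>j<nn. \<Sum>i<nn. - (cnj (X $$ (j, i)) * B u (e j i v)))"
    by (rule sum.swap)
  also have "\<dots> = - B u (act X v)"
    unfolding act_def B_sum by (simp add: B_right sum_negf)
  finally show "B (act X u) v = - B u (act X v)" .
qed

end

text \<open>\<open>unitary_parameter\<close> asks for a realization by complex sequences; an
  injective linear map carries one there from any other space.\<close>

lemma unitary_parameter_transfer:
  fixes scale :: "complex \<Rightarrow> 'v::ab_group_add \<Rightarrow> 'v" and \<phi> :: "'v \<Rightarrow> nat \<Rightarrow> complex"
  assumes mod: "sl_module scale p q V act"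
    and L: "sl_module.realizes_L scale p q V act (\<lambda>i. \<Lambda> i - rho (p + q) i)"
    and U: "sl_module.unitarizable scale p q V act"
    and add: "\<And>u v. \<phi> (u + v) = \<phi> u + \<phi> v"
    and sc: "\<And>c v. \<phi> (scale c v) = fun_scale c (\<phi> v)"
    and inj: "inj \<phi>"
  shows "unitary_parameter p q \<Lambda>"
proof -
  interpret A: sl_module scale p q V act by (rule mod)
  interpret fs: vector_space "fun_scale :: complex \<Rightarrow> _" by (rule vector_space_fun_scale)
  define \<psi> where "\<psi> = inv_into UNIV \<phi>"
  have \<psi>: "\<psi> (\<phi> x) = x" for x using inj by (simp add: \<psi>_def)
  define act' where "act' X w = \<phi> (act X (\<psi> w))" for X w
  have act': "act' X (\<phi> v) = \<phi> (act X v)" for X v by (simp add: act'_def \<psi>)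
  have zero: "\<phi> 0 = 0" using add[of 0 0] by simp
  have \<phi>0: "\<phi> x = 0 \<longleftrightarrow> x = 0" for x using zero inj by (metis injD)
  have neg: "\<phi> (- v) = - \<phi> v" for v using add[of v "- v"] zero by (simp add: eq_neg_iff_add_eq_0 add.commute)
  have diff: "\<phi> (u - v) = \<phi> u - \<phi> v" for u v using add[of u "- v"] neg[of v] by simp
  have sub: "fs.subspace (\<phi> ` W)" if "A.subspace W" for W
    using A.subspace_0[OF that] A.subspace_add[OF that] A.subspace_scale[OF that] zero
    by (intro fs.subspaceI) (auto simp: add[symmetric] sc[symmetric] image_iff)
  have sub': "A.subspace {x. \<phi> x \<in> W}" if "fs.subspace W" for W
    using fs.subspace_0[OF that] fs.subspace_add[OF that] fs.subspace_scale[OF that]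
    by (intro A.subspaceI) (auto simp: zero add sc)
  interpret A': sl_module fun_scale p q "\<phi> ` V" act'
  proof unfold_locales
    show "fs.subspace (\<phi> ` V)" by (rule sub[OF A.subspace_V])
  qed (auto simp: act' A.act_closed add[symmetric] sc[symmetric] A.act_add_vec A.act_scale_vec
      A.act_add_mat A.act_smult_mat A.act_bracket diff[symmetric])
  have irr: "A'.irreducible_module"
    unfolding A'.irreducible_module_def
  proof (intro conjI allI impI)
    have "V \<noteq> {0}" using L unfolding A.realizes_L_def A.irreducible_module_def by blast
    then obtain v where "v \<in> V" "v \<noteq> 0" using A.subspace_0[OF A.subspace_V] by blast
    then show "\<phi> ` V \<noteq> {0}" using \<phi>0[of v] by blast
    fix W assume W: "A'.stable (sl (p + q)) W"
    then have sW: "fs.subspace W" and WV: "W \<subseteq> \<phi> ` V" unfolding A'.stable_def by auto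
    have "{x. \<phi> x \<in> W} \<subseteq> V" using WV inj_image_mem_iff[OF inj] by blast
    moreover have "act X x \<in> {x. \<phi> x \<in> W}" if "X \<in> sl (p + q)" "x \<in> {x. \<phi> x \<in> W}" for X x
      using that W unfolding A'.stable_def by (auto simp: act'[symmetric])
    ultimately have "A.stable (sl (p + q)) {x. \<phi> x \<in> W}"
      unfolding A.stable_def using sub'[OF sW] by blast
    then have "{x. \<phi> x \<in> W} = {0} \<or> {x. \<phi> x \<in> W} = V"
      using L unfolding A.realizes_L_def A.irreducible_module_def by blast
    moreover have "W = \<phi> ` {x. \<phi> x \<in> W}" using WV by auto
    ultimately show "W = {0} \<or> W = \<phi> ` V" using zero by auto
  qed
  have span: "\<phi> ` A.span S \<subseteq> fs.span (\<phi> ` S)" for S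
  proof
    fix y assume "y \<in> \<phi> ` A.span S"
    then obtain x where x: "x \<in> A.span S" "y = \<phi> x" by blast
    have "x \<in> {x. \<phi> x \<in> fs.span (\<phi> ` S)}"
      by (rule A.span_induct[OF x(1)]) (auto intro: sub' fs.subspace_span fs.span_base)
    then show "y \<in> fs.span (\<phi> ` S)" using x by simp
  qed
  have fin: "A'.locally_k_finite"
    unfolding A'.locally_k_finite_def
  proof
    fix y assume "y \<in> \<phi> ` V"
    then obtain v where v: "v \<in> V" "y = \<phi> v" by blast
    then obtain W S where W: "A.stable (k_alg p q) W" "v \<in> W" "finite S" "W \<subseteq> A.span S"
      using L unfolding A.realizes_L_def A.locally_k_finite_def by blast
    have "A'.stable (k_alg p q) (\<phi> ` W)"
      using W(1) sub[of W] unfolding A'.stable_def A.stable_def by (auto simp: act')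
    moreover have "\<phi> ` W \<subseteq> fs.span (\<phi> ` S)" using W(4) span by blast
    ultimately show "\<exists>W S. A'.stable (k_alg p q) W \<and> y \<in> W \<and> finite S \<and> W \<subseteq> fs.span S"
      using W v by blast
  qed
  obtain v where v: "A.highest_weight_vector (\<lambda>i. \<Lambda> i - rho (p + q) i) v"
    using L unfolding A.realizes_L_def by blast
  have "A'.highest_weight_vector (\<lambda>i. \<Lambda> i - rho (p + q) i) (\<phi> v)"
    using v unfolding A'.highest_weight_vector_def A.highest_weight_vector_def
    by (simp only: act' \<phi>0 zero sc[symmetric] image_eqI bex_simps) (simp add: zero)
  then have L': "A'.realizes_L (\<lambda>i. \<Lambda> i - rho (p + q) i)"
    using irr fin unfolding A'.realizes_L_def by blast
  obtain B where B: "A.positive_definite_hermitian B" "\<forall>X\<in>su p q. \<forall>u\<in>V. \<forall>v\<in>V. B (act X u) v = - B u (act X v)"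
    using U unfolding A.unitarizable_def by blast
  define B' where "B' u v = B (\<psi> u) (\<psi> v)" for u v
  have B': "B' (\<phi> u) (\<phi> v) = B u v" for u v by (simp add: B'_def \<psi>)
  have "A'.positive_definite_hermitian B'"
    unfolding A'.positive_definite_hermitian_def
  proof (intro conjI ballI allI impI; elim imageE)
    note B1 = B(1)[unfolded A.positive_definite_hermitian_def]
    { fix y z u v assume yz: "y = \<phi> u" "z = \<phi> v" and uv: "u \<in> V" "v \<in> V"
      show "B' (fun_scale c y) z = c * B' y z" for c
        unfolding yz sc[symmetric] B' using B1 uv by blast
      show "B' z y = cnj (B' y z)"
        unfolding yz B' using B1 uv by blast
      show "B' (y + z) s = B' y s + B' z s" if "s = \<phi> x" "x \<in> V" for s x
        unfolding yz that(1) add[symmetric] B' using B1 uv that(2) by blast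
      show "Re (B' y y) > 0" if "y \<noteq> 0"
        using that B1 uv \<phi>0 unfolding yz B' by blast }
  qed
  moreover have "\<forall>X\<in>su p q. \<forall>u\<in>\<phi> ` V. \<forall>v\<in>\<phi> ` V. B' (act' X u) v = - B' u (act' X v)"
    using B(2) by (auto simp: B' act')
  ultimately have "A'.unitarizable" unfolding A'.unitarizable_def by blast
  then show ?thesis
    unfolding unitary_parameter_def using L' A'.sl_module_axioms by blast
qed

section \<open>The Fock space\<close>

text \<open>A monomial is the multiset of its variables; the convolution product over the additive
  monoid of multisets is then the product of polynomials.\<close>

type_synonym 'x mpoly = "'x multiset \<Rightarrow>\<^sub>0 complex"

lemma poly_mapping_sum_single: "f = (\<Sum>k\<in>Poly_Mapping.keys f. Poly_Mapping.single k (Poly_Mapping.lookup f k))"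
proof (rule poly_mapping_eqI)
  fix m
  have "Poly_Mapping.lookup (\<Sum>k\<in>Poly_Mapping.keys f. Poly_Mapping.single k (Poly_Mapping.lookup f k)) m
      = (\<Sum>k\<in>Poly_Mapping.keys f. if k = m then Poly_Mapping.lookup f m else 0)"
    unfolding lookup_sum by (intro sum.cong refl) (auto simp: lookup_single)
  also have "\<dots> = Poly_Mapping.lookup f m"
    by (auto simp: in_keys_iff)
  finally show "Poly_Mapping.lookup f m = Poly_Mapping.lookup (\<Sum>k\<in>Poly_Mapping.keys f. Poly_Mapping.single k (Poly_Mapping.lookup f k)) m" ..
qed

lemma poly_mapping_additive_induct [case_names single add zero]:
  assumes "\<And>k c. P (Poly_Mapping.single k c)" "\<And>f g. P f \<Longrightarrow> P g \<Longrightarrow> P (f + g)" "P 0"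
  shows "P (f :: 'a \<Rightarrow>\<^sub>0 'b::comm_monoid_add)"
proof -
  have "P (\<Sum>k\<in>A. Poly_Mapping.single k (h k))" if "finite A" for A and h :: "'a \<Rightarrow> 'b"
    using that by (induction A rule: finite_induct) (use assms in auto)
  then show ?thesis
    by (subst poly_mapping_sum_single) simp
qed

definition pscale :: "complex \<Rightarrow> 'x mpoly \<Rightarrow> 'x mpoly" where
  "pscale c f = Poly_Mapping.single 0 c * f"

lemma lookup_pscale [simp]: "Poly_Mapping.lookup (pscale c f) m = c * Poly_Mapping.lookup f m"
  unfolding pscale_def mult_map_scale_conv_mult[symmetric]
  by (simp add: Poly_Mapping.map.rep_eq when_def)

interpretation ps: vector_space pscale
  by unfold_locales (auto intro!: poly_mapping_eqI simp: lookup_add algebra_simps)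

lemma pscale_mult_left: "pscale c f * g = pscale c (f * g)"
  by (simp add: pscale_def mult.assoc)

lemma pscale_mult_right: "f * pscale c g = pscale c (f * g)"
  by (simp add: pscale_def mult.left_commute)

section \<open>Variables, partial derivatives and the Fischer product\<close>

definition var :: "'x \<Rightarrow> 'x mpoly" where
  "var x = Poly_Mapping.single {#x#} 1"

lemma lookup_var_mult:
  "Poly_Mapping.lookup (var x * f) m = (if x \<in># m then Poly_Mapping.lookup f (m - {#x#}) else 0)"
proof (induction f rule: poly_mapping_additive_induct)
  case (single k c)
  have "(add_mset x k = m) = (x \<in># m \<and> k = m - {#x#})" by auto
  then show ?case by (auto simp: var_def mult_single lookup_single when_def)
qed (auto simp: lookup_add distrib_left)

lemma keys_var_mult: "Poly_Mapping.keys (var x * f) = add_mset x ` Poly_Mapping.keys f"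
proof (rule equalityI; rule subsetI)
  fix m assume "m \<in> Poly_Mapping.keys (var x * f)"
  then show "m \<in> add_mset x ` Poly_Mapping.keys f"
    by (intro image_eqI[of _ _ "m - {#x#}"]) (auto simp: in_keys_iff lookup_var_mult split: if_splits)
qed (auto simp: in_keys_iff lookup_var_mult)

lift_definition pd :: "'x \<Rightarrow> 'x mpoly \<Rightarrow> 'x mpoly" is
  "\<lambda>x f m. of_nat (Suc (count m x)) * f (add_mset x m)"
proof -
  fix x :: 'x and f :: "'x multiset \<Rightarrow> complex"
  assume "finite {m. f m \<noteq> 0}"
  then have "finite (add_mset x -` {m. f m \<noteq> 0})"
    by (rule finite_vimageI) (simp add: inj_def)
  then show "finite {m. of_nat (Suc (count m x)) * f (add_mset x m) \<noteq> 0}"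
    by (rule rev_finite_subset) auto
qed

lemma lookup_pd: "Poly_Mapping.lookup (pd x f) m =
    of_nat (Suc (count m x)) * Poly_Mapping.lookup f (add_mset x m)"
  by transfer simp

lemma keys_pd: "m \<in> Poly_Mapping.keys (pd x f) \<longleftrightarrow> add_mset x m \<in> Poly_Mapping.keys f"
  by (simp add: in_keys_iff lookup_pd del: of_nat_Suc)

lemma pd_add: "pd x (f + g) = pd x f + pd x g"
  by (rule poly_mapping_eqI) (simp add: lookup_pd lookup_add distrib_left del: of_nat_Suc)

lemma pd_0 [simp]: "pd x 0 = 0"
  by (rule poly_mapping_eqI) (simp add: lookup_pd)

lemma pd_pscale: "pd x (pscale c f) = pscale c (pd x f)"
  by (rule poly_mapping_eqI) (simp add: lookup_pd del: of_nat_Suc)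

lemma pd_uminus: "pd x (- f) = - pd x f"
  by (rule poly_mapping_eqI) (simp add: lookup_pd del: of_nat_Suc)

lemma pd_single: "pd x (Poly_Mapping.single k c) = Poly_Mapping.single (k - {#x#}) (of_nat (count k x) * c)"
proof (rule poly_mapping_eqI)
  fix m
  show "Poly_Mapping.lookup (pd x (Poly_Mapping.single k c)) m =
      Poly_Mapping.lookup (Poly_Mapping.single (k - {#x#}) (of_nat (count k x) * c)) m"
  proof (cases "x \<in># k")
    case True
    then have "(k = add_mset x m) = (k - {#x#} = m)" "k - {#x#} = m \<Longrightarrow> count k x = Suc (count m x)"
      by auto
    then show ?thesis by (auto simp: lookup_pd lookup_single when_def simp del: of_nat_Suc)
  next
    case False
    then have "k \<noteq> add_mset x m" by auto
    then show ?thesis using False by (simp add: lookup_pd lookup_single when_def not_in_iff)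
  qed
qed

text \<open>Both sides are additive in \<open>f\<close> and in \<open>g\<close>, which leaves
  monomials. There the cases separate the occurrences of \<open>x\<close>: the multiset difference
  is truncated, but the factor \<open>count\<close> vanishes when \<open>x\<close> does not
  occur.\<close>

lemma pd_mult: "pd x (f * g) = pd x f * g + f * pd x g"
proof (induction f rule: poly_mapping_additive_induct)
  case (single k c)
  show ?case
  proof (induction g rule: poly_mapping_additive_induct)
    case (single k' c')
    show ?case
    proof (cases "x \<in># k")
      case True
      then have 1: "k + k' - {#x#} = k - {#x#} + k'" by simp
      show ?thesis
      proof (cases "x \<in># k'")
        case True
        then have 2: "k + k' - {#x#} = k + (k' - {#x#})" by simp
        have "Poly_Mapping.single (k + k' - {#x#}) (of_nat (count (k + k') x) * (c * c')) =
          Poly_Mapping.single (k + k' - {#x#}) (of_nat (count k x) * c * c') +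
          Poly_Mapping.single (k + k' - {#x#}) (c * (of_nat (count k' x) * c'))"
          by (simp add: single_add[symmetric] algebra_simps)
        then show ?thesis using 1 2 by (simp add: pd_single mult_single)
      next
        case False
        then show ?thesis using 1 by (simp add: pd_single mult_single not_in_iff algebra_simps)
      qed
    next
      case False
      show ?thesis
      proof (cases "x \<in># k'")
        case True
        then have 2: "k + k' - {#x#} = k + (k' - {#x#})" by simp
        then show ?thesis using False by (simp add: pd_single mult_single not_in_iff algebra_simps)
      next
        case f2: False
        then show ?thesis using False by (simp add: pd_single mult_single not_in_iff)
      qed
    qed
  qed (simp_all add: distrib_left pd_add algebra_simps)
qed (simp_all add: distrib_right pd_add algebra_simps)

lemma pd_var: "pd x (var y) = (if x = y then 1 else 0)"
  by (auto simp: var_def pd_single)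

lemma pd_commute: "pd x (pd y f) = pd y (pd x f)"
  by (rule poly_mapping_eqI) (auto simp: lookup_pd add_mset_commute simp del: of_nat_Suc)

text \<open>The square norm of the monomial \<open>m\<close>. Its growth in
  \<open>mfact_add_mset\<close> matches the factor in \<open>lookup_pd\<close>, which makes
  multiplication by a variable adjoint to the partial derivative.\<close>

definition mfact :: "'x multiset \<Rightarrow> nat" where
  "mfact m = (\<Prod>x\<in>set_mset m. fact (count m x))"

lemma mfact_pos: "mfact m > 0"
  unfolding mfact_def by (intro prod_pos) auto

lemma mfact_add_mset: "mfact (add_mset x m) = Suc (count m x) * mfact m"
proof -
  have 1: "mfact m = (\<Prod>y\<in>insert x (set_mset m). fact (count m y))"
    unfolding mfact_def by (rule prod.mono_neutral_left) (auto simp: not_in_iff)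
  have "mfact (add_mset x m) = fact (count (add_mset x m) x) * (\<Prod>y\<in>set_mset m - {x}. fact (count (add_mset x m) y))"
    unfolding mfact_def set_mset_add_mset_insert by (subst prod.insert_remove) auto
  also have "(\<Prod>y\<in>set_mset m - {x}. fact (count (add_mset x m) y)) = (\<Prod>y\<in>set_mset m - {x}. fact (count m y) :: nat)"
    by (intro prod.cong) auto
  finally show ?thesis unfolding 1 by (subst prod.insert_remove) (auto simp: algebra_simps)
qed

text \<open>The Fischer (Fock) inner product.\<close>
definition fip :: "'x mpoly \<Rightarrow> 'x mpoly \<Rightarrow> complex" where
  "fip f g = (\<Sum>m\<in>Poly_Mapping.keys f. Poly_Mapping.lookup f m * cnj (Poly_Mapping.lookup g m) * of_nat (mfact m))"

lemma fip_superset: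
  assumes "finite A" "Poly_Mapping.keys f \<subseteq> A"
  shows "fip f g = (\<Sum>m\<in>A. Poly_Mapping.lookup f m * cnj (Poly_Mapping.lookup g m) * of_nat (mfact m))"
  unfolding fip_def using assms by (intro sum.mono_neutral_left) (auto simp: in_keys_iff)

lemma fip_add: "fip (f + g) h = fip f h + fip g h"
proof -
  let ?A = "Poly_Mapping.keys f \<union> Poly_Mapping.keys g"
  have "Poly_Mapping.keys (f + g) \<subseteq> ?A" by (rule keys_add)
  then show ?thesis
    by (simp add: fip_superset[of ?A] lookup_add distrib_right sum.distrib)
qed

lemma fip_pscale: "fip (pscale c f) h = c * fip f h"
proof -
  have "Poly_Mapping.keys (pscale c f) \<subseteq> Poly_Mapping.keys f" by (auto simp: in_keys_iff)
  then show ?thesis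
    by (simp add: fip_superset[of "Poly_Mapping.keys f"] sum_distrib_left mult.assoc)
qed

lemma fip_cnj: "fip g f = cnj (fip f g)"
proof -
  let ?A = "Poly_Mapping.keys f \<union> Poly_Mapping.keys g"
  show ?thesis by (simp add: fip_superset[of ?A] mult.commute)
qed

lemma fip_pos:
  assumes "f \<noteq> 0"
  shows "Re (fip f f) > 0"
proof -
  have "Poly_Mapping.keys f \<noteq> {}"
    using assms by (metis keys_eq_empty)
  moreover have "Re (fip f f) = (\<Sum>m\<in>Poly_Mapping.keys f. (cmod (Poly_Mapping.lookup f m))\<^sup>2 * real (mfact m))"
    unfolding fip_def by (simp add: complex_norm_square[symmetric] del: of_real_power)
  moreover have "(cmod (Poly_Mapping.lookup f m))\<^sup>2 * real (mfact m) > 0" if "m \<in> Poly_Mapping.keys f" for m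
    using that by (simp add: in_keys_iff mfact_pos)
  ultimately show ?thesis
    by (simp add: sum_pos)
qed

lemma fip_var: "fip (var x * f) g = fip f (pd x g)"
proof -
  have inj: "inj_on (add_mset x) (Poly_Mapping.keys f)" by (simp add: inj_on_def)
  show ?thesis
    unfolding fip_def keys_var_mult sum.reindex[OF inj] o_def
    by (intro sum.cong refl, simp add: lookup_var_mult lookup_pd mfact_add_mset)
      (simp add: algebra_simps)
qed

lemma fip_pd: "fip (pd x f) g = fip f (var x * g)"
  using fip_var[of x g f] fip_cnj by metis

section \<open>The oscillator representation\<close>

type_synonym fock = "(nat \<times> nat) mpoly"

text \<open>The oscillator representation of \<open>\<gg>\<ll>(p + q)\<close> on \<open>K\<close> copies: the operators satisfy
  \<open>[P\<^sub>i\<^sub>c, Q\<^sub>j\<^sub>d] = \<delta>\<close>, and rows \<open>i < p\<close> carry the dual Heisenberg pair, which makes the form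
  indefinite exactly on the noncompact roots.\<close>
definition Qop :: "nat \<Rightarrow> nat \<Rightarrow> nat \<Rightarrow> fock \<Rightarrow> fock" where
  "Qop p i c f = (if i < p then - pd (i, c) f else var (i, c) * f)"

definition Pop :: "nat \<Rightarrow> nat \<Rightarrow> nat \<Rightarrow> fock \<Rightarrow> fock" where
  "Pop p i c f = (if i < p then var (i, c) * f else pd (i, c) f)"

definition osc :: "nat \<Rightarrow> nat \<Rightarrow> nat \<Rightarrow> nat \<Rightarrow> fock \<Rightarrow> fock" where
  "osc p K i j f = (\<Sum>c<K. Qop p i c (Pop p j c f))"

lemma pd_var_mult: "pd x (var y * f) = var y * pd x f + (if x = y then f else 0)"
  by (simp add: pd_mult pd_var)

lemma Pop_Qop: "Pop p i c (Qop p j d f) = Qop p j d (Pop p i c f) + (if i = j \<and> c = d then f else 0)"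
  by (auto simp: Pop_def Qop_def pd_var_mult pd_uminus pd_commute[of "(i, c)"])

lemma Pop_Pop: "Pop p i c (Pop p j d f) = Pop p j d (Pop p i c f)"
  by (auto simp: Pop_def pd_var_mult pd_commute[of "(i, c)"] mult.left_commute)

lemma Qop_Qop: "Qop p i c (Qop p j d f) = Qop p j d (Qop p i c f)"
  by (auto simp: Qop_def pd_var_mult pd_uminus pd_commute[of "(i, c)"] mult.left_commute)

lemma Pop_linear: "Pop p i c (f + g) = Pop p i c f + Pop p i c g"
    "Pop p i c (pscale a f) = pscale a (Pop p i c f)" "Pop p i c 0 = 0"
  by (auto simp: Pop_def pd_add pd_pscale distrib_left pscale_mult_right)

lemma Qop_linear: "Qop p i c (f + g) = Qop p i c f + Qop p i c g"
    "Qop p i c (pscale a f) = pscale a (Qop p i c f)" "Qop p i c 0 = 0"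
  by (auto simp: Qop_def pd_add pd_pscale distrib_left pscale_mult_right)

lemma Pop_sum: "Pop p i c (\<Sum>x\<in>A. f x) = (\<Sum>x\<in>A. Pop p i c (f x))"
  by (induction A rule: infinite_finite_induct) (simp_all add: Pop_linear)

lemma Qop_sum: "Qop p i c (\<Sum>x\<in>A. f x) = (\<Sum>x\<in>A. Qop p i c (f x))"
  by (induction A rule: infinite_finite_induct) (simp_all add: Qop_linear)

lemma osc_linear: "osc p K i j (f + g) = osc p K i j f + osc p K i j g"
    "osc p K i j (pscale a f) = pscale a (osc p K i j f)"
  by (simp_all add: osc_def Pop_linear Qop_linear sum.distrib ps.scale_sum_right)

text \<open>Only the canonical commutation relations of \<open>Pop\<close> and \<open>Qop\<close>
  enter, so the two kinds of rows need no separate treatment.\<close>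

lemma osc_comm:
  "osc p K i j (osc p K k l f) = osc p K k l (osc p K i j f)
     + (if j = k then osc p K i l f else 0) - (if i = l then osc p K k j f else 0)"
proof -
  \<comment> \<open>Normal ordering. The quartic part is symmetric under exchange of
    \<open>(i, j)\<close> and \<open>(k, l)\<close>, so the commutator keeps only the two
    contractions.\<close>
  have 1: "osc p K i j (osc p K k l f) = (\<Sum>c<K. \<Sum>d<K. Qop p i c (Qop p k d (Pop p j c (Pop p l d f))))
      + (if j = k then osc p K i l f else 0)" for i j k l
  proof -
    have "osc p K i j (osc p K k l f) = (\<Sum>c<K. \<Sum>d<K. Qop p i c (Qop p k d (Pop p j c (Pop p l d f)))
      + (if d = c then if j = k then Qop p i c (Pop p l c f) else 0 else 0))"
      unfolding osc_def Pop_sum Qop_sum Pop_Qop Qop_linear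
      by (intro sum.cong refl) (auto simp: Qop_linear)
    also have "\<dots> = (\<Sum>c<K. \<Sum>d<K. Qop p i c (Qop p k d (Pop p j c (Pop p l d f))))
      + (\<Sum>c<K. if j = k then Qop p i c (Pop p l c f) else 0)"
      unfolding sum.distrib by simp
    finally show ?thesis by (simp add: osc_def)
  qed
  have 2: "(\<Sum>c<K. \<Sum>d<K. Qop p k c (Qop p i d (Pop p l c (Pop p j d f)))) =
      (\<Sum>c<K. \<Sum>d<K. Qop p i c (Qop p k d (Pop p j c (Pop p l d f))))"
    unfolding Qop_Qop[of p k _ i] Pop_Pop[of p l _ j] by (rule sum.swap)
  show ?thesis
    unfolding 1[of i j k l] 1[of k l i j] 2 by auto
qed

lemma fip_uminus: "fip (- f) g = - fip f g" "fip f (- g) = - fip f g"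
proof -
  have *: "- f = pscale (- 1) f" for f :: "'a mpoly"
    by (rule poly_mapping_eqI) simp
  have 1: "fip (- f) g = - fip f g" for f g :: "'a mpoly"
    unfolding *[of f] fip_pscale by simp
  then show "fip (- f) g = - fip f g" .
  show "fip f (- g) = - fip f g"
    using fip_cnj[of "- g" f] fip_cnj[of g f] 1[of g f] by (metis complex_cnj_minus fip_cnj)
qed

lemma fip_Qop: "fip (Qop p i c f) g = (if i < p then - 1 else 1) * fip f (Pop p i c g)"
  by (simp add: Qop_def Pop_def fip_var fip_pd fip_uminus)

lemma fip_Pop: "fip (Pop p i c f) g = (if i < p then - 1 else 1) * fip f (Qop p i c g)"
  by (simp add: Qop_def Pop_def fip_var fip_pd fip_uminus)

lemma fip_0 [simp]: "fip 0 g = 0" "fip g 0 = 0"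
  by (simp_all add: fip_def)

lemma fip_add_right: "fip h (f + g) = fip h f + fip h g"
  using fip_cnj[of h "f + g"] fip_cnj[of h f] fip_cnj[of h g] by (simp add: fip_add)

lemma fip_sum: "fip (\<Sum>x\<in>A. f x) g = (\<Sum>x\<in>A. fip (f x) g)" "fip g (\<Sum>x\<in>A. f x) = (\<Sum>x\<in>A. fip g (f x))"
  by (induction A rule: infinite_finite_induct) (simp_all add: fip_add fip_add_right)

lemma fip_osc: "fip (osc p K i j f) g =
    (if i < p then - 1 else 1) * (if j < p then - 1 else 1) * fip f (osc p K j i g)"
  unfolding osc_def fip_sum fip_Qop fip_Pop by (simp add: sum_distrib_left)

lemma finite_bounded_multisets:
  assumes "finite X"
  shows "finite {m. set_mset m \<subseteq> X \<and> size m \<le> D}"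
proof (rule finite_subset)
  show "{m. set_mset m \<subseteq> X \<and> size m \<le> D} \<subseteq> mset ` {xs. set xs \<subseteq> X \<and> length xs \<le> D}"
  proof
    fix m assume m: "m \<in> {m. set_mset m \<subseteq> X \<and> size m \<le> D}"
    obtain xs where "m = mset xs" using ex_mset[of m] by metis
    then show "m \<in> mset ` {xs. set xs \<subseteq> X \<and> length xs \<le> D}" using m by auto
  qed
  show "finite (mset ` {xs. set xs \<subseteq> X \<and> length xs \<le> D})"
    using finite_lists_length_le[OF assms] by simp
qed

text \<open>Within one block an operator combines one multiplication with one derivative and so
  never raises the degree; \<open>F\<close> bounds the degree and the set of variables.\<close>

lemma osc_k_finite:
  "\<exists>F S. ps.subspace F \<and> u \<in> F \<and> finite S \<and> F \<subseteq> ps.span S \<and>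
      (\<forall>i<n. \<forall>j<n. (i < p) = (j < p) \<longrightarrow> (\<forall>x\<in>F. osc p K i j x \<in> F))"
proof -
  \<comment> \<open>The variables of \<open>u\<close> are included because \<open>u\<close> may
    contain others than those on which the operators act.\<close>
  define X where "X = ({..<n} \<times> {..<K}) \<union> (\<Union>m\<in>Poly_Mapping.keys u. set_mset m)"
  define D where "D = (\<Sum>m\<in>Poly_Mapping.keys u. size m)"
  define S where "S = {m. set_mset m \<subseteq> X \<and> size m \<le> D}"
  define F where "F = {f :: fock. Poly_Mapping.keys f \<subseteq> S}"
  have "finite X" by (simp add: X_def)
  then have finS: "finite S" unfolding S_def by (rule finite_bounded_multisets)
  have sub: "ps.subspace F"
  proof (rule ps.subspaceI)
    show "0 \<in> F" by (simp add: F_def)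
    show "x + y \<in> F" if "x \<in> F" "y \<in> F" for x y
      using that keys_add[of x y] by (auto simp: F_def)
    show "pscale c x \<in> F" if "x \<in> F" for c x
      using that by (auto simp: F_def in_keys_iff subset_iff)
  qed
  have "size m \<le> D" if "m \<in> Poly_Mapping.keys u" for m
    unfolding D_def using that by (intro member_le_sum) auto
  then have "u \<in> F" by (auto simp: F_def S_def X_def)
  moreover have "F \<subseteq> ps.span ((\<lambda>m. Poly_Mapping.single m 1) ` S)"
  proof
    fix f assume f: "f \<in> F"
    have "f = (\<Sum>k\<in>Poly_Mapping.keys f. pscale (Poly_Mapping.lookup f k) (Poly_Mapping.single k 1))"
      by (subst poly_mapping_sum_single) (simp add: pscale_def mult_single)
    also have "\<dots> \<in> ps.span ((\<lambda>m. Poly_Mapping.single m 1) ` S)"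
      using f by (intro ps.span_sum ps.span_scale ps.span_base) (auto simp: F_def)
    finally show "f \<in> ps.span ((\<lambda>m. Poly_Mapping.single m 1) ` S)" .
  qed
  moreover have "osc p K i j x \<in> F" if ij: "i < n" "j < n" "(i < p) = (j < p)" and x: "x \<in> F" for i j x
    unfolding osc_def
  proof (rule ps.subspace_sum[OF sub])
    fix c assume "c \<in> {..<K}"
    then have c: "(i, c) \<in> X" "(j, c) \<in> X" using ij by (auto simp: X_def)
    have 1: "var (i, c) * pd (j, c) x \<in> F"
      unfolding F_def
    proof (intro CollectI subsetI)
      fix m assume "m \<in> Poly_Mapping.keys (var (i, c) * pd (j, c) x)"
      then obtain m' where "m = add_mset (i, c) m'" "add_mset (j, c) m' \<in> Poly_Mapping.keys x"
        by (auto simp: keys_var_mult keys_pd)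
      then show "m \<in> S" using x c by (fastforce simp: F_def S_def)
    qed
    have 2: "- pd (i, c) (var (j, c) * x) \<in> F"
    proof -
      have "pd (i, c) (var (j, c) * x) \<in> F"
        unfolding F_def
      proof (intro CollectI subsetI)
        fix m assume "m \<in> Poly_Mapping.keys (pd (i, c) (var (j, c) * x))"
        then obtain m' where m': "add_mset (i, c) m = add_mset (j, c) m'" "m' \<in> Poly_Mapping.keys x"
          by (auto simp: keys_var_mult keys_pd)
        then have "size m = size m'" by (metis add_left_cancel size_add_mset nat.inject)
        moreover have "set_mset m \<subseteq> insert (j, c) (set_mset m')"
          using m'(1) by (metis set_mset_add_mset_insert subset_insertI)
        ultimately show "m \<in> S" using m'(2) x c by (fastforce simp: F_def S_def)
      qed
      then show ?thesis by (rule ps.subspace_neg[OF sub])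
    qed
    show "Qop p i c (Pop p j c x) \<in> F"
      using 1 2 ij by (auto simp: Qop_def Pop_def)
  qed
  ultimately show ?thesis
    using sub finS by blast
qed

lemma osc_gl_ops: "gl_ops pscale UNIV n (osc p K)"
proof unfold_locales
  show "osc p K i j (osc p K k l v) = osc p K k l (osc p K i j v)
     + (if j = k then osc p K i l v else 0) - (if i = l then osc p K k j v else 0)" for i j k l v
    by (rule osc_comm)
qed (auto simp: osc_linear ps.subspace_UNIV)

text \<open>There are countably many monomials, so a polynomial is determined by its coefficients
  along an enumeration of them.\<close>

lemma inj_fock_embedding:
  "inj (\<lambda>(f :: fock) N. Poly_Mapping.lookup f (from_nat_into UNIV N))"
proof (rule injI)
  fix f g :: fock
  assume eq: "(\<lambda>N. Poly_Mapping.lookup f (from_nat_into UNIV N)) = (\<lambda>N. Poly_Mapping.lookup g (from_nat_into UNIV N))"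
  have "range mset = (UNIV :: (nat \<times> nat) multiset set)"
    using ex_mset by (auto simp: surj_def eq_commute)
  then have "countable (UNIV :: (nat \<times> nat) multiset set)"
    using countable_image[OF countableI_type[of "UNIV :: (nat \<times> nat) list set"], of mset] by simp
  then have surj: "\<exists>N. from_nat_into UNIV N = m" for m :: "(nat \<times> nat) multiset"
    by (rule from_nat_into_surj) simp
  show "f = g"
  proof (rule poly_mapping_eqI)
    fix m :: "(nat \<times> nat) multiset"
    obtain N where "from_nat_into UNIV N = m" using surj by blast
    then show "Poly_Mapping.lookup f m = Poly_Mapping.lookup g m" using fun_cong[OF eq, of N] by simp
  qed
qed

text \<open>Reduces sufficiency to exhibiting a highest weight vector in the Fock space;
  \<open>C\<close> is the constant modulo which weights are taken.\<close>

theorem fock_unitary_parameter: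
  assumes "p \<ge> 1" and "v0 \<noteq> 0"
    and "\<And>i j. i < j \<Longrightarrow> j < p + q \<Longrightarrow> osc p K i j v0 = 0"
    and "\<And>i. i < p + q \<Longrightarrow> osc p K i i v0 = pscale (of_real (l i)) v0"
    and \<Lambda>: "\<And>i. i < p + q \<Longrightarrow> \<Lambda> (Suc i) - rho (p + q) (Suc i) = l i + C"
  shows "unitary_parameter p q \<Lambda>"
proof -
  interpret gl_ops pscale UNIV "p + q" "osc p K" by (rule osc_gl_ops)
  interpret hw_unitary pscale p q "osc p K" fip l v0
  proof unfold_locales
    show "p \<ge> 1" by (rule assms)
    show "v0 \<noteq> 0" by (rule assms)
    show "fip (u + v) x = fip u x + fip v x" for u v x :: fock by (rule fip_add)
    show "fip (pscale c u) x = c * fip u x" for c and u x :: fock by (rule fip_pscale)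
    show "fip x u = cnj (fip u x)" for u x :: fock by (rule fip_cnj)
    show "Re (fip u u) > 0" if "u \<noteq> 0" for u :: fock using that by (rule fip_pos)
    show "\<exists>F S. ps.subspace F \<and> u \<in> F \<and> finite S \<and> F \<subseteq> ps.span S \<and>
      (\<forall>i<p + q. \<forall>j<p + q. (i < p) = (j < p) \<longrightarrow> (\<forall>x\<in>F. osc p K i j x \<in> F))" for u
      by (rule osc_k_finite)
  qed (use assms(3,4) fip_osc in blast)+
  have "sl.realizes_L (\<lambda>i. \<Lambda> i - rho (p + q) i)"
    unfolding sl.realizes_L_def
    using irreducible locally_finite highest_weight[of "\<lambda>i. \<Lambda> i - rho (p + q) i" C] \<Lambda> by blast
  then show ?thesis
    by (rule unitary_parameter_transfer[OF sl.sl_module_axioms _ unitarizable _ _ inj_fock_embedding])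
      (auto simp: lookup_add fun_scale_def)
qed

section \<open>Highest weight vectors in the Fock space\<close>

locale derivation =
  fixes D :: "'a::comm_ring_1 \<Rightarrow> 'a"
  assumes D_add: "D (f + g) = D f + D g"
    and D_mult: "D (f * g) = D f * g + f * D g"
begin

lemma D_0: "D 0 = 0" using D_add[of 0 0] by simp

lemma D_1: "D 1 = 0" using D_mult[of 1 1] by simp

lemma D_uminus: "D (- f) = - D f"
  using D_add[of f "- f"] D_0 by (simp add: eq_neg_iff_add_eq_0 add.commute)

lemma D_sum: "D (\<Sum>x\<in>A. f x) = (\<Sum>x\<in>A. D (f x))"
  by (induction A rule: infinite_finite_induct) (simp_all add: D_0 D_add)

lemma D_prod_0: "(\<And>x. x \<in> A \<Longrightarrow> D (f x) = 0) \<Longrightarrow> D (\<Prod>x\<in>A. f x) = 0"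
  by (induction A rule: infinite_finite_induct) (simp_all add: D_1 D_mult)

lemma D_det_0:
  assumes "M \<in> carrier_mat k k" "\<And>i j. i < k \<Longrightarrow> j < k \<Longrightarrow> D (M $$ (i, j)) = 0"
  shows "D (det M) = 0"
proof -
  have "D (of_int (sign \<pi>) * (\<Prod>i=0..<k. M $$ (i, \<pi> i))) = 0" if "\<pi> permutes {0..<k}" for \<pi>
  proof -
    have "D (\<Prod>i=0..<k. M $$ (i, \<pi> i)) = 0"
    proof (rule D_prod_0)
      fix i assume "i \<in> {0..<k}"
      then have "i < k" "\<pi> i < k" using permutes_in_image[OF that, of i] by auto
      then show "D (M $$ (i, \<pi> i)) = 0" by (rule assms(2))
    qed
    then show ?thesis by (auto simp: sign_def D_mult D_uminus D_1)
  qed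
  then show ?thesis
    using assms(1) by (auto simp: det_def D_sum intro!: sum.neutral)
qed

text \<open>Expand along row \<open>a\<close>: the cofactors are built from entries killed by
  \<open>D\<close>, so \<open>D\<close> acts on that row alone.\<close>

lemma D_det_row:
  assumes M: "M \<in> carrier_mat k k" and a: "a < k"
    and zero: "\<And>i j. i < k \<Longrightarrow> j < k \<Longrightarrow> i \<noteq> a \<Longrightarrow> D (M $$ (i, j)) = 0"
  shows "D (det M) = det (mat k k (\<lambda>(i, j). if i = a then D (M $$ (a, j)) else M $$ (i, j)))"
    (is "_ = det ?N")
proof -
  have N: "?N \<in> carrier_mat k k" by simp
  have del: "mat_delete ?N a j = mat_delete M a j" for j
    using M a by (intro eq_matI) (auto simp: mat_delete_def)
  have cof: "D (cofactor M a j) = 0" if "j < k" for j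
  proof -
    have "D (det (mat_delete M a j)) = 0"
    proof (rule D_det_0)
      show "mat_delete M a j \<in> carrier_mat (k - 1) (k - 1)" using M by (rule mat_delete_carrier)
    qed (use M a that in \<open>auto simp: mat_delete_def intro!: zero\<close>)
    moreover have "D ((- 1) ^ m) = 0" for m
      by (induction m) (simp_all add: D_1 D_mult D_uminus)
    ultimately show ?thesis by (simp add: cofactor_def D_mult)
  qed
  have "D (det M) = (\<Sum>j<k. D (M $$ (a, j)) * cofactor M a j)"
    unfolding laplace_expansion_row[OF M a] D_sum
    by (intro sum.cong refl) (simp add: D_mult cof)
  also have "\<dots> = det ?N"
    unfolding laplace_expansion_row[OF N a] using a
    by (intro sum.cong refl) (simp add: cofactor_def del)
  finally show ?thesis .
qed

end

lemma derivation_pd: "derivation (pd x)"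
  by unfold_locales (simp_all add: pd_add pd_mult)

lemma derivation_eigen_prod_power:
  fixes D :: "'x mpoly \<Rightarrow> 'x mpoly"
  assumes "derivation D" and "\<And>k. k \<in> I \<Longrightarrow> D (g k) = pscale (c k) (g k)"
  shows "D (\<Prod>k\<in>I. g k ^ m k) = pscale (\<Sum>k\<in>I. c k * of_nat (m k)) (\<Prod>k\<in>I. g k ^ m k)"
  using assms(2)
proof (induction I rule: infinite_finite_induct)
  case (insert k I)
  interpret derivation D by fact
  have "D (g k ^ e) = pscale (c k * of_nat e) (g k ^ e)" for e
    by (induction e)
      (simp_all add: D_1 D_mult insert.prems pscale_mult_left pscale_mult_right ps.scale_left_distrib distrib_left)
  then show ?case
    using insert by (simp add: D_mult pscale_mult_left pscale_mult_right ps.scale_left_distrib)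
qed (simp_all add: derivation.D_1[OF assms(1)])

text \<open>The classical polarization operator: it substitutes the variables of row
  \<open>v\<close> for those of row \<open>u\<close>, one occurrence at a time.\<close>

definition polarization :: "nat \<Rightarrow> nat \<Rightarrow> nat \<Rightarrow> fock \<Rightarrow> fock" where
  "polarization K u v f = (\<Sum>c<K. var (v, c) * pd (u, c) f)"

lemma derivation_polarization: "derivation (polarization K u v)"
  by unfold_locales
    (simp_all add: polarization_def pd_add pd_mult distrib_left sum.distrib sum_distrib_left sum_distrib_right mult_ac)

definition minor :: "nat \<Rightarrow> (nat \<Rightarrow> nat) \<Rightarrow> nat \<Rightarrow> fock" where
  "minor k R off = det (mat k k (\<lambda>(a, c). var (R a, off + c)))"

lemma pd_minor_0:
  assumes "i \<notin> R ` {..<k} \<or> c \<notin> {off..<off + k}"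
  shows "pd (i, c) (minor k R off) = 0"
proof -
  interpret derivation "pd (i, c)" by (rule derivation_pd)
  show ?thesis
    unfolding minor_def using assms by (intro D_det_0[of _ k]) (auto simp: pd_var)
qed

lemma polarization_var:
  "polarization K u v (var (i, c)) = (if u = i \<and> c < K then var (v, c) else 0)"
proof -
  have "polarization K u v (var (i, c)) = (\<Sum>d<K. if d = c then if u = i then var (v, d) else 0 else 0)"
    unfolding polarization_def by (intro sum.cong refl) (auto simp: pd_var)
  then show ?thesis by simp
qed

text \<open>Polarization replaces row \<open>u\<close> of the minor by row \<open>v\<close>. If
  \<open>v\<close> is a different row of the minor, two rows coincide and the determinant
  vanishes.\<close>

lemma polarization_minor:
  assumes R: "inj_on R {..<k}" and K: "off + k \<le> K" and v: "u \<in> R ` {..<k} \<Longrightarrow> v \<in> R ` {..<k}"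
  shows "polarization K u v (minor k R off) = (if u \<in> R ` {..<k} \<and> u = v then minor k R off else 0)"
proof -
  interpret derivation "polarization K u v" by (rule derivation_polarization)
  let ?M = "mat k k (\<lambda>(a, c). var (R a, off + c)) :: fock mat"
  show ?thesis
  proof (cases "u \<in> R ` {..<k}")
    case False
    then show ?thesis
      unfolding minor_def by (simp, intro D_det_0[of _ k]) (auto simp: polarization_var)
  next
    case True
    then obtain a where a: "a < k" "u = R a" by auto
    obtain b where b: "b < k" "v = R b" using v[OF True] by auto
    let ?N = "mat k k (\<lambda>(i, j). if i = a then polarization K u v (?M $$ (a, j)) else ?M $$ (i, j))"
    have "polarization K u v (minor k R off) = det ?N"
      unfolding minor_def
    proof (rule D_det_row[OF _ a(1)])
      fix i j assume "i < k" "j < k" "i \<noteq> a"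
      then show "polarization K u v (?M $$ (i, j)) = 0"
        using R a by (auto simp: polarization_var inj_on_def)
    qed simp
    also have "?N = mat k k (\<lambda>(i, j). if i = a then var (v, off + j) else var (R i, off + j))"
      by (intro eq_matI) (use a K in \<open>auto simp: polarization_var\<close>)
    also have "det \<dots> = (if u = v then minor k R off else 0)"
    proof (cases "u = v")
      case True
      then have "mat k k (\<lambda>(i, j). if i = a then var (v, off + j) else var (R i, off + j)) = ?M"
        using a by (intro eq_matI) auto
      then show ?thesis using True by (simp add: minor_def)
    next
      case False
      then have "a \<noteq> b" using a b by auto
      then have "det (mat k k (\<lambda>(i, j). if i = a then var (v, off + j) else var (R i, off + j) :: fock)) = 0"
        using a b by (intro det_identical_rows[of _ k a b]) (auto intro!: eq_vecI)
      then show ?thesis using False by simp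
    qed
    finally show ?thesis using True by simp
  qed
qed

text \<open>The term with \<open>K\<close> arises from moving the derivative past the variable, once
  per column. It is the origin of the shift by \<open>r + s\<close> in the weights of the left
  block.\<close>

lemma osc_compact_left:
  assumes "i < p" "j < p"
  shows "osc p K i j f = - polarization K i j f - (if i = j then pscale (of_nat K) f else 0)"
proof -
  have "osc p K i j f = (\<Sum>c<K. - (var (j, c) * pd (i, c) f) - (if i = j then f else 0))"
    unfolding osc_def using assms by (intro sum.cong refl) (auto simp: Qop_def Pop_def pd_var_mult)
  also have "\<dots> = - polarization K i j f - (\<Sum>c<K. if i = j then f else 0)"
    by (simp add: polarization_def sum_subtractf sum_negf)
  also have "(\<Sum>c<K. if i = j then f else 0) = (if i = j then pscale (of_nat K) f else 0)"
    by (simp add: pscale_def)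
  finally show ?thesis .
qed

lemma osc_compact_right:
  assumes "p \<le> i" "p \<le> j"
  shows "osc p K i j f = polarization K j i f"
  unfolding osc_def polarization_def using assms by (intro sum.cong refl) (auto simp: Qop_def Pop_def)

text \<open>Evaluation at a point serves to show that the product of minors is not the zero
  polynomial.\<close>

definition eval_at :: "('x \<Rightarrow> complex) \<Rightarrow> 'x mpoly \<Rightarrow> complex" where
  "eval_at g f = (\<Sum>m\<in>Poly_Mapping.keys f. Poly_Mapping.lookup f m * (\<Prod>x\<in>#m. g x))"

lemma eval_at_single: "eval_at g (Poly_Mapping.single k c) = c * (\<Prod>x\<in>#k. g x)"
  by (simp add: eval_at_def)

lemma eval_at_add: "eval_at g (f + h) = eval_at g f + eval_at g h"
proof -
  let ?A = "Poly_Mapping.keys f \<union> Poly_Mapping.keys h"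
  have *: "eval_at g u = (\<Sum>m\<in>?A. Poly_Mapping.lookup u m * (\<Prod>x\<in>#m. g x))"
    if "Poly_Mapping.keys u \<subseteq> ?A" for u
    unfolding eval_at_def using that by (intro sum.mono_neutral_left) (auto simp: in_keys_iff)
  show ?thesis
    using keys_add[of f h] by (simp add: * lookup_add distrib_right sum.distrib)
qed

lemma eval_at_0: "eval_at g 0 = 0"
  by (simp add: eval_at_def)

lemma eval_at_mult: "eval_at g (f * h) = eval_at g f * eval_at g h"
proof (induction f rule: poly_mapping_additive_induct)
  case (single k c)
  show ?case
    by (induction h rule: poly_mapping_additive_induct)
      (simp_all add: mult_single eval_at_single eval_at_add eval_at_0 distrib_left)
qed (simp_all add: eval_at_add eval_at_0 distrib_right)

lemma eval_at_1: "eval_at g 1 = 1"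
  using eval_at_single[of g 0 1] by simp

lemma comm_ring_hom_eval_at: "comm_ring_hom (eval_at g)"
  by unfold_locales (simp_all add: eval_at_add eval_at_0 eval_at_mult eval_at_1)

lemma eval_at_var: "eval_at g (var x) = g x"
  by (simp add: var_def eval_at_single)

lemma eval_at_minor:
  assumes "\<And>a c. a < k \<Longrightarrow> c < k \<Longrightarrow> g (R a, off + c) = (if a = c then 1 else 0)"
  shows "eval_at g (minor k R off) = 1"
proof -
  interpret comm_ring_hom "eval_at g" by (rule comm_ring_hom_eval_at)
  have "map_mat (eval_at g) (mat k k (\<lambda>(a, c). var (R a, off + c))) = 1\<^sub>m k"
    by (intro eq_matI) (use assms in \<open>auto simp: eval_at_var\<close>)
  then show ?thesis
    unfolding minor_def using hom_det[of "mat k k (\<lambda>(a, c). var (R a, off + c))"] by simp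
qed

text \<open>Up to a constant the weight will be \<open>-(r + s) - A k\<close> in the left block and
  \<open>B k\<close> in the right one; dominance for the compact roots makes \<open>A\<close>
  increase and \<open>B\<close> decrease, and the numbers of columns allow \<open>A\<close> at most
  \<open>r\<close> and \<open>B\<close> at most \<open>s\<close> nonzero entries. The value
  \<open>A 0 = 0\<close> contained in \<open>A_0\<close> matters when \<open>r = p\<close>.\<close>

context
  fixes p q r s :: nat and A B :: "nat \<Rightarrow> nat"
  assumes p: "1 \<le> p" and r: "r \<le> p" and s: "s \<le> q"
    and A_mono: "\<And>i j. i \<le> j \<Longrightarrow> j \<le> p \<Longrightarrow> A i \<le> A j" and A_0: "\<And>i. i \<le> p - r \<Longrightarrow> A i = 0"
    and B_mono: "\<And>i j. i \<le> j \<Longrightarrow> B j \<le> B i" and B_0: "\<And>i. i > s \<Longrightarrow> B i = 0"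
begin

text \<open>The rows of \<open>xminor\<close> are numbered upwards from \<open>p - 1\<close>, so that all minors take the value 1 at a
  single 0-1 point (see \<open>hwv_nonzero\<close>). The two families use disjoint columns; therefore the mixed second
  order raising operators annihilate \<open>hwv\<close>.\<close>
definition xminor :: "nat \<Rightarrow> fock" where
  "xminor k = minor k (\<lambda>a. p - 1 - a) 0"

definition yminor :: "nat \<Rightarrow> fock" where
  "yminor k = minor k (\<lambda>a. p + a) r"

text \<open>Row \<open>i\<close> of the left block occurs in \<open>xminor k\<close> for
  \<open>p - k \<le> i\<close>, so consecutive differences as exponents make the degree in row
  \<open>i\<close> telescope to \<open>A (i + 1)\<close>.\<close>

definition xprod :: fock where
  "xprod = (\<Prod>k=1..r. xminor k ^ (A (p + 1 - k) - A (p - k)))"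

definition yprod :: fock where
  "yprod = (\<Prod>k=1..s. yminor k ^ (B k - B (k + 1)))"

definition hwv :: fock where
  "hwv = xprod * yprod"

lemma x_rows: "k \<le> p \<Longrightarrow> (\<lambda>a. p - 1 - a) ` {..<k} = {p - k..<p}"
proof (intro subset_antisym subsetI)
  fix i assume "k \<le> p" "i \<in> {p - k..<p}"
  then show "i \<in> (\<lambda>a. p - 1 - a) ` {..<k}" by (intro image_eqI[of _ _ "p - 1 - i"]) auto
qed auto

lemma y_rows: "(\<lambda>a. p + a) ` {..<k} = {p..<p + k}"
proof (intro subset_antisym subsetI)
  fix i assume "i \<in> {p..<p + k}"
  then show "i \<in> (\<lambda>a. p + a) ` {..<k}" by (intro image_eqI[of _ _ "i - p"]) auto
qed auto

lemma derivation_0_prod: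
  assumes D: "derivation D"
  shows "(\<And>k. 1 \<le> k \<Longrightarrow> k \<le> r \<Longrightarrow> D (xminor k) = 0) \<Longrightarrow> D xprod = 0"
    "(\<And>k. 1 \<le> k \<Longrightarrow> k \<le> s \<Longrightarrow> D (yminor k) = 0) \<Longrightarrow> D yprod = 0"
  unfolding xprod_def yprod_def
  by (subst derivation_eigen_prod_power[OF D, where c = "\<lambda>_. 0"]; simp)+

lemma pd_xprod: "i \<ge> p \<or> c \<ge> r \<Longrightarrow> pd (i, c) xprod = 0"
  by (rule derivation_0_prod[OF derivation_pd])
    (unfold xminor_def, rule pd_minor_0, use r in \<open>auto simp: x_rows\<close>)

lemma pd_yprod: "i < p \<or> c < r \<Longrightarrow> pd (i, c) yprod = 0"
  by (rule derivation_0_prod[OF derivation_pd])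
    (unfold yminor_def, rule pd_minor_0, auto simp: y_rows)

lemma polarization_xminor:
  assumes "1 \<le> k" "k \<le> r" "v < p \<Longrightarrow> u \<le> v" "u < p \<Longrightarrow> v < p"
  shows "polarization (r + s) u v (xminor k) = (if p - k \<le> u \<and> u < p \<and> u = v then xminor k else 0)"
proof -
  have k: "k \<le> p" using assms r by simp
  have "polarization (r + s) u v (minor k (\<lambda>a. p - 1 - a) 0) =
      (if u \<in> (\<lambda>a. p - 1 - a) ` {..<k} \<and> u = v then minor k (\<lambda>a. p - 1 - a) 0 else 0)"
  proof (rule polarization_minor)
    show "inj_on (\<lambda>a. p - 1 - a) {..<k}" using k by (auto simp: inj_on_def)
    show "v \<in> (\<lambda>a. p - 1 - a) ` {..<k}" if "u \<in> (\<lambda>a. p - 1 - a) ` {..<k}"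
      using that assms unfolding x_rows[OF k] by auto
  qed (use assms in auto)
  then show ?thesis by (simp only: x_rows[OF k] xminor_def atLeastLessThan_iff conj_assoc)
qed

lemma polarization_yminor:
  assumes "1 \<le> k" "k \<le> s" "p \<le> v \<Longrightarrow> v \<le> u" "p \<le> u \<Longrightarrow> p \<le> v"
  shows "polarization (r + s) u v (yminor k) = (if p \<le> u \<and> u < p + k \<and> u = v then yminor k else 0)"
  unfolding yminor_def using assms
  by (subst polarization_minor) (auto simp: y_rows)

lemma hwv_nonzero: "hwv \<noteq> 0"
proof -
  \<comment> \<open>The ones turn every minor into an identity matrix: they lie on the antidiagonal
    \<open>i + c = p - 1\<close> of the left rows, and on the diagonal of the right rows that starts
    at row \<open>p\<close> and column \<open>r\<close>.\<close>
  define g :: "nat \<times> nat \<Rightarrow> complex" where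
    "g = (\<lambda>(i, c). if i < p \<and> i + c = p - 1 \<or> p \<le> i \<and> c = r + (i - p) then 1 else 0)"
  interpret comm_ring_hom "eval_at g" by (rule comm_ring_hom_eval_at)
  have x: "eval_at g (xminor k) = 1" if "1 \<le> k" "k \<le> r" for k
    unfolding xminor_def using that r p by (intro eval_at_minor) (auto simp: g_def)
  have y: "eval_at g (yminor k) = 1" if "1 \<le> k" "k \<le> s" for k
    unfolding yminor_def by (intro eval_at_minor) (auto simp: g_def)
  have pw: "eval_at g (f ^ m) = eval_at g f ^ m" for f m
    by (induction m) (simp_all add: eval_at_mult eval_at_1)
  have pr: "eval_at g (\<Prod>k\<in>I. f k) = (\<Prod>k\<in>I. eval_at g (f k))" for I :: "nat set" and f
    by (induction I rule: infinite_finite_induct) (simp_all add: eval_at_mult eval_at_1)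
  have "eval_at g hwv = 1"
    by (simp add: hwv_def xprod_def yprod_def eval_at_mult pr pw x y)
  then show ?thesis by (auto simp: eval_at_0)
qed

text \<open>The rows of \<open>xminor k\<close> are the last \<open>k\<close> of the left block,
  those of \<open>yminor k\<close> the first \<open>k\<close> of the right block. So a compact
  raising operator either misses a minor or substitutes a row already present. For a noncompact
  root, in each column one of the two derivatives vanishes.\<close>

lemma hwv_raise:
  assumes "i < j" "j < p + q"
  shows "osc p (r + s) i j hwv = 0"
proof -
  interpret D: derivation "polarization (r + s) u v" for u v by (rule derivation_polarization)
  consider "j < p" | "i < p" "p \<le> j" | "p \<le> i" by linarith
  then show ?thesis
  proof cases
    case 1
    have "polarization (r + s) i j xprod = 0" "polarization (r + s) i j yprod = 0"
      using 1 assms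
      by (auto intro!: derivation_0_prod[OF derivation_polarization] simp: polarization_xminor polarization_yminor)
    then show ?thesis using 1 assms by (simp add: osc_compact_left hwv_def D.D_mult)
  next
    case 2
    have "Qop p i c (Pop p j c hwv) = 0" for c
    proof -
      have "pd (j, c) hwv = xprod * pd (j, c) yprod"
        using 2 by (simp add: hwv_def pd_mult pd_xprod)
      then have "pd (i, c) (pd (j, c) hwv) = pd (i, c) xprod * pd (j, c) yprod"
        using 2 by (simp add: pd_mult pd_commute[of "(i, c)" "(j, c)" yprod] pd_yprod)
      also have "\<dots> = 0"
        using pd_xprod[of i c] pd_yprod[of j c] by (cases "c < r") auto
      finally show ?thesis using 2 by (simp add: Qop_def Pop_def)
    qed
    then show ?thesis by (simp add: osc_def)
  next
    case 3
    have "polarization (r + s) j i xprod = 0" "polarization (r + s) j i yprod = 0"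
      using 3 assms
      by (auto intro!: derivation_0_prod[OF derivation_polarization] simp: polarization_xminor polarization_yminor)
    then show ?thesis using 3 assms by (simp add: osc_compact_right hwv_def D.D_mult)
  qed
qed

lemma hwv_weight:
  assumes "i < p + q"
  shows "osc p (r + s) i i hwv =
    pscale (of_real (if i < p then - real (A (i + 1)) - real (r + s) else real (B (i - p + 1)))) hwv"
proof -
  interpret D: derivation "polarization (r + s) u v" for u v by (rule derivation_polarization)
  show ?thesis
  proof (cases "i < p")
    case True
    have "polarization (r + s) i i xprod =
        pscale (\<Sum>k=1..r. (if p - k \<le> i then 1 else 0) * of_nat (A (p + 1 - k) - A (p - k))) xprod"
      unfolding xprod_def
      by (rule derivation_eigen_prod_power[OF derivation_polarization])
        (use True in \<open>auto simp: polarization_xminor\<close>)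
    also have "(\<Sum>k=1..r. (if p - k \<le> i then 1 else 0) * of_nat (A (p + 1 - k) - A (p - k)) :: complex) =
      of_nat (\<Sum>k=p - r..<p. if k \<le> i then A (Suc k) - A k else 0)"
      unfolding of_nat_sum
      by (rule sum.reindex_bij_witness[of _ "\<lambda>k. p - k" "\<lambda>k. p - k"]) (use r in \<open>auto simp: Suc_diff_le\<close>)
    also have "(\<Sum>k=p - r..<p. if k \<le> i then A (Suc k) - A k else 0) = A (Suc i)"
    proof (cases "p - r \<le> i")
      case True
      have "(\<Sum>k=p - r..<p. if k \<le> i then A (Suc k) - A k else 0) = (\<Sum>k=p - r..<Suc i. A (Suc k) - A k)"
        using \<open>i < p\<close> by (intro sum.mono_neutral_cong_right) auto
      \<comment> \<open>Subtraction is truncated here, so the telescoping relies on the monotonicity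
        of \<open>A\<close>.\<close>
      also have "\<dots> = A (Suc i) - A (p - r)"
        using True \<open>i < p\<close> A_mono
      proof (induction i)
        case (Suc i)
        show ?case
        proof (cases "p - r \<le> i")
          case True
          then have "(\<Sum>k=p - r..<Suc i. A (Suc k) - A k) = A (Suc i) - A (p - r)" using Suc by simp
          moreover have "A (p - r) \<le> A (Suc i)" "A (Suc i) \<le> A (Suc (Suc i))"
            using Suc.prems True by auto
          ultimately show ?thesis using Suc.prems by simp
        next
          case False
          then have "p - r = Suc i" using Suc.prems by simp
          then show ?thesis by simp
        qed
      qed simp
      finally show ?thesis using A_0 by simp
    next
      case False
      then show ?thesis using A_0[of "Suc i"] by (auto intro!: sum.neutral)
    qed
    finally have "polarization (r + s) i i xprod = pscale (of_nat (A (Suc i))) xprod" .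
    moreover have "polarization (r + s) i i yprod = 0"
      using True by (auto intro!: derivation_0_prod[OF derivation_polarization] simp: polarization_yminor)
    ultimately show ?thesis
      using True by (simp add: osc_compact_left hwv_def D.D_mult pscale_mult_left
          ps.scale_left_diff_distrib ps.scale_left_distrib)
  next
    case False
    have "polarization (r + s) i i yprod =
        pscale (\<Sum>k=1..s. (if i < p + k then 1 else 0) * of_nat (B k - B (k + 1))) yprod"
      unfolding yprod_def
      by (rule derivation_eigen_prod_power[OF derivation_polarization])
        (use False in \<open>auto simp: polarization_yminor\<close>)
    also have "(\<Sum>k=1..s. (if i < p + k then 1 else 0) * of_nat (B k - B (k + 1)) :: complex) =
       of_nat (\<Sum>k=1..s. if i - p < k then B k - B (Suc k) else 0)"
      unfolding of_nat_sum using False by (intro sum.cong) auto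
    also have "(\<Sum>k=1..s. if i - p < k then B k - B (Suc k) else 0) = (\<Sum>k=Suc (i - p)..s. B k - B (Suc k))"
      by (intro sum.mono_neutral_cong_right) auto
    also have "\<dots> = B (Suc (i - p))"
    proof (cases "Suc (i - p) \<le> s")
      case True
      have "(\<Sum>k=Suc (i - p)..s'. B k - B (Suc k)) = B (Suc (i - p)) - B (Suc s')" if "i - p \<le> s'" for s'
        using that
      proof (induction rule: dec_induct)
        case (step m)
        have "B (Suc m) \<le> B (Suc (i - p))" "B (Suc (Suc m)) \<le> B (Suc m)" using step B_mono by auto
        then show ?case using step by simp
      qed simp
      from this[of s] show ?thesis using True B_0[of "Suc s"] by simp
    qed (use B_0[of "Suc (i - p)"] in auto)
    finally have "polarization (r + s) i i yprod = pscale (of_nat (B (Suc (i - p)))) yprod" .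
    moreover have "polarization (r + s) i i xprod = 0"
      using False by (auto intro!: derivation_0_prod[OF derivation_polarization] simp: polarization_xminor)
    ultimately show ?thesis
      using False by (simp add: osc_compact_right hwv_def D.D_mult pscale_mult_right)
  qed
qed

theorem unitary_parameter_hwv:
  assumes "\<And>k. 1 \<le> k \<Longrightarrow> k \<le> p \<Longrightarrow> \<Lambda> k - rho (p + q) k = C - real (A k) - real (r + s)"
    and "\<And>k. 1 \<le> k \<Longrightarrow> k \<le> q \<Longrightarrow> \<Lambda> (p + k) - rho (p + q) (p + k) = C + real (B k)"
  shows "unitary_parameter p q \<Lambda>"
proof (rule fock_unitary_parameter[OF p hwv_nonzero])
  fix i assume i: "i < p + q"
  show "\<Lambda> (Suc i) - rho (p + q) (Suc i) =
      (if i < p then - real (A (i + 1)) - real (r + s) else real (B (i - p + 1))) + C"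
    using assms(1)[of "Suc i"] assms(2)[of "Suc i - p"] i by (auto simp: Suc_diff_le)
qed (use hwv_raise hwv_weight in auto)

end

section \<open>Shuffles and edge points\<close>

lemma perm_rank:
  assumes \<sigma>: "\<sigma> permutes {1..n}" and x: "x \<in> {1..n}"
  shows "\<sigma> x = Suc (card {y \<in> {1..n}. \<sigma> y < \<sigma> x})"
proof -
  have "\<sigma> ` {y \<in> {1..n}. \<sigma> y < \<sigma> x} = {1..<\<sigma> x}"
  proof (intro subset_antisym subsetI)
    fix z assume z: "z \<in> {1..<\<sigma> x}"
    moreover have "\<sigma> x \<le> n" using permutes_in_image[OF \<sigma>, of x] x by simp
    ultimately have "z \<in> \<sigma> ` {1..n}" using permutes_image[OF \<sigma>] by simp
    then show "z \<in> \<sigma> ` {y \<in> {1..n}. \<sigma> y < \<sigma> x}" using z by auto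
  next
    fix z assume "z \<in> \<sigma> ` {y \<in> {1..n}. \<sigma> y < \<sigma> x}"
    then obtain y where "y \<in> {1..n}" "\<sigma> y < \<sigma> x" "z = \<sigma> y" by blast
    then show "z \<in> {1..<\<sigma> x}" using permutes_in_image[OF \<sigma>, of y] by simp
  qed
  then have "card {1..<\<sigma> x} = card {y \<in> {1..n}. \<sigma> y < \<sigma> x}"
    using card_image[of \<sigma> "{y \<in> {1..n}. \<sigma> y < \<sigma> x}"] permutes_inj[OF \<sigma>]
    by (metis inj_on_subset subset_UNIV)
  moreover have "\<sigma> x \<ge> 1" using permutes_in_image[OF \<sigma>, of x] x by simp
  ultimately show ?thesis by simp
qed

text \<open>\<open>\<sigma>\<close> stands for the inverse of \<open>w\<close>, so that coordinate
  \<open>k\<close> of \<open>w\<rho>\<close> is \<open>\<rho>\<close> at \<open>\<sigma> k\<close>.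
  As \<open>\<rho>\<close> decreases, dominance for the compact roots says that
  \<open>\<sigma>\<close> increases on each block, and larger values of \<open>\<sigma>\<close> mean
  smaller coordinates.\<close>

locale shuffle =
  fixes p q n :: nat and \<sigma> :: "nat \<Rightarrow> nat"
  assumes p: "1 \<le> p" and q: "1 \<le> q" and n: "n = p + q"
    and perm: "\<sigma> permutes {1..n}"
    and left: "\<And>i j. 1 \<le> i \<Longrightarrow> i < j \<Longrightarrow> j \<le> p \<Longrightarrow> \<sigma> i < \<sigma> j"
    and right: "\<And>i j. p < i \<Longrightarrow> i < j \<Longrightarrow> j \<le> n \<Longrightarrow> \<sigma> i < \<sigma> j"
begin

lemma sigma_range: "1 \<le> i \<Longrightarrow> i \<le> n \<Longrightarrow> 1 \<le> \<sigma> i \<and> \<sigma> i \<le> n"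
  using permutes_in_image[OF perm, of i] by simp

lemma eq_iff: "\<sigma> i = \<sigma> j \<longleftrightarrow> i = j"
  using permutes_inj[OF perm] by (auto dest: injD)

text \<open>Inside its own block exactly the positions before \<open>k\<close> have smaller values,
  so the other block accounts for the rest of the rank. In terms of the Young diagram, row
  \<open>k\<close> counts the right positions with values above \<open>\<sigma> k\<close>.\<close>

lemma left_rank:
  assumes k: "1 \<le> k" "k \<le> p"
  shows "\<sigma> k = k + card {t \<in> {p + 1..n}. \<sigma> t < \<sigma> k}"
proof -
  have "{y \<in> {1..n}. \<sigma> y < \<sigma> k} = {1..<k} \<union> {t \<in> {p + 1..n}. \<sigma> t < \<sigma> k}"
  proof (intro subset_antisym subsetI)
    fix y assume y: "y \<in> {y \<in> {1..n}. \<sigma> y < \<sigma> k}"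
    have "y < k" if "y \<le> p"
    proof (rule ccontr)
      assume "\<not> y < k"
      then have "\<sigma> k \<le> \<sigma> y" using left[of k y] k that by (cases "y = k") auto
      then show False using y by simp
    qed
    then show "y \<in> {1..<k} \<union> {t \<in> {p + 1..n}. \<sigma> t < \<sigma> k}" using y by auto
  next
    fix y assume "y \<in> {1..<k} \<union> {t \<in> {p + 1..n}. \<sigma> t < \<sigma> k}"
    then show "y \<in> {y \<in> {1..n}. \<sigma> y < \<sigma> k}" using left[of y k] k n by auto
  qed
  moreover have "{1..<k} \<inter> {t \<in> {p + 1..n}. \<sigma> t < \<sigma> k} = {}" using k by auto
  ultimately have "card {y \<in> {1..n}. \<sigma> y < \<sigma> k} = card {1..<k} + card {t \<in> {p + 1..n}. \<sigma> t < \<sigma> k}"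
    by (simp add: card_Un_disjoint)
  then show ?thesis using perm_rank[OF perm, of k] k n by simp
qed

lemma right_rank:
  assumes k: "p < k" "k \<le> n"
  shows "\<sigma> k = k - p + card {t \<in> {1..p}. \<sigma> t < \<sigma> k}"
proof -
  have "{y \<in> {1..n}. \<sigma> y < \<sigma> k} = {p + 1..<k} \<union> {t \<in> {1..p}. \<sigma> t < \<sigma> k}"
  proof (intro subset_antisym subsetI)
    fix y assume y: "y \<in> {y \<in> {1..n}. \<sigma> y < \<sigma> k}"
    have "y < k" if "p < y"
    proof (rule ccontr)
      assume "\<not> y < k"
      then have "\<sigma> k \<le> \<sigma> y" using right[of k y] k that y by (cases "y = k") auto
      then show False using y by simp
    qed
    then show "y \<in> {p + 1..<k} \<union> {t \<in> {1..p}. \<sigma> t < \<sigma> k}" using y by auto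
  next
    fix y assume "y \<in> {p + 1..<k} \<union> {t \<in> {1..p}. \<sigma> t < \<sigma> k}"
    then show "y \<in> {y \<in> {1..n}. \<sigma> y < \<sigma> k}" using right[of y k] k n by auto
  qed
  moreover have "{p + 1..<k} \<inter> {t \<in> {1..p}. \<sigma> t < \<sigma> k} = {}" using k by auto
  ultimately have "card {y \<in> {1..n}. \<sigma> y < \<sigma> k} = card {p + 1..<k} + card {t \<in> {1..p}. \<sigma> t < \<sigma> k}"
    by (simp add: card_Un_disjoint)
  then show ?thesis using perm_rank[OF perm, of k] k n by simp
qed

text \<open>\<open>\<sigma>\<close> maps \<open>{1..j} \<union> {n - i + 1..n}\<close> to the interval of the \<open>i + j\<close> numbers following \<open>q - i\<close>.\<close>
definition edge :: "nat \<Rightarrow> nat \<Rightarrow> bool" where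
  "edge i j \<longleftrightarrow> 1 \<le> i \<and> i \<le> q \<and> 1 \<le> j \<and> j \<le> p \<and>
     (\<forall>k. 1 \<le> k \<longrightarrow> k \<le> j \<longrightarrow> \<sigma> k = q - i + k) \<and> (\<forall>k. j < k \<longrightarrow> k \<le> p \<longrightarrow> \<sigma> k = q + k)"

text \<open>\<open>C\<close> is empty or \<open>{1..j}\<close>: the values on \<open>{1..j}\<close>
  are consecutive and \<open>\<sigma> t\<close> is none of them, while the left values after
  \<open>j\<close> exceed all right values. The rank then gives \<open>\<sigma> t\<close>, and
  comparison with the run decides which case occurs.\<close>

lemma edge_right:
  assumes "edge i j" "p < t" "t \<le> n"
  shows "\<sigma> t = (if t \<le> n - i then t - p else t - p + j)"
proof -
  have e: "1 \<le> i" "i \<le> q" "1 \<le> j" "j \<le> p" "\<And>k. 1 \<le> k \<Longrightarrow> k \<le> j \<Longrightarrow> \<sigma> k = q - i + k"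
     "\<And>k. j < k \<Longrightarrow> k \<le> p \<Longrightarrow> \<sigma> k = q + k"
    using assms(1) unfolding edge_def by auto
  define C where "C = {k \<in> {1..p}. \<sigma> k < \<sigma> t}"
  have rank: "\<sigma> t = t - p + card C" using right_rank[OF assms(2,3)] by (simp add: C_def)
  \<comment> \<open>By \<open>left_rank\<close>, \<open>\<sigma> k = q + k\<close> forces all
    \<open>q\<close> right values below \<open>\<sigma> k\<close>.\<close>
  have noj: "k \<notin> C" if "j < k" for k
  proof
    assume k: "k \<in> C"
    then have "card {t \<in> {p + 1..n}. \<sigma> t < \<sigma> k} = card {p + 1..n}"
      using left_rank[of k] e(6)[OF that] n by (auto simp: C_def)
    then have eq: "{t \<in> {p + 1..n}. \<sigma> t < \<sigma> k} = {p + 1..n}"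
      by (intro card_subset_eq) auto
    have "t \<in> {p + 1..n}" using assms by simp
    then have "t \<in> {t \<in> {p + 1..n}. \<sigma> t < \<sigma> k}" by (simp only: eq)
    then have "\<sigma> t < \<sigma> k" by simp
    then show False using k by (simp add: C_def)
  qed
  have all: "C = {} \<or> C = {1..j}"
  proof (cases "C = {}")
    case False
    then obtain k where k: "k \<in> C" by blast
    then have kj: "1 \<le> k" "k \<le> j" "\<sigma> k < \<sigma> t" using noj[of k] not_less[of j k] by (auto simp: C_def)
    have "\<sigma> j < \<sigma> t"
    proof -
      have "\<sigma> k' < \<sigma> t" if "k \<le> k'" "k' \<le> j" for k'
        using that
      proof (induction k' rule: dec_induct)
        case (step m)
        then have "\<sigma> m < \<sigma> t" "\<sigma> (Suc m) = Suc (\<sigma> m)" using kj e(5)[of m] e(5)[of "Suc m"] by auto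
        moreover have "Suc m \<noteq> t" using step.prems e(4) assms(2) by simp
        then have "\<sigma> (Suc m) \<noteq> \<sigma> t" by (simp add: eq_iff)
        ultimately show ?case by simp
      qed (rule kj)
      then show ?thesis using kj by blast
    qed
    then have "k' \<in> C" if "1 \<le> k'" "k' \<le> j" for k'
      using left[of k' j] that e(4) by (cases "k' = j") (auto simp: C_def intro: less_trans)
    moreover have "C \<subseteq> {1..j}"
    proof
      fix k' assume "k' \<in> C"
      then show "k' \<in> {1..j}" using noj[of k'] by (cases "j < k'") (simp_all add: C_def)
    qed
    ultimately show ?thesis by auto
  qed simp
  show ?thesis
  proof (cases "C = {}")
    case True
    then have "\<not> \<sigma> 1 < \<sigma> t" using p by (auto simp: C_def)
    then have "\<sigma> t < \<sigma> 1" using eq_iff[of 1 t] assms p by (metis linorder_neqE_nat not_less)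
    then have "t - p \<le> q - i" using e(5)[of 1] e rank True by simp
    then show ?thesis using rank True assms n e by auto
  next
    case False
    then have "C = {1..j}" using all by simp
    then have "card C = j" "j \<in> C" using e(3) by simp_all
    then have "\<sigma> j < \<sigma> t" unfolding C_def by blast
    then have "q - i < t - p" using rank e(5)[of j] e(1-4) \<open>card C = j\<close> by simp
    then show ?thesis using rank \<open>card C = j\<close> assms n e by auto
  qed
qed

lemma edge_unique:
  assumes "edge i j" "edge i' j'"
  shows "i = i' \<and> j = j'"
proof -
  have "i = i'" using assms by (auto simp: edge_def)
  moreover have "j' \<le> j" if "edge i j" "edge i j'" for j j'
  proof (rule ccontr)
    assume "\<not> j' \<le> j"
    then have j: "Suc j \<le> j'" by simp
    have i: "1 \<le> i" "i \<le> q" and "Suc j \<le> p" using that(2) j by (simp_all add: edge_def)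
    then have "\<sigma> (Suc j) = q + Suc j" using that(1) by (simp add: edge_def)
    moreover have "\<sigma> (Suc j) = q - i + Suc j" using that(2) j by (simp add: edge_def)
    ultimately show False using i by simp
  qed
  ultimately show ?thesis using assms by (auto intro: antisym)
qed

lemma left_shift: "1 \<le> k \<Longrightarrow> k \<le> l \<Longrightarrow> l \<le> p \<Longrightarrow> \<sigma> k + (l - k) \<le> \<sigma> l"
proof (induction l)
  case (Suc l)
  then show ?case using left[of l "Suc l"] by (cases "k = Suc l") auto
qed simp

lemma right_shift: "p < k \<Longrightarrow> k \<le> l \<Longrightarrow> l \<le> n \<Longrightarrow> \<sigma> k + (l - k) \<le> \<sigma> l"
proof (induction l)
  case (Suc l)
  then show ?case using right[of l "Suc l"] by (cases "k = Suc l") auto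
qed simp

text \<open>The extreme shuffle, which is the chamber of \<open>rho_tilde\<close>. Monotonicity on
  the blocks reduces the comparison of all right with all left values to that of
  \<open>\<sigma> n\<close> with \<open>\<sigma> 1\<close>.\<close>

lemma separated_iff:
  "(\<forall>k\<in>{1..p}. \<sigma> k = q + k) \<longleftrightarrow> \<sigma> n < \<sigma> 1"
  "\<sigma> n < \<sigma> 1 \<Longrightarrow> p < t \<Longrightarrow> t \<le> n \<Longrightarrow> \<sigma> t = t - p"
proof -
  have le: "\<sigma> 1 \<le> \<sigma> k" if "1 \<le> k" "k \<le> p" for k using left_shift[of 1 k] that by simp
  have le': "\<sigma> t \<le> \<sigma> n" if "p < t" "t \<le> n" for t using right_shift[of t n] that by simp
  show "(\<forall>k\<in>{1..p}. \<sigma> k = q + k) \<longleftrightarrow> \<sigma> n < \<sigma> 1"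
  proof
    assume "\<sigma> n < \<sigma> 1"
    then have "{t \<in> {p + 1..n}. \<sigma> t < \<sigma> k} = {p + 1..n}" if "1 \<le> k" "k \<le> p" for k
    proof -
      have "\<sigma> t < \<sigma> k" if "t \<in> {p + 1..n}" for t
        using le'[of t] that le[OF \<open>1 \<le> k\<close> \<open>k \<le> p\<close>] \<open>\<sigma> n < \<sigma> 1\<close> by simp
      then show ?thesis by blast
    qed
    then show "\<forall>k\<in>{1..p}. \<sigma> k = q + k" using left_rank n by auto
  next
    assume *: "\<forall>k\<in>{1..p}. \<sigma> k = q + k"
    then have "card {t \<in> {p + 1..n}. \<sigma> t < \<sigma> 1} = card {p + 1..n}"
      using left_rank[of 1] p n by auto
    then have eq: "{t \<in> {p + 1..n}. \<sigma> t < \<sigma> 1} = {p + 1..n}" by (intro card_subset_eq) auto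
    have "n \<in> {p + 1..n}" using n q by simp
    then have "n \<in> {t \<in> {p + 1..n}. \<sigma> t < \<sigma> 1}" by (simp only: eq)
    then show "\<sigma> n < \<sigma> 1" by simp
  qed
  show "\<sigma> t = t - p" if "\<sigma> n < \<sigma> 1" "p < t" "t \<le> n"
  proof -
    have "{k \<in> {1..p}. \<sigma> k < \<sigma> t} = {}"
      using le le'[OF that(2,3)] that(1) by fastforce
    then have "card {k \<in> {1..p}. \<sigma> k < \<sigma> t} = 0" by (simp only: card.empty)
    then show ?thesis using right_rank[OF that(2,3)] by (simp only: add_0_right)
  qed
qed

text \<open>The two runs fill one interval of values, so nothing else lies inside it: right
  positions before \<open>m\<close> have values below \<open>\<sigma> 1\<close>, left positions
  after \<open>j\<close> have values above \<open>\<sigma> n\<close>. The ranks give the rest;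
  \<open>n - m + 1\<close> is the length of the right run.\<close>

lemma edgeI:
  assumes j: "1 \<le> j" "j \<le> p" and m: "p < m" "m \<le> n"
    and run_left: "\<And>k. 1 \<le> k \<Longrightarrow> k \<le> j \<Longrightarrow> \<sigma> k = \<sigma> 1 + (k - 1)"
    and run_right: "\<And>t. m \<le> t \<Longrightarrow> t \<le> n \<Longrightarrow> \<sigma> t = \<sigma> m + (t - m)"
    and adj: "\<sigma> m = Suc (\<sigma> j)"
  shows "edge (n - m + 1) j"
proof -
  have "{t \<in> {p + 1..n}. \<sigma> t < \<sigma> 1} = {p + 1..<m}"
  proof (intro subset_antisym subsetI)
    fix t assume t: "t \<in> {t \<in> {p + 1..n}. \<sigma> t < \<sigma> 1}"
    show "t \<in> {p + 1..<m}"
    proof (rule ccontr)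
      assume "t \<notin> {p + 1..<m}"
      then have "\<sigma> m \<le> \<sigma> t" using t run_right[of t] by auto
      then show False using t adj run_left[of j] j by auto
    qed
  next
    fix t assume t: "t \<in> {p + 1..<m}"
    then have "\<sigma> t < Suc (\<sigma> j)" using right[of t m] m adj by auto
    moreover have "\<sigma> t \<notin> {\<sigma> 1..\<sigma> j}"
    proof
      assume *: "\<sigma> t \<in> {\<sigma> 1..\<sigma> j}"
      then have "\<sigma> (\<sigma> t - \<sigma> 1 + 1) = \<sigma> t"
        using run_left[of "\<sigma> t - \<sigma> 1 + 1"] run_left[of j] j by auto
      then have "\<sigma> t - \<sigma> 1 + 1 = t" by (simp add: eq_iff)
      then show False using * run_left[of j] j t by auto
    qed
    ultimately show "t \<in> {t \<in> {p + 1..n}. \<sigma> t < \<sigma> 1}" using t m by auto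
  qed
  then have s1: "\<sigma> 1 = m - p" using left_rank[of 1] p m by auto
  have "\<sigma> k = q + k" if k: "j < k" "k \<le> p" for k
  proof -
    have "\<sigma> n < \<sigma> k"
    proof (rule ccontr)
      assume "\<not> \<sigma> n < \<sigma> k"
      moreover have "\<sigma> m \<le> \<sigma> k" using left[of j k] k j adj by simp
      ultimately have "\<sigma> (m + (\<sigma> k - \<sigma> m)) = \<sigma> k"
        using run_right[of "m + (\<sigma> k - \<sigma> m)"] run_right[of n] m by auto
      then have "m + (\<sigma> k - \<sigma> m) = k" by (simp add: eq_iff)
      then show False using m k by simp
    qed
    then have "\<sigma> t < \<sigma> k" if "t \<in> {p + 1..n}" for t
      using add_leD1[OF right_shift[of t n]] that by simp
    then have "{t \<in> {p + 1..n}. \<sigma> t < \<sigma> k} = {p + 1..n}" by blast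
    then show ?thesis using left_rank[of k] k j n by auto
  qed
  moreover have "\<sigma> k = q - (n - m + 1) + k" if "1 \<le> k" "k \<le> j" for k
    using run_left[OF that] s1 m n that by simp
  moreover have "1 \<le> n - m + 1" "n - m + 1 \<le> q" using m n by simp_all
  ultimately show ?thesis
    unfolding edge_def using j by blast
qed

section \<open>Parameters in the chamber of a shuffle\<close>

context
  fixes \<mu> :: "nat \<Rightarrow> real" and \<Lambda> :: "nat \<Rightarrow> real"
  assumes mu: "g_dominant_integral n \<mu>"
  defines "\<Lambda> \<equiv> \<lambda>k. rho n (\<sigma> k) + \<mu> (\<sigma> k)"
begin

lemma mu_diff: "1 \<le> a \<Longrightarrow> a \<le> b \<Longrightarrow> b \<le> n \<Longrightarrow> \<mu> a - \<mu> b \<in> \<nat>"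
proof (induction b)
  case (Suc b)
  show ?case
  proof (cases "a = Suc b")
    case False
    then have "\<mu> a - \<mu> b \<in> \<nat>" "\<mu> b - \<mu> (Suc b) \<in> \<nat>"
      using Suc mu by (auto simp: g_dominant_integral_def)
    then show ?thesis using Nats_add by fastforce
  qed simp
qed simp

lemma Lambda_diff:
  assumes "a \<in> {1..n}" "b \<in> {1..n}" "\<sigma> a \<le> \<sigma> b"
  shows "\<Lambda> a - \<Lambda> b = real (\<sigma> b - \<sigma> a) + (\<mu> (\<sigma> a) - \<mu> (\<sigma> b))" "\<mu> (\<sigma> a) - \<mu> (\<sigma> b) \<in> \<nat>"
    "\<mu> (\<sigma> a) - \<mu> (\<sigma> b) \<ge> 0"
proof -
  show "\<mu> (\<sigma> a) - \<mu> (\<sigma> b) \<in> \<nat>" using assms sigma_range mu_diff by auto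
  then show "\<mu> (\<sigma> a) - \<mu> (\<sigma> b) \<ge> 0" by (auto elim!: Nats_cases)
  show "\<Lambda> a - \<Lambda> b = real (\<sigma> b - \<sigma> a) + (\<mu> (\<sigma> a) - \<mu> (\<sigma> b))"
    using assms by (simp add: \<Lambda>_def rho_def of_nat_diff)
qed

definition lam :: "nat \<Rightarrow> real" where
  "lam k = \<Lambda> k - rho n k"

lemma lam_left:
  assumes "1 \<le> k" "k \<le> l" "l \<le> p"
  shows "lam k - lam l \<in> \<nat>"
proof -
  have le: "\<sigma> k + (l - k) \<le> \<sigma> l" using left_shift assms by simp
  have "k \<in> {1..n}" "l \<in> {1..n}" using assms n by auto
  note d = Lambda_diff[OF this]
  have "lam k - lam l = real (\<sigma> l - \<sigma> k - (l - k)) + (\<mu> (\<sigma> k) - \<mu> (\<sigma> l))"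
    using d(1) le assms by (simp add: lam_def rho_def of_nat_diff)
  then show ?thesis using d(2) le Nats_add of_nat_in_Nats by (metis add_leD1)
qed

lemma lam_right:
  assumes "p < k" "k \<le> l" "l \<le> n"
  shows "lam k - lam l \<in> \<nat>"
proof -
  have le: "\<sigma> k + (l - k) \<le> \<sigma> l" using right_shift assms by simp
  have "k \<in> {1..n}" "l \<in> {1..n}" using assms n by auto
  note d = Lambda_diff[OF this]
  have "lam k - lam l = real (\<sigma> l - \<sigma> k - (l - k)) + (\<mu> (\<sigma> k) - \<mu> (\<sigma> l))"
    using d(1) le assms by (simp add: lam_def rho_def of_nat_diff)
  then show ?thesis using d(2) le Nats_add of_nat_in_Nats by (metis add_leD1)
qed

text \<open>Reads off the data of the Fock space construction from \<open>lam\<close>, with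
  \<open>lam n\<close> as the constant and \<open>r + s\<close> columns. As \<open>lam 1\<close> is
  the largest left coordinate, \<open>D\<close> makes all entries of \<open>A\<close>
  nonnegative.\<close>

lemma unitaryI:
  assumes rs: "r \<le> p" "s \<le> q"
    and D: "lam n - lam 1 - real (r + s) \<in> \<nat>"
    and left_eq: "\<And>k. 1 \<le> k \<Longrightarrow> k \<le> p - r \<Longrightarrow> lam k = lam n - real (r + s)"
    and right_eq: "\<And>t. p + s < t \<Longrightarrow> t \<le> n \<Longrightarrow> lam t = lam n"
  shows "unitary_parameter p q \<Lambda>"
proof -
  \<comment> \<open>The floors only convert natural numbers given as reals. Monotonicity is also
    required at index 0 and, for \<open>B\<close>, beyond \<open>q\<close>; this dictates the
    default values.\<close>
  define A where "A k = (if k = 0 then 0 else nat \<lfloor>lam n - lam k - real (r + s)\<rfloor>)" for k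
  define B where "B t = (if t \<le> q then nat \<lfloor>lam (p + max t 1) - lam n\<rfloor> else 0)" for t
  have nat_floor: "real (nat \<lfloor>x\<rfloor>) = x" if "x \<in> \<nat>" for x :: real
    using that by (auto elim!: Nats_cases)
  have ge0: "x \<ge> 0" if "x \<in> \<nat>" for x :: real using that by (auto elim!: Nats_cases)
  have AN: "lam n - lam k - real (r + s) \<in> \<nat>" if "1 \<le> k" "k \<le> p" for k
    using Nats_add[OF D lam_left[of 1 k]] that by (simp add: algebra_simps)
  have BN: "lam (p + t) - lam n \<in> \<nat>" if "1 \<le> t" "t \<le> q" for t
    using lam_right[of "p + t" n] that n by simp
  show ?thesis
  proof (rule unitary_parameter_hwv[of p r s q A B, OF p rs])
    fix i j assume ij: "i \<le> j" "j \<le> p"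
    show "A i \<le> A j"
    proof (cases "i = 0")
      case False
      then have "lam j \<le> lam i" using ge0[OF lam_left[of i j]] ij by simp
      then show ?thesis using False ij by (auto simp: A_def intro!: nat_mono floor_mono)
    qed (simp add: A_def)
  next
    fix i assume "i \<le> p - r"
    then show "A i = 0" using left_eq[of i] by (simp add: A_def)
  next
    fix i j :: nat assume ij: "i \<le> j"
    show "B j \<le> B i"
    proof (cases "j \<le> q")
      case True
      then have "lam (p + max j 1) \<le> lam (p + max i 1)"
        using ge0[OF lam_right[of "p + max i 1" "p + max j 1"]] ij n q by simp
      then show ?thesis using True ij by (auto simp: B_def intro!: nat_mono floor_mono)
    qed (simp add: B_def)
  next
    fix i assume i: "i > s"
    have "lam (p + i) = lam n" if "i \<le> q" using right_eq[of "p + i"] n i that by simp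
    then show "B i = 0" using i by (simp add: B_def max_absorb1)
  next
    fix k assume k: "1 \<le> k" "k \<le> p"
    then show "\<Lambda> k - rho (p + q) k = lam n - real (A k) - real (r + s)"
      using nat_floor[OF AN[OF k]] by (simp add: A_def lam_def n[symmetric])
  next
    fix k assume k: "1 \<le> k" "k \<le> q"
    then show "\<Lambda> (p + k) - rho (p + q) (p + k) = lam n + real (B k)"
      using nat_floor[OF BN[OF k]] by (simp add: B_def lam_def max_absorb1 n[symmetric])
  qed
qed

text \<open>Coordinates \<open>n\<close> and \<open>1\<close> carry the neighbouring values
  \<open>\<sigma> n = q\<close> and \<open>\<sigma> 1 = q + 1\<close>, so
  \<open>lam n - lam 1\<close> exceeds \<open>p + q\<close> by a difference of neighbouring
  coordinates of \<open>\<mu>\<close>, which is never negative.\<close>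

lemma unitary_separated:
  assumes "\<sigma> n < \<sigma> 1"
  shows "unitary_parameter p q \<Lambda>"
proof (rule unitaryI[of p q])
  have "\<forall>k\<in>{1..p}. \<sigma> k = q + k" using separated_iff(1) assms by blast
  then have "\<sigma> 1 = q + 1" using p by simp
  moreover have "\<sigma> n = q" using separated_iff(2)[OF assms, of n] q n by simp
  moreover have "n \<in> {1..n}" "1 \<in> {1..n}" using p n by auto
  note d = Lambda_diff[OF this]
  ultimately have "lam n - lam 1 - real (p + q) = \<mu> (\<sigma> n) - \<mu> (\<sigma> 1)"
    using d(1) p by (simp add: lam_def rho_def n[symmetric])
  then show "lam n - lam 1 - real (p + q) \<in> \<nat>" using d(2) assms by simp
qed (use n in auto)

text \<open>Under \<open>red\<close> the difference \<open>lam n - lam 1\<close> is exactly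
  \<open>p + q - i - j\<close>. With that many columns the coordinates in the two runs become zero
  entries of \<open>A\<close> and \<open>B\<close>, leaving at most \<open>p - j\<close> and
  \<open>q - i\<close> others.\<close>

lemma unitary_edge:
  assumes e: "edge i j" and red: "\<forall>a \<in> {1..j} \<union> {n - i + 1..n}. \<forall>b \<in> {1..j} \<union> {n - i + 1..n}. \<mu> (\<sigma> a) = \<mu> (\<sigma> b)"
  shows "unitary_parameter p q \<Lambda>"
proof (rule unitaryI[of "p - j" "q - i"])
  have ij: "1 \<le> i" "i \<le> q" "1 \<le> j" "j \<le> p" using e by (auto simp: edge_def)
  have sn: "\<sigma> n = q + j" using edge_right[OF e, of n] ij n p by auto
  have lamL: "lam k = lam n - real (p - j + (q - i))" if k: "1 \<le> k" "k \<le> j" for k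
  proof -
    have "\<sigma> k = q - i + k" using e k by (auto simp: edge_def)
    moreover have "\<mu> (\<sigma> k) = \<mu> (\<sigma> n)" using red k ij n by auto
    ultimately show ?thesis
      using sn ij n k unfolding lam_def \<Lambda>_def rho_def by (simp add: of_nat_diff)
  qed
  then show "lam n - lam 1 - real (p - j + (q - i)) \<in> \<nat>" using ij by simp
  show "lam k = lam n - real (p - j + (q - i))" if "1 \<le> k" "k \<le> p - (p - j)" for k
    using lamL that ij by simp
  show "lam t = lam n" if t: "p + (q - i) < t" "t \<le> n" for t
  proof -
    have "\<sigma> t = t - p + j" using edge_right[OF e, of t] t ij n by auto
    moreover have "\<mu> (\<sigma> t) = \<mu> (\<sigma> n)" using red t ij n by auto
    ultimately show ?thesis
      using sn ij n t unfolding lam_def \<Lambda>_def rho_def by (simp add: of_nat_diff)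
  qed
qed auto

lemma unitary_imp:
  assumes "unitary_parameter p q \<Lambda>" and "\<not> \<sigma> n < \<sigma> 1"
  shows "\<exists>i j. edge i j \<and>
    (\<forall>a \<in> {1..j} \<union> {n - i + 1..n}. \<forall>b \<in> {1..j} \<union> {n - i + 1..n}. \<mu> (\<sigma> a) = \<mu> (\<sigma> b))"
proof -
  have s1n: "\<sigma> 1 < \<sigma> n" using assms(2) eq_iff[of 1 n] p q n by (auto simp: not_less le_less)
  \<comment> \<open>\<open>j\<close> and \<open>m\<close> will be the inner ends of the maximal runs
    of consecutive coordinates that start at \<open>1\<close> and end at \<open>n\<close>;
    maximality provides the gaps required by the bound.\<close>
  define P where "P j \<longleftrightarrow> 1 \<le> j \<and> j \<le> p \<and> (\<forall>k. 1 \<le> k \<longrightarrow> k \<le> j \<longrightarrow> \<Lambda> k = \<Lambda> 1 - (real k - 1))" for j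
  define j where "j = (GREATEST j. P j)"
  have "P 1" using p by (auto simp: P_def le_Suc_eq)
  moreover have le_p: "\<And>j'. P j' \<Longrightarrow> j' \<le> p" by (simp add: P_def)
  ultimately have Pj: "P j" and jmax: "\<And>j'. P j' \<Longrightarrow> j' \<le> j"
    unfolding j_def by (blast intro: GreatestI_nat Greatest_le_nat)+
  define Q where "Q m \<longleftrightarrow> p < m \<and> m \<le> n \<and> (\<forall>t. m \<le> t \<longrightarrow> t \<le> n \<longrightarrow> \<Lambda> t = \<Lambda> n + (real n - real t))" for m
  define m where "m = (LEAST m. Q m)"
  have "Q n" using n q by (auto simp: Q_def)
  then have Qm: "Q m" and mmin: "\<And>m'. Q m' \<Longrightarrow> m \<le> m'"
    unfolding m_def by (auto intro: LeastI Least_le)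
  have j: "1 \<le> j" "j \<le> p" and m: "p < m" "m \<le> n" using Pj Qm unfolding P_def Q_def by blast+
  have Lj: "\<Lambda> k = \<Lambda> 1 - (real k - 1)" if "1 \<le> k" "k \<le> j" for k using Pj that unfolding P_def by blast
  have Lm: "\<Lambda> t = \<Lambda> n + (real n - real t)" if "m \<le> t" "t \<le> n" for t using Qm that unfolding Q_def by blast
  have diff: "\<Lambda> a - \<Lambda> b \<ge> real (\<sigma> b - \<sigma> a)" if "a \<in> {1..n}" "b \<in> {1..n}" "\<sigma> a \<le> \<sigma> b" for a b
    using Lambda_diff[OF that] by simp
  have gapL: "\<Lambda> j - \<Lambda> c > 1" if c: "j < c" "c \<le> p" for c
  proof -
    have "\<Lambda> j - \<Lambda> (Suc j) \<ge> 1"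
      using diff[of j "Suc j"] left[of j "Suc j"] j c n by simp
    moreover have "\<Lambda> j - \<Lambda> (Suc j) \<noteq> 1"
    proof
      assume *: "\<Lambda> j - \<Lambda> (Suc j) = 1"
      have "P (Suc j)" unfolding P_def
      proof (intro conjI allI impI)
        fix k assume "1 \<le> k" "k \<le> Suc j"
        then show "\<Lambda> k = \<Lambda> 1 - (real k - 1)"
          using * Lj[of k] Lj[of j] j by (cases "k = Suc j") auto
      qed (use c in auto)
      then show False using jmax[of "Suc j"] by simp
    qed
    moreover have "\<Lambda> (Suc j) \<ge> \<Lambda> c"
      using diff[of "Suc j" c] add_leD1[OF left_shift[of "Suc j" c]] j c n by simp
    ultimately show ?thesis by simp
  qed
  have gapR: "\<Lambda> c - \<Lambda> m > 1" if c: "p < c" "c < m" for c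
  proof -
    have m1: "p < m - 1" "m - 1 < m" "m - 1 \<in> {1..n}" "m \<in> {1..n}" using m c by auto
    then have "\<Lambda> (m - 1) - \<Lambda> m \<ge> 1"
      using diff[OF m1(3,4)] right[OF m1(1,2) m(2)] by simp
    moreover have "\<Lambda> (m - 1) - \<Lambda> m \<noteq> 1"
    proof
      assume *: "\<Lambda> (m - 1) - \<Lambda> m = 1"
      have "Q (m - 1)" unfolding Q_def
      proof (intro conjI allI impI)
        fix t assume "m - 1 \<le> t" "t \<le> n"
        then show "\<Lambda> t = \<Lambda> n + (real n - real t)"
          using * Lm[of t] Lm[of m] m c by (cases "t = m - 1") (auto simp: of_nat_diff)
      qed (use c m in auto)
      then show False using mmin c by fastforce
    qed
    moreover have "c \<in> {1..n}" "\<sigma> c \<le> \<sigma> (m - 1)"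
      using add_leD1[OF right_shift[of c "m - 1"]] m c by auto
    then have "\<Lambda> c \<ge> \<Lambda> (m - 1)" using diff[OF _ m1(3), of c] by simp
    ultimately show ?thesis by simp
  qed
  have bound: "\<Lambda> j - \<Lambda> m \<le> 1"
    using unitary_parameter_bound[OF assms(1) j] m n gapL gapR by blast
  have run_left: "\<sigma> k = \<sigma> 1 + (k - 1)" if k: "1 \<le> k" "k \<le> j" for k
  proof -
    have "\<sigma> 1 + (k - 1) \<le> \<sigma> k" using left_shift[of 1 k] k j by simp
    moreover have "real (\<sigma> k - \<sigma> 1) \<le> real k - 1"
      using diff[of 1 k] Lj[OF k] k j n calculation by simp
    ultimately show ?thesis by linarith
  qed
  have run_right: "\<sigma> t = \<sigma> m + (t - m)" if t: "m \<le> t" "t \<le> n" for t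
  proof -
    have "\<sigma> m + (t - m) \<le> \<sigma> t" using right_shift[of m t] t m by simp
    moreover have "real (\<sigma> t - \<sigma> m) \<le> real t - real m"
      using diff[of m t] Lm[OF t] Lm[of m] t m n calculation by simp
    ultimately show ?thesis using t by linarith
  qed
  \<comment> \<open>Otherwise an interval of values filled by one run contains a value of the other
    block: \<open>\<sigma> m\<close> if it is at least \<open>\<sigma> 1\<close>, and else
    \<open>\<sigma> 1\<close>, because \<open>\<sigma> 1 < \<sigma> n\<close>.\<close>
  have "\<sigma> j < \<sigma> m"
  proof (rule ccontr)
    assume "\<not> \<sigma> j < \<sigma> m"
    then have mj: "\<sigma> m < \<sigma> j" using eq_iff[of j m] j m by (auto simp: not_less le_less)
    show False
    proof (cases "\<sigma> 1 \<le> \<sigma> m")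
      case True
      then have "\<sigma> (\<sigma> m - \<sigma> 1 + 1) = \<sigma> m"
        using run_left[of "\<sigma> m - \<sigma> 1 + 1"] run_left[of j] mj j by auto
      then have "\<sigma> m - \<sigma> 1 + 1 = m" by (simp add: eq_iff)
      then show False using run_left[of j] mj j m by auto
    next
      case False
      then have "\<sigma> (m + (\<sigma> 1 - \<sigma> m)) = \<sigma> 1"
        using run_right[of "m + (\<sigma> 1 - \<sigma> m)"] run_right[of n] s1n m by auto
      then have "m + (\<sigma> 1 - \<sigma> m) = 1" by (simp add: eq_iff)
      then show False using m p by simp
    qed
  qed
  moreover have jm: "j \<in> {1..n}" "m \<in> {1..n}" using j m n by auto
  \<comment> \<open>\<open>\<Lambda> j - \<Lambda> m\<close> is a positive integer plus a
    nonnegative difference of \<open>\<mu>\<close>; being at most 1, it forces the integer to be 1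
    and the difference to vanish.\<close>
  ultimately have adj: "\<sigma> m = Suc (\<sigma> j)" and mu_jm: "\<mu> (\<sigma> j) = \<mu> (\<sigma> m)"
    using bound Lambda_diff[OF jm] by auto
  have "\<mu> (\<sigma> k) = \<mu> (\<sigma> j)" if "1 \<le> k" "k \<le> j" for k
    using Lj[OF that] Lj[of j] run_left[OF that] run_left[of j] that j by (simp add: \<Lambda>_def rho_def of_nat_diff)
  moreover have "\<mu> (\<sigma> t) = \<mu> (\<sigma> j)" if "m \<le> t" "t \<le> n" for t
    using Lm[OF that] Lm[of m] run_right[OF that] that m mu_jm by (simp add: \<Lambda>_def rho_def of_nat_diff)
  ultimately have "\<mu> (\<sigma> a) = \<mu> (\<sigma> j)" if "a \<in> {1..j} \<union> {m..n}" for a using that by auto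
  moreover have "n - (n - m + 1) + 1 = m" using m by simp
  ultimately show ?thesis
    using edgeI[OF j m run_left run_right adj] by (intro exI[of _ "n - m + 1"] exI[of _ j]) simp
qed

end

end

section \<open>Dimension of the faces of the translation cone\<close>

text \<open>The fundamental weight with index \<open>t\<close>, in the representative with
  coordinate sum 0.\<close>

definition fund_weight :: "nat \<Rightarrow> nat \<Rightarrow> nat \<Rightarrow> real" where
  "fund_weight n t k = (if k \<in> {1..n} then (if k \<le> t then 1 else 0) - real t / real n else 0)"

lemma fund_weight_diff:
  assumes "1 \<le> k" "k < n"
  shows "fund_weight n t k - fund_weight n t (k + 1) = (if k = t then 1 else 0)"
  using assms by (auto simp: fund_weight_def)

lemma sum_fund_weight:
  assumes "t \<le> n" "n > 0"
  shows "(\<Sum>k=1..n. fund_weight n t k) = 0"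
proof -
  have "(\<Sum>k=1..n. fund_weight n t k) = (\<Sum>k=1..n. (if k \<le> t then 1 else 0) - real t / real n)"
    by (intro sum.cong) (auto simp: fund_weight_def)
  also have "\<dots> = (\<Sum>k=1..n. if k \<le> t then 1 else 0) - real t"
    using assms by (simp add: sum_subtractf)
  also have "(\<Sum>k=1..n. if k \<le> t then 1 else 0 :: real) = (\<Sum>k=1..t. 1)"
    using assms by (intro sum.mono_neutral_cong_right) auto
  finally show ?thesis by simp
qed

lemma fund_weight_cone:
  assumes "t \<le> n" "n > 0"
  shows "fund_weight n t \<in> translation_cone n"
  using assms sum_fund_weight[OF assms] fund_weight_diff[of _ n t]
  by (auto simp: translation_cone_def g_dominant_integral_def fund_weight_def)

lemma eq_from_differences:
  fixes f g :: "nat \<Rightarrow> real"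
  assumes d: "\<And>k. 1 \<le> k \<Longrightarrow> k < n \<Longrightarrow> f k - f (k + 1) = g k - g (k + 1)"
    and s: "(\<Sum>k=1..n. f k) = (\<Sum>k=1..n. g k)" and k: "k \<in> {1..n}"
  shows "f k = g k"
proof -
  have c: "f k - g k = f 1 - g 1" if "1 \<le> k" "k \<le> n" for k
    using that
  proof (induction k rule: dec_induct)
    case (step k)
    then show ?case using d[of k] by simp
  qed simp
  have "(\<Sum>k=1..n. f k - g k) = (\<Sum>k=1..n. f 1 - g 1)"
    by (intro sum.cong refl) (simp only: c atLeastAtMost_iff)
  then have "real n * (f 1 - g 1) = 0" using s by (simp add: sum_subtractf)
  then show ?thesis using c[of k] k by simp
qed

interpretation fsr: vector_space "fun_scale :: real \<Rightarrow> _"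
  by (rule vector_space_fun_scale)

lemma sum_fun_scale_apply: "(\<Sum>t\<in>T. fun_scale (c t) (f t)) k = (\<Sum>t\<in>T. c t * f t k)"
  by (induction T rule: infinite_finite_induct) (simp_all add: fun_scale_def)

lemma fund_weight_combination:
  assumes "finite T" "1 \<le> k" "k < n"
  shows "(\<Sum>t\<in>T. c t * fund_weight n t k) - (\<Sum>t\<in>T. c t * fund_weight n t (k + 1)) = (if k \<in> T then c k else 0)"
proof -
  have "(\<Sum>t\<in>T. c t * fund_weight n t k) - (\<Sum>t\<in>T. c t * fund_weight n t (k + 1)) =
      (\<Sum>t\<in>T. if k = t then c t else 0)"
    unfolding sum_subtractf[symmetric] right_diff_distrib[symmetric] fund_weight_diff[OF assms(2,3)]
    by (intro sum.cong) auto
  then show ?thesis using assms(1) by simp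
qed

text \<open>The fundamental weights with index in \<open>T\<close> form a basis of the span: their
  coefficients are the consecutive differences of \<open>\<mu>\<close>, and the differences outside
  \<open>T\<close> vanish on the face.\<close>

lemma cone_dim_face:
  assumes T: "T \<subseteq> {1..<n}" and n: "n > 0"
  shows "cone_dim {\<mu> \<in> translation_cone n. \<forall>k\<in>{1..<n} - T. \<mu> k = \<mu> (k + 1)} = card T"
  unfolding cone_dim_def
proof (rule fsr.dim_unique[of "fund_weight n ` T"])
  let ?F = "{\<mu> \<in> translation_cone n. \<forall>k\<in>{1..<n} - T. \<mu> k = \<mu> (k + 1)}"
  have finT: "finite T" using T finite_subset by blast
  have inj: "inj_on (fund_weight n) T"
  proof (rule inj_onI)
    fix s t assume st: "s \<in> T" "t \<in> T" "fund_weight n s = fund_weight n t"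
    then have "1 \<le> s" "s < n" using T by auto
    then show "s = t"
      using fund_weight_diff[of s n s] fund_weight_diff[of s n t] st(3) by (auto split: if_splits)
  qed
  show "card (fund_weight n ` T) = card T" by (rule card_image[OF inj])
  show "fund_weight n ` T \<subseteq> ?F"
  proof
    fix f assume "f \<in> fund_weight n ` T"
    then obtain t where t: "t \<in> T" "f = fund_weight n t" by blast
    then have "f \<in> translation_cone n" using fund_weight_cone[of t n] T n by auto
    moreover have "f k = f (k + 1)" if "k \<in> {1..<n} - T" for k
    proof -
      have "k \<noteq> t" using that t by blast
      then show ?thesis using fund_weight_diff[of k n t] that t by simp
    qed
    ultimately show "f \<in> ?F" by blast
  qed
  show "?F \<subseteq> fsr.span (fund_weight n ` T)"
  proof
    fix \<mu> assume mu: "\<mu> \<in> ?F"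
    define c where "c t = \<mu> t - \<mu> (t + 1)" for t
    have "\<mu> = (\<Sum>t\<in>T. fun_scale (c t) (fund_weight n t))"
    proof
      fix k
      show "\<mu> k = (\<Sum>t\<in>T. fun_scale (c t) (fund_weight n t)) k"
      proof (cases "k \<in> {1..n}")
        case True
        have "\<mu> k = (\<Sum>t\<in>T. c t * fund_weight n t k)"
        proof (rule eq_from_differences[OF _ _ True])
          fix k assume k: "1 \<le> k" "k < n"
          show "\<mu> k - \<mu> (k + 1) = (\<Sum>t\<in>T. c t * fund_weight n t k) - (\<Sum>t\<in>T. c t * fund_weight n t (k + 1))"
            unfolding fund_weight_combination[OF finT k] using mu k by (auto simp: c_def)
        next
          have "(\<Sum>k=1..n. \<Sum>t\<in>T. c t * fund_weight n t k) = (\<Sum>t\<in>T. c t * (\<Sum>k=1..n. fund_weight n t k))"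
            by (subst sum.swap) (simp add: sum_distrib_left)
          also have "\<dots> = 0"
          proof (intro sum.neutral ballI)
            fix t assume "t \<in> T"
            then have "t \<le> n" using T by auto
            then show "c t * (\<Sum>k=1..n. fund_weight n t k) = 0" using sum_fund_weight n by simp
          qed
          finally show "(\<Sum>k=1..n. \<mu> k) = (\<Sum>k=1..n. \<Sum>t\<in>T. c t * fund_weight n t k)"
            using mu by (simp add: translation_cone_def)
        qed
        then show ?thesis by (simp add: sum_fun_scale_apply)
      next
        case False
        then have "fund_weight n t k = 0" for t by (simp only: fund_weight_def if_False)
        then show ?thesis using mu False by (simp add: sum_fun_scale_apply translation_cone_def)
      qed
    qed
    also have "\<dots> \<in> fsr.span (fund_weight n ` T)"
      by (intro fsr.span_sum fsr.span_scale fsr.span_base) auto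
    finally show "\<mu> \<in> fsr.span (fund_weight n ` T)" .
  qed
  show "fsr.independent (fund_weight n ` T)"
  proof (rule fsr.independent_if_scalars_zero)
    show "finite (fund_weight n ` T)" using finT by simp
    fix u x assume u: "(\<Sum>x\<in>fund_weight n ` T. fun_scale (u x) x) = 0" and x: "x \<in> fund_weight n ` T"
    obtain t where t: "t \<in> T" "x = fund_weight n t" using x by blast
    have "(\<Sum>t\<in>T. fun_scale (u (fund_weight n t)) (fund_weight n t)) = 0"
      using u by (simp add: sum.reindex[OF inj])
    then have "(\<Sum>t\<in>T. u (fund_weight n t) * fund_weight n t k) = 0" for k
      using sum_fun_scale_apply[of "\<lambda>t. u (fund_weight n t)" "fund_weight n" T k] by simp
    then show "u x = 0"
      using fund_weight_combination[OF finT, of t n "\<lambda>t. u (fund_weight n t)"] t T by auto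
  qed
qed

section \<open>The classification\<close>

theorem theorem2p9:
  fixes p q n :: nat and w :: "nat \<Rightarrow> nat"
  assumes "1 \<le> p" and "p \<le> q" and "n = p + q"
    and "w \<in> W1 p n"
  shows
    "(\<forall>\<mu>. g_dominant_integral n \<mu> \<longrightarrow>
        (unitary_parameter p q (weyl_act w (\<lambda>k. rho n k + \<mu> k)) \<longleftrightarrow>
          (is_rho_tilde p q w \<or> (\<exists>i j. edge_point p q w i j)) \<and>
          (\<forall>i j. edge_point p q w i j \<longrightarrow> reduced_cond n w i j \<mu>)))
     \<and> (unitary_parameter p q (weyl_act w (rho n)) \<longleftrightarrow>
          is_rho_tilde p q w \<or> (\<exists>i j. edge_point p q w i j))
     \<and> (\<forall>i j. edge_point p q w i j \<longrightarrow>
          {\<mu> \<in> translation_cone n. unitary_parameter p q (weyl_act w (\<lambda>k. rho n k + \<mu> k))}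
            = {\<mu> \<in> translation_cone n. reduced_cond n w i j \<mu>}
          \<and> cone_dim {\<mu> \<in> translation_cone n. reduced_cond n w i j \<mu>} = p + q - i - j)
     \<and> (is_rho_tilde p q w \<longrightarrow>
          {\<mu> \<in> translation_cone n. unitary_parameter p q (weyl_act w (\<lambda>k. rho n k + \<mu> k))}
            = translation_cone n)"
proof -
  define \<sigma> where "\<sigma> = inv_into UNIV w"
  have w: "w permutes {1..n}" "k_dominant p n (weyl_act w (rho n))"
    using assms(4) by (auto simp: W1_def)
  have perm: "\<sigma> permutes {1..n}" unfolding \<sigma>_def using permutes_inv[OF w(1)] .
  have inj: "\<sigma> i = \<sigma> j \<longleftrightarrow> i = j" for i j using permutes_inj[OF perm] by (auto dest: injD)
  have mono: "\<sigma> i < \<sigma> j" if "compact_positive_root p n i j" for i j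
  proof -
    have "\<sigma> i \<le> \<sigma> j"
      using w(2) that by (auto simp: k_dominant_def weyl_act_def \<sigma>_def[symmetric] rho_def)
    moreover have "i \<noteq> j" using that by (auto simp: compact_positive_root_def)
    ultimately show ?thesis using inj[of i j] by (simp add: le_less)
  qed
  interpret shuffle p q n \<sigma>
    by unfold_locales (use assms perm mono in \<open>auto simp: compact_positive_root_def\<close>)
  have act: "weyl_act w x = (\<lambda>k. x (\<sigma> k))" for x by (simp add: weyl_act_def fun_eq_iff \<sigma>_def)
  have YD: "YD_row p q w k = real (q + k) - real (\<sigma> k)" if "k \<in> {1..p}" for k
    using that by (simp add: YD_row_def act rho_def rho_tilde_def)
  have edge_iff: "edge_point p q w i j \<longleftrightarrow> edge i j" for i j
  proof
    assume e: "edge i j"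
    then have "YD_row p q w k = (if k \<le> j then real i else 0)" if "k \<in> {1..p}" for k
      using YD[OF that] that by (auto simp: edge_def of_nat_diff)
    moreover from this e have "{k \<in> {1..p}. YD_row p q w k \<noteq> 0} = {1..j}"
      by (auto simp: edge_def split: if_splits)
    ultimately show "edge_point p q w i j"
      using e by (auto simp: edge_point_def edge_def)
  next
    assume e: "edge_point p q w i j"
    define S where "S = {k \<in> {1..p}. YD_row p q w k \<noteq> 0}"
    have S: "\<sigma> k = q - i + k" if "k \<in> S" for k
    proof -
      have "real (q + k) - real (\<sigma> k) = real i" "i \<le> q"
        using e that YD[of k] by (auto simp: S_def edge_point_def)
      then have "real (\<sigma> k) = real (q - i + k)" by (simp add: of_nat_diff)
      then show ?thesis by (simp only: of_nat_eq_iff)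
    qed
    have notS: "\<sigma> k = q + k" if "k \<in> {1..p}" "k \<notin> S" for k
      using that YD[of k] by (simp add: S_def of_nat_add[symmetric] del: of_nat_add)
    \<comment> \<open>\<open>edge_point\<close> only counts the nonzero rows. They are the first
      ones because a zero row above a nonzero one would contradict the growth of
      \<open>\<sigma>\<close> on the left block.\<close>
    have down: "k' \<in> S" if "k \<in> S" "k' \<in> {1..k}" for k k'
    proof (rule ccontr)
      assume "k' \<notin> S"
      moreover have k: "k \<le> p" "1 \<le> i" "i \<le> q" using that(1) e by (auto simp: S_def edge_point_def)
      ultimately have "\<sigma> k' = q + k'" using notS that by auto
      then show False using left_shift[of k' k] S[OF that(1)] that(2) k by simp
    qed
    have "S = {1..card S}"
    proof (cases "S = {}")
      case False
      have fin: "finite S" by (simp add: S_def)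
      have "S = {1..Max S}"
      proof (rule equalityI; rule subsetI)
        fix k assume "k \<in> S"
        then show "k \<in> {1..Max S}" using Max_ge[OF fin] by (auto simp: S_def)
      next
        fix k assume "k \<in> {1..Max S}"
        then show "k \<in> S" using down[OF Max_in[OF fin False]] by blast
      qed
      then show ?thesis by (metis card_atLeastAtMost diff_Suc_1)
    qed simp
    moreover have "card S = j" using e by (simp add: edge_point_def S_def)
    ultimately have Sj: "S = {1..j}" by simp
    show "edge i j"
      unfolding edge_def
      using e S notS unfolding Sj by (auto simp: edge_point_def)
  qed
  have rt_iff: "is_rho_tilde p q w \<longleftrightarrow> \<sigma> n < \<sigma> 1"
  proof
    assume r: "is_rho_tilde p q w"
    have "\<sigma> k = q + k" if "k \<in> {1..p}" for k
    proof -
      have "rho (p + q) (\<sigma> k) = rho_tilde p q k"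
        using r that by (simp add: is_rho_tilde_def act)
      then have "real (\<sigma> k) = real (q + k)"
        using that by (simp add: rho_def rho_tilde_def)
      then show ?thesis by (simp only: of_nat_eq_iff)
    qed
    then show "\<sigma> n < \<sigma> 1" using separated_iff(1) by blast
  next
    assume s: "\<sigma> n < \<sigma> 1"
    then have "\<forall>k\<in>{1..p}. \<sigma> k = q + k" using separated_iff(1) by blast
    then show "is_rho_tilde p q w"
      using separated_iff(2)[OF s] assms(3)
      by (auto simp: is_rho_tilde_def act rho_def rho_tilde_def of_nat_diff not_le)
  qed
  have rt_edge: "\<not> edge i j" if "\<sigma> n < \<sigma> 1" for i j
  proof
    assume "edge i j"
    then have "\<sigma> 1 = q - i + 1" "1 \<le> i" "i \<le> q" by (auto simp: edge_def)
    moreover have "\<sigma> 1 = q + 1" using separated_iff(1) that p by auto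
    ultimately show False by simp
  qed
  have red: "reduced_cond n w i j \<mu> \<longleftrightarrow>
     (\<forall>a \<in> {1..j} \<union> {n - i + 1..n}. \<forall>b \<in> {1..j} \<union> {n - i + 1..n}. \<mu> (\<sigma> a) = \<mu> (\<sigma> b))" for i j \<mu>
    by (simp only: reduced_cond_def act)
  have main: "unitary_parameter p q (weyl_act w (\<lambda>k. rho n k + \<mu> k)) \<longleftrightarrow>
          (is_rho_tilde p q w \<or> (\<exists>i j. edge_point p q w i j)) \<and>
          (\<forall>i j. edge_point p q w i j \<longrightarrow> reduced_cond n w i j \<mu>)" (is "?U \<longleftrightarrow> ?R")
    if mu: "g_dominant_integral n \<mu>" for \<mu>
  proof
    assume U: ?U
    show ?R
    proof (cases "\<sigma> n < \<sigma> 1")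
      case True
      then show ?thesis using rt_edge by (simp add: rt_iff edge_iff)
    next
      case False
      then obtain i j where ij: "edge i j" "reduced_cond n w i j \<mu>"
        using unitary_imp[OF mu] U unfolding act red by blast
      \<comment> \<open>Condition (2) quantifies over all pairs, but a point lies on an edge for one
        pair only.\<close>
      then show ?thesis using edge_unique unfolding edge_iff by blast
    qed
  next
    assume R: ?R
    show ?U
    proof (cases "\<sigma> n < \<sigma> 1")
      case True
      then show ?thesis using unitary_separated[OF mu] unfolding act by blast
    next
      case False
      then obtain i j where "edge i j" "reduced_cond n w i j \<mu>"
        using R unfolding rt_iff edge_iff by blast
      then show ?thesis using unitary_edge[OF mu] unfolding act red by blast
    qed
  qed
  have rho_case: "unitary_parameter p q (weyl_act w (rho n)) \<longleftrightarrow>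
          is_rho_tilde p q w \<or> (\<exists>i j. edge_point p q w i j)"
    using main[of "\<lambda>_. 0"] by (simp add: g_dominant_integral_def reduced_cond_def weyl_act_def)
  have cone: "\<mu> \<in> translation_cone n \<Longrightarrow> g_dominant_integral n \<mu>" for \<mu>
    by (simp add: translation_cone_def)
  have edge_cone: "{\<mu> \<in> translation_cone n. unitary_parameter p q (weyl_act w (\<lambda>k. rho n k + \<mu> k))}
            = {\<mu> \<in> translation_cone n. reduced_cond n w i j \<mu>}" if "edge_point p q w i j" for i j
    using main[OF cone] that edge_unique unfolding edge_iff by blast
  have dim: "cone_dim {\<mu> \<in> translation_cone n. reduced_cond n w i j \<mu>} = p + q - i - j"
    if e: "edge_point p q w i j" for i j
  proof -
    have e': "edge i j" using e by (simp add: edge_iff)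
    then have ij: "1 \<le> i" "i \<le> q" "1 \<le> j" "j \<le> p" by (auto simp: edge_def)
    \<comment> \<open>The free differences. As \<open>\<sigma>\<close> maps the index set of the
      condition onto the interval \<open>{q - i + 1..q + j}\<close>, the condition consists of
      \<open>i + j - 1\<close> equalities between neighbours and leaves
      \<open>n - 1 - (i + j - 1)\<close> differences free.\<close>
    define T where "T = {1..<n} - {q - i + 1..<q + j}"
    have img: "\<sigma> ` ({1..j} \<union> {n - i + 1..n}) = {q - i + 1..q + j}"
    proof (rule equalityI; rule subsetI)
      fix x assume "x \<in> \<sigma> ` ({1..j} \<union> {n - i + 1..n})"
      then obtain a where "a \<in> {1..j} \<union> {n - i + 1..n}" "x = \<sigma> a" by blast
      then show "x \<in> {q - i + 1..q + j}"
        using e' edge_right[OF e', of a] ij assms(3) by (auto simp: edge_def)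
    next
      fix x assume x: "x \<in> {q - i + 1..q + j}"
      show "x \<in> \<sigma> ` ({1..j} \<union> {n - i + 1..n})"
      proof (cases "x \<le> q - i + j")
        case True
        then have "\<sigma> (x - (q - i)) = x" using x e' by (auto simp: edge_def)
        then show ?thesis using x True by (intro image_eqI[of _ _ "x - (q - i)"]) auto
      next
        case False
        then have "\<sigma> (x + p - j) = x" using x edge_right[OF e', of "x + p - j"] ij assms(3) by auto
        then show ?thesis using x False ij assms(3) by (intro image_eqI[of _ _ "x + p - j"]) auto
      qed
    qed
    have "reduced_cond n w i j \<mu> \<longleftrightarrow> (\<forall>k\<in>{1..<n} - T. \<mu> k = \<mu> (k + 1))" for \<mu>
    proof -
      have nT: "{1..<n} - T = {q - i + 1..<q + j}" using ij assms(3) by (auto simp: T_def)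
      have "reduced_cond n w i j \<mu> \<longleftrightarrow> (\<forall>x\<in>{q - i + 1..q + j}. \<forall>y\<in>{q - i + 1..q + j}. \<mu> x = \<mu> y)"
        unfolding red img[symmetric] by blast
      also have "\<dots> \<longleftrightarrow> (\<forall>k\<in>{q - i + 1..<q + j}. \<mu> k = \<mu> (k + 1))"
      proof
        assume *: "\<forall>k\<in>{q - i + 1..<q + j}. \<mu> k = \<mu> (k + 1)"
        have const: "\<mu> x = \<mu> (q - i + 1)" if "q - i + 1 \<le> x" "x \<le> q + j" for x
          using that
        proof (induction x rule: dec_induct)
          case (step x)
          then have "\<mu> x = \<mu> (x + 1)" using * by simp
          then show ?case using step by simp
        qed simp
        show "\<forall>x\<in>{q - i + 1..q + j}. \<forall>y\<in>{q - i + 1..q + j}. \<mu> x = \<mu> y"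
        proof (intro ballI)
          fix x y assume "x \<in> {q - i + 1..q + j}" "y \<in> {q - i + 1..q + j}"
          then show "\<mu> x = \<mu> y" using const[of x] const[of y] by simp
        qed
      qed auto
      finally show ?thesis unfolding nT .
    qed
    then have "cone_dim {\<mu> \<in> translation_cone n. reduced_cond n w i j \<mu>} = card T"
      using cone_dim_face[of T n] assms(1,3) by (simp add: T_def)
    also have "card T = p + q - i - j"
    proof -
      have "{q - i + 1..<q + j} \<subseteq> {1..<n}" using ij assms(3) by auto
      then have "card T = (n - 1) - (q + j - (q - i + 1))"
        unfolding T_def by (subst card_Diff_subset) auto
      moreover have "q + j - (q - i + 1) = i + j - 1" using ij by linarith
      ultimately show ?thesis using ij assms(3) by linarith
    qed
    finally show ?thesis .
  qed
  have "{\<mu> \<in> translation_cone n. unitary_parameter p q (weyl_act w (\<lambda>k. rho n k + \<mu> k))}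
            = translation_cone n" if "is_rho_tilde p q w"
    using main[OF cone] that rt_edge unfolding rt_iff edge_iff by blast
  then show ?thesis using main rho_case edge_cone dim by blast
qed

end
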